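(* Let $(M,g)$ be a Lorentzian manifold with a Witt structure $TM=(V_{p_1}\oplus V_{p_1^*})\oplus V_{q_1}$, null frame $(\nu,\nu^* )$, dual forms $\sigma,\sigma^*$, $H=V_{q_1}$, and canonical Witt connection $\nabla$, as described in the context. Let $\lambda=(\lambda_1,\lambda_2)\in C^\infty(M,\mathbb{R}^2)$ and let $c\in\mathcal{C}_H$. For any variation $c_s$ of $c$ with fixed endpoints, $$\begin{aligned}\frac{\partial}{\partial s}E^\lambda(c_s)\Big|_{s=0}=\int_0^1\Big[&-g(\nabla_{\dot c}\dot c,w_H)+\lambda_1^c\,d\sigma(\dot c,w_H)+\lambda_2^c\,d\sigma^*(\dot c,w_H)\\&+\sigma(w)\Big(\dot{\lambda_1^c}-\lambda_1^c(\mathcal{L}_\nu\sigma)(\dot c)-\lambda_2^c(\mathcal{L}_\nu\sigma^* )(\dot c)+\tfrac12(\mathcal{L}_\nu g)(\dot c,\dot c)\Big)\\&+\sigma^*(w)\Big(\dot{\lambda_2^c}-\lambda_1^c(\mathcal{L}_{\nu^*}\sigma)(\dot c)-\lambda_2^c(\mathcal{L}_{\nu^*}\sigma^* )(\dot c)+\tfrac12(\mathcal{L}_{\nu^*}g)(\dot c,\dot c)\Big)\Big]dt,\end{aligned}$$ where $\lambda_i^c=\lambda_i\circ c$ and $w(t)=\frac{\partial}{\partial s}c_s(t)\big|_{s=0}$.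
   Context: **Setting.** $(M,g)$ is a Lorentzian manifold with a decomposition $TM=(V_{p_1}\oplus V_{p_1^*})\oplus V_{q_1}$, where $V_{p_1}\oplus V_{p_1^*}$ is $g$-orthogonal to $V_{q_1}$, $V_{p_1}$ and $V_{p_1^*}$ are trivial null line subbundles with $g|_{V_{p_1}\times V_{p_1^*}}$ non-degenerate, and $g|_{V_{q_1}}$ is positive definite. Fix global nowhere vanishing sections $\nu$ of $V_{p_1}$ and $\nu^*$ of $V_{p_1^*}$ with $g(\nu,\nu^* )=1$, and put $\sigma=g(\nu^*,\cdot)$, $\sigma^*=g(\nu,\cdot)$. Put $H=V_{q_1}=\mathrm{Ker}\,\sigma\cap\mathrm{Ker}\,\sigma^*$; $w_H$ denotes the $H$-component of $w$, so $w=w_H+\sigma(w)\nu+\sigma^*(w)\nu^*$. **Canonical Witt connection.** $\nabla$ is the unique affine connection with $\nabla g=0$ whose torsion $T(X,Y)=\nabla_XY-\nabla_YX-[X,Y]$ is, for $X,Y\in V_{q_1}$, $T(X,Y)=d\sigma(X,Y)\nu+d\sigma^*(X,Y)\nu^*$, $T(\nu,X)=d\sigma^*(\nu,X)\nu^*-\frac12(\mathcal{L}_Xg)(\nu,\nu^* )\nu+\mathcal{T}_{V_{q_1}}(\nu,X)$, $T(\nu^*,X)=d\sigma(\nu^*,X)\nu-\frac12(\mathcal{L}_Xg)(\nu,\nu^* )\nu^*+\mathcal{T}_{V_{q_1}}(\nu^*,X)$, $T(\nu,\nu^* )=-[\nu,\nu^*]_{V_{q_1}}$, where $\mathcal{T}_{V_{q_1}}(\nu,X),\mathcal{T}_{V_{q_1}}(\nu^*,X)\in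 V_{q_1}$ are given by $g(\mathcal{T}_{V_{q_1}}(\nu,X),Y)=\frac12(\mathcal{L}_\nu g)(X,Y)$ and $g(\mathcal{T}_{V_{q_1}}(\nu^*,X),Y)=\frac12(\mathcal{L}_{\nu^*}g)(X,Y)$. It preserves each of $V_{p_1},V_{p_1^*},V_{q_1}$. Convention: $d\alpha(X,Y)=X\alpha(Y)-Y\alpha(X)-\alpha([X,Y])$. **Curves and functionals.** For fixed $x,y\in M$, $\mathcal{C}$ is the set of smooth curves $c:[0,1]\to M$ with $c(0)=x$, $c(1)=y$, and $\mathcal{C}_H$ the subset of those with $\dot c(t)\in H_{c(t)}$ for all $t$. For $\lambda=(\lambda_1,\lambda_2)\in C^\infty(M,\mathbb{R}^2)$ put $\alpha^\lambda=\lambda_1\sigma+\lambda_2\sigma^*$ and, for $c\in\mathcal{C}$, $$E^\lambda(c)=\frac12\int_0^1g(\dot c,\dot c)\,dt-\int_0^1\alpha^\lambda(\dot c)\,dt.$$ A variation of $c$ with fixed endpoints is a smooth map $F:(-\epsilon,\epsilon)\times[0,1]\to M$ with $F(0,t)=c(t)$, $F(s,0)=c(0)$, $F(s,1)=c(1)$; one writes $c_s(t)=F(s,t)$. *)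

theory Defs
  imports "HOL-Analysis.Analysis" "HOL-Library.Function_Algebras"
begin

section \<open>Pointwise real vector space structure on functions\<close>

text \<open>Tangent vectors are represented below as operators on real functions; they are added and
  scaled pointwise.\<close>

instantiation "fun" :: (type, real_vector) real_vector
begin

definition scaleR_fun :: "real \<Rightarrow> ('a \<Rightarrow> 'b) \<Rightarrow> 'a \<Rightarrow> 'b" where
  "scaleR_fun r f = (\<lambda>x. r *\<^sub>R f x)"

instance
  by standard (auto simp: scaleR_fun_def plus_fun_def fun_eq_iff scaleR_add_right scaleR_add_left)

end


section \<open>Smooth manifolds\<close>

text \<open>All iterated directional derivatives up to order \<open>k\<close> exist and are continuous.\<close>

fun Ck_on :: "nat \<Rightarrow> ('a::euclidean_space \<Rightarrow> 'b::real_normed_vector) \<Rightarrow> 'a set \<Rightarrow> bool" where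
  "Ck_on 0 f S \<longleftrightarrow> continuous_on S f"
| "Ck_on (Suc k) f S \<longleftrightarrow> (\<forall>x\<in>S. f differentiable (at x)) \<and>
     (\<forall>v. Ck_on k (\<lambda>x. frechet_derivative f (at x) v) S)"

definition smooth_on :: "'a::euclidean_space set \<Rightarrow> ('a \<Rightarrow> 'b::real_normed_vector) \<Rightarrow> bool" where
  "smooth_on S f \<longleftrightarrow> open S \<and> (\<forall>k. Ck_on k f S)"

text \<open>A chart is a pair \<open>(U, \<phi>)\<close>; only the values of \<open>\<phi>\<close> on \<open>U\<close> matter. The manifold is the
  whole type \<open>'m\<close>, and atlases need not be maximal.\<close>

type_synonym ('m, 'e) atlas = "('m set \<times> ('m \<Rightarrow> 'e)) set"

definition smooth_atlas ::
    "('m::{t2_space,second_countable_topology}, 'e::euclidean_space) atlas \<Rightarrow> bool" where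
  "smooth_atlas A \<longleftrightarrow>
     (\<Union>(U, \<phi>)\<in>A. U) = UNIV \<and>
     (\<forall>(U, \<phi>)\<in>A. open U \<and> open (\<phi> ` U) \<and> homeomorphism U (\<phi> ` U) \<phi> (inv_into U \<phi>)) \<and>
     (\<forall>(U, \<phi>)\<in>A. \<forall>(V, \<psi>)\<in>A. smooth_on (\<phi> ` (U \<inter> V)) (\<psi> \<circ> inv_into U \<phi>))"

definition smooth_fun_on ::
    "('m::topological_space, 'e::euclidean_space) atlas \<Rightarrow> 'm set \<Rightarrow>
     ('m \<Rightarrow> 'b::real_normed_vector) \<Rightarrow> bool" where
  "smooth_fun_on A W f \<longleftrightarrow> open W \<and>
     (\<forall>(U, \<phi>)\<in>A. smooth_on (\<phi> ` (W \<inter> U)) (f \<circ> inv_into U \<phi>))"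

definition smooth_near ::
    "('m::topological_space, 'e::euclidean_space) atlas \<Rightarrow> 'm \<Rightarrow>
     ('m \<Rightarrow> 'b::real_normed_vector) \<Rightarrow> bool" where
  "smooth_near A p f \<longleftrightarrow> (\<exists>W. p \<in> W \<and> smooth_fun_on A W f)"

definition smooth_map_open ::
    "('m::topological_space, 'e::euclidean_space) atlas \<Rightarrow> 'd::euclidean_space set \<Rightarrow>
     ('d \<Rightarrow> 'm) \<Rightarrow> bool" where
  "smooth_map_open A W G \<longleftrightarrow> open W \<and> continuous_on W G \<and>
     (\<forall>(U, \<phi>)\<in>A. smooth_on (W \<inter> G -` U) (\<phi> \<circ> G))"

text \<open>On a set that need not be open (such as \<open>{0..1}\<close>), smoothness means having, near each
  point of the set, a smooth extension to an open neighbourhood.\<close>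

definition smooth_map_on ::
    "('m::topological_space, 'e::euclidean_space) atlas \<Rightarrow> 'd::euclidean_space set \<Rightarrow>
     ('d \<Rightarrow> 'm) \<Rightarrow> bool" where
  "smooth_map_on A S F \<longleftrightarrow>
     (\<forall>a\<in>S. \<exists>W G. a \<in> W \<and> smooth_map_open A W G \<and> (\<forall>x\<in>S \<inter> W. F x = G x))"


section \<open>Tangent vectors and vector fields\<close>

text \<open>Two curves have the same velocity iff they differentiate all functions that are smooth near
  the point in the same way, so the velocity is identified with the operator \<open>f \<mapsto> (f \<circ> c)'(t)\<close>,
  extended by \<open>0\<close> to functions that are not smooth near \<open>c t\<close> in order that equality of operators
  is equality of tangent vectors. The parameter \<open>S\<close> is the domain of the curve: derivatives at
  end points are one-sided.\<close>

type_synonym 'm tvec = "('m \<Rightarrow> real) \<Rightarrow> real"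

type_synonym 'm vfield = "'m \<Rightarrow> 'm tvec"

definition velocity ::
    "('m::topological_space, 'e::euclidean_space) atlas \<Rightarrow> real set \<Rightarrow> (real \<Rightarrow> 'm) \<Rightarrow>
     real \<Rightarrow> 'm tvec" where
  "velocity A S c t =
     (\<lambda>f. if smooth_near A (c t) f then vector_derivative (f \<circ> c) (at t within S) else 0)"

definition tangent_space ::
    "('m::topological_space, 'e::euclidean_space) atlas \<Rightarrow> 'm \<Rightarrow> 'm tvec set" where
  "tangent_space A p = {v. \<exists>e>0. \<exists>c. smooth_map_on A {-e<..<e} c \<and> c 0 = p \<and>
     v = velocity A {-e<..<e} c 0}"

definition vfield_on ::
    "('m::topological_space, 'e::euclidean_space) atlas \<Rightarrow> 'm set \<Rightarrow> 'm vfield \<Rightarrow> bool" where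
  "vfield_on A U X \<longleftrightarrow> open U \<and> (\<forall>p\<in>U. X p \<in> tangent_space A p) \<and>
     (\<forall>W f. W \<subseteq> U \<and> smooth_fun_on A W f \<longrightarrow> smooth_fun_on A W (\<lambda>p. X p f))"

definition vfield_near ::
    "('m::topological_space, 'e::euclidean_space) atlas \<Rightarrow> 'm \<Rightarrow> 'm vfield \<Rightarrow> bool" where
  "vfield_near A p X \<longleftrightarrow> (\<exists>U. p \<in> U \<and> vfield_on A U X)"

definition lie_bracket ::
    "('m::topological_space, 'e::euclidean_space) atlas \<Rightarrow> 'm vfield \<Rightarrow> 'm vfield \<Rightarrow> 'm vfield" where
  "lie_bracket A X Y p =
     (\<lambda>f. if smooth_near A p f then X p (\<lambda>q. Y q f) - Y p (\<lambda>q. X q f) else 0)"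

definition coord_field ::
    "('m::topological_space, 'e::euclidean_space) atlas \<Rightarrow> 'm set \<Rightarrow> ('m \<Rightarrow> 'e) \<Rightarrow> 'e \<Rightarrow>
     'm vfield" where
  "coord_field A U \<phi> b p =
     (\<lambda>f. if smooth_near A p f then frechet_derivative (f \<circ> inv_into U \<phi>) (at (\<phi> p)) b else 0)"

definition smooth_subbundle ::
    "('m::topological_space, 'e::euclidean_space) atlas \<Rightarrow> nat \<Rightarrow> ('m \<Rightarrow> 'm tvec set) \<Rightarrow> bool" where
  "smooth_subbundle A r V \<longleftrightarrow>
     (\<forall>p. \<exists>U E. p \<in> U \<and> (\<forall>i<r. vfield_on A U (E i)) \<and>
        (\<forall>q\<in>U. inj_on (\<lambda>i. E i q) {..<r} \<and> independent ((\<lambda>i. E i q) ` {..<r}) \<and>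
               V q = span ((\<lambda>i. E i q) ` {..<r})))"

definition section_on ::
    "('m::topological_space, 'e::euclidean_space) atlas \<Rightarrow> 'm set \<Rightarrow> ('m \<Rightarrow> 'm tvec set) \<Rightarrow>
     'm vfield \<Rightarrow> bool" where
  "section_on A U V X \<longleftrightarrow> vfield_on A U X \<and> (\<forall>p\<in>U. X p \<in> V p)"


section \<open>Exterior and Lie derivatives\<close>

text \<open>Tensors given by a formula in vector fields are evaluated on tangent vectors at \<open>p\<close> by
  extending these to smooth vector fields near \<open>p\<close>; the value does not depend on the extension.\<close>

definition eval1 ::
    "('m::topological_space, 'e::euclidean_space) atlas \<Rightarrow> ('m vfield \<Rightarrow> 'm \<Rightarrow> real) \<Rightarrow>
     'm \<Rightarrow> 'm tvec \<Rightarrow> real" where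
  "eval1 A \<Phi> p u = (THE r. \<forall>X. vfield_near A p X \<and> X p = u \<longrightarrow> \<Phi> X p = r)"

definition eval2 ::
    "('m::topological_space, 'e::euclidean_space) atlas \<Rightarrow>
     ('m vfield \<Rightarrow> 'm vfield \<Rightarrow> 'm \<Rightarrow> real) \<Rightarrow> 'm \<Rightarrow> 'm tvec \<Rightarrow> 'm tvec \<Rightarrow> real" where
  "eval2 A \<Phi> p u v = (THE r. \<forall>X Y. vfield_near A p X \<and> vfield_near A p Y \<and>
     X p = u \<and> Y p = v \<longrightarrow> \<Phi> X Y p = r)"

type_synonym 'm oneform = "'m \<Rightarrow> 'm tvec \<Rightarrow> real"

type_synonym 'm bilform = "'m \<Rightarrow> 'm tvec \<Rightarrow> 'm tvec \<Rightarrow> real"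

definition ext_deriv ::
    "('m::topological_space, 'e::euclidean_space) atlas \<Rightarrow> 'm oneform \<Rightarrow> 'm bilform" where
  "ext_deriv A \<alpha> = eval2 A (\<lambda>X Y p.
     X p (\<lambda>q. \<alpha> q (Y q)) - Y p (\<lambda>q. \<alpha> q (X q)) - \<alpha> p (lie_bracket A X Y p))"

definition lie_form ::
    "('m::topological_space, 'e::euclidean_space) atlas \<Rightarrow> 'm vfield \<Rightarrow> 'm oneform \<Rightarrow>
     'm oneform" where
  "lie_form A Z \<alpha> = eval1 A (\<lambda>X p. Z p (\<lambda>q. \<alpha> q (X q)) - \<alpha> p (lie_bracket A Z X p))"

definition lie_metric ::
    "('m::topological_space, 'e::euclidean_space) atlas \<Rightarrow> 'm vfield \<Rightarrow> 'm bilform \<Rightarrow>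
     'm bilform" where
  "lie_metric A Z g = eval2 A (\<lambda>X Y p. Z p (\<lambda>q. g q (X q) (Y q))
     - g p (lie_bracket A Z X p) (Y p) - g p (X p) (lie_bracket A Z Y p))"


section \<open>Lorentzian metrics and Witt structures\<close>

definition lorentzian_metric ::
    "('m::topological_space, 'e::euclidean_space) atlas \<Rightarrow> 'm bilform \<Rightarrow> bool" where
  "lorentzian_metric A g \<longleftrightarrow>
     (\<forall>p. \<forall>u\<in>tangent_space A p. \<forall>v\<in>tangent_space A p. g p u v = g p v u) \<and>
     (\<forall>p a. \<forall>u\<in>tangent_space A p. \<forall>v\<in>tangent_space A p. \<forall>w\<in>tangent_space A p.
        g p (a *\<^sub>R u + v) w = a * g p u w + g p v w) \<and>
     (\<forall>U X Y. vfield_on A U X \<and> vfield_on A U Y \<longrightarrow> smooth_fun_on A U (\<lambda>p. g p (X p) (Y p))) \<and>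
     (\<forall>p. \<exists>(e :: 'e \<Rightarrow> 'm tvec). \<exists>b0\<in>Basis. span (e ` Basis) = tangent_space A p \<and>
        (\<forall>b\<in>Basis. \<forall>b'\<in>Basis.
           g p (e b) (e b') = (if b = b' then if b = b0 then -1 else 1 else 0)))"

text \<open>The null frame \<open>(\<nu>, \<nu>s)\<close> trivialises the line bundles \<open>Vp\<close> and \<open>Vps\<close>.\<close>

definition witt_structure ::
    "('m::topological_space, 'e::euclidean_space) atlas \<Rightarrow> 'm bilform \<Rightarrow>
     ('m \<Rightarrow> 'm tvec set) \<Rightarrow> ('m \<Rightarrow> 'm tvec set) \<Rightarrow> ('m \<Rightarrow> 'm tvec set) \<Rightarrow>
     'm vfield \<Rightarrow> 'm vfield \<Rightarrow> bool" where
  "witt_structure A g Vp Vps Vq \<nu> \<nu>s \<longleftrightarrow>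
     smooth_subbundle A 1 Vp \<and> smooth_subbundle A 1 Vps \<and> (\<exists>r. smooth_subbundle A r Vq) \<and>
     (\<forall>p. \<forall>v\<in>tangent_space A p.
        \<exists>!(x, y, z). x \<in> Vp p \<and> y \<in> Vps p \<and> z \<in> Vq p \<and> v = x + y + z) \<and>
     (\<forall>p. \<forall>x\<in>Vp p. \<forall>y\<in>Vps p. \<forall>z\<in>Vq p. g p (x + y) z = 0) \<and>
     (\<forall>p. \<forall>x\<in>Vp p. g p x x = 0) \<and> (\<forall>p. \<forall>y\<in>Vps p. g p y y = 0) \<and>
     (\<forall>p. \<forall>x\<in>Vp p. x \<noteq> 0 \<longrightarrow> (\<exists>y\<in>Vps p. g p x y \<noteq> 0)) \<and>
     (\<forall>p. \<forall>y\<in>Vps p. y \<noteq> 0 \<longrightarrow> (\<exists>x\<in>Vp p. g p x y \<noteq> 0)) \<and>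
     (\<forall>p. \<forall>z\<in>Vq p. z \<noteq> 0 \<longrightarrow> g p z z > 0) \<and>
     section_on A UNIV Vp \<nu> \<and> section_on A UNIV Vps \<nu>s \<and>
     (\<forall>p. \<nu> p \<noteq> 0) \<and> (\<forall>p. \<nu>s p \<noteq> 0) \<and>
     (\<forall>p. g p (\<nu> p) (\<nu>s p) = 1)"

definition flat :: "'m bilform \<Rightarrow> 'm vfield \<Rightarrow> 'm oneform" where
  "flat g X = (\<lambda>p v. g p (X p) v)"

text \<open>The suffix \<open>s\<close> stands for a star. The coframe dual to \<open>(\<nu>, \<nu>s)\<close> is \<open>\<sigma> = flat g \<nu>s\<close>,
  \<open>\<sigma>s = flat g \<nu>\<close>, so the \<open>Vq\<close>-component of \<open>w\<close> is \<open>w - \<sigma>(w) \<nu> - \<sigma>s(w) \<nu>s\<close>.\<close>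

definition hcomp :: "'m bilform \<Rightarrow> 'm vfield \<Rightarrow> 'm vfield \<Rightarrow> 'm \<Rightarrow> 'm tvec \<Rightarrow> 'm tvec" where
  "hcomp g \<nu> \<nu>s p w = w - flat g \<nu>s p w *\<^sub>R \<nu> p - flat g \<nu> p w *\<^sub>R \<nu>s p"


section \<open>Affine connections\<close>

text \<open>\<open>nabla p v Y\<close> is the covariant derivative of \<open>Y\<close> at \<open>p\<close> in direction \<open>v\<close>, where \<open>Y\<close> is a smooth
  vector field on some neighbourhood of \<open>p\<close>. The Leibniz rule implies that it only depends on the
  germ of \<open>Y\<close> at \<open>p\<close>, as a smooth function near \<open>p\<close> is arbitrary away from \<open>p\<close>.\<close>

type_synonym 'm connection = "'m \<Rightarrow> 'm tvec \<Rightarrow> 'm vfield \<Rightarrow> 'm tvec"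

definition affine_connection ::
    "('m::topological_space, 'e::euclidean_space) atlas \<Rightarrow> 'm connection \<Rightarrow> bool" where
  "affine_connection A nabla \<longleftrightarrow>
     (\<forall>p Y a. \<forall>u\<in>tangent_space A p. \<forall>v\<in>tangent_space A p. vfield_near A p Y \<longrightarrow>
        nabla p (a *\<^sub>R u + v) Y = a *\<^sub>R nabla p u Y + nabla p v Y) \<and>
     (\<forall>p Y Z. \<forall>v\<in>tangent_space A p. vfield_near A p Y \<and> vfield_near A p Z \<longrightarrow>
        nabla p v (\<lambda>q. Y q + Z q) = nabla p v Y + nabla p v Z) \<and>
     (\<forall>p Y f. \<forall>v\<in>tangent_space A p. vfield_near A p Y \<and> smooth_near A p f \<longrightarrow>
        nabla p v (\<lambda>q. f q *\<^sub>R Y q) = v f *\<^sub>R Y p + f p *\<^sub>R nabla p v Y) \<and>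
     (\<forall>U X Y. vfield_on A U X \<and> vfield_on A U Y \<longrightarrow> vfield_on A U (\<lambda>p. nabla p (X p) Y))"

definition metric_connection ::
    "('m::topological_space, 'e::euclidean_space) atlas \<Rightarrow> 'm bilform \<Rightarrow> 'm connection \<Rightarrow> bool" where
  "metric_connection A g nabla \<longleftrightarrow>
     (\<forall>p Y Z. \<forall>v\<in>tangent_space A p. vfield_near A p Y \<and> vfield_near A p Z \<longrightarrow>
        v (\<lambda>q. g q (Y q) (Z q)) = g p (nabla p v Y) (Z p) + g p (Y p) (nabla p v Z))"

definition torsion ::
    "('m::topological_space, 'e::euclidean_space) atlas \<Rightarrow> 'm connection \<Rightarrow> 'm vfield \<Rightarrow>
     'm vfield \<Rightarrow> 'm vfield" where
  "torsion A nabla X Y p = nabla p (X p) Y - nabla p (Y p) X - lie_bracket A X Y p"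

text \<open>The vector \<open>\<T>\<close> in \<open>Vq p\<close> with \<open>g(\<T>, y) = 1/2 (L\<^bsub>N\<^esub> g)(x, y)\<close> for all \<open>y\<close> in \<open>Vq p\<close>.\<close>

definition witt_T ::
    "('m::topological_space, 'e::euclidean_space) atlas \<Rightarrow> 'm bilform \<Rightarrow> ('m \<Rightarrow> 'm tvec set) \<Rightarrow>
     'm vfield \<Rightarrow> 'm \<Rightarrow> 'm tvec \<Rightarrow> 'm tvec" where
  "witt_T A g Vq N p x =
     (THE \<tau>. \<tau> \<in> Vq p \<and> (\<forall>y\<in>Vq p. g p \<tau> y = 1/2 * lie_metric A N g p x y))"

text \<open>These conditions determine the connection uniquely and imply that it preserves \<open>Vp\<close>, \<open>Vps\<close>
  and \<open>Vq\<close>.\<close>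

definition canonical_witt_connection ::
    "('m::topological_space, 'e::euclidean_space) atlas \<Rightarrow> 'm bilform \<Rightarrow> ('m \<Rightarrow> 'm tvec set) \<Rightarrow>
     'm vfield \<Rightarrow> 'm vfield \<Rightarrow> 'm connection \<Rightarrow> bool" where
  "canonical_witt_connection A g Vq \<nu> \<nu>s nabla \<longleftrightarrow>
     affine_connection A nabla \<and> metric_connection A g nabla \<and>
     (\<forall>U X Y. section_on A U Vq X \<and> section_on A U Vq Y \<longrightarrow> (\<forall>p\<in>U.
        torsion A nabla X Y p = ext_deriv A (flat g \<nu>s) p (X p) (Y p) *\<^sub>R \<nu> p
          + ext_deriv A (flat g \<nu>) p (X p) (Y p) *\<^sub>R \<nu>s p)) \<and>
     (\<forall>U X. section_on A U Vq X \<longrightarrow> (\<forall>p\<in>U.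
        torsion A nabla \<nu> X p = ext_deriv A (flat g \<nu>) p (\<nu> p) (X p) *\<^sub>R \<nu>s p
          - (1/2 * lie_metric A X g p (\<nu> p) (\<nu>s p)) *\<^sub>R \<nu> p
          + witt_T A g Vq \<nu> p (X p))) \<and>
     (\<forall>U X. section_on A U Vq X \<longrightarrow> (\<forall>p\<in>U.
        torsion A nabla \<nu>s X p = ext_deriv A (flat g \<nu>s) p (\<nu>s p) (X p) *\<^sub>R \<nu> p
          - (1/2 * lie_metric A X g p (\<nu> p) (\<nu>s p)) *\<^sub>R \<nu>s p
          + witt_T A g Vq \<nu>s p (X p))) \<and>
     (\<forall>p. torsion A nabla \<nu> \<nu>s p = - hcomp g \<nu> \<nu>s p (lie_bracket A \<nu> \<nu>s p))"

text \<open>Covariant derivative of a vector field \<open>Z\<close> along \<open>c\<close>: writing \<open>Z = \<Sum>b z\<^sub>b \<partial>\<^sub>b\<close> in the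
  coordinate frame of a chart around \<open>c t\<close>, with \<open>z\<^sub>b(s) = Z(s)(x\<^sub>b)\<close>, it is
  \<open>\<Sum>b z\<^sub>b' \<partial>\<^sub>b + z\<^sub>b nabla\<^bsub>c'\<^esub> \<partial>\<^sub>b\<close>. The result does not depend on the chart.\<close>

definition cov_deriv_along ::
    "('m::topological_space, 'e::euclidean_space) atlas \<Rightarrow> 'm connection \<Rightarrow> real set \<Rightarrow>
     (real \<Rightarrow> 'm) \<Rightarrow> (real \<Rightarrow> 'm tvec) \<Rightarrow> real \<Rightarrow> 'm tvec" where
  "cov_deriv_along A nabla S c Z t =
     (let (U, \<phi>) = (SOME ch. ch \<in> A \<and> c t \<in> fst ch) in
      \<Sum>b\<in>Basis.
        vector_derivative (\<lambda>s. Z s (\<lambda>q. \<phi> q \<bullet> b)) (at t within S) *\<^sub>R coord_field A U \<phi> b (c t)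
        + Z t (\<lambda>q. \<phi> q \<bullet> b) *\<^sub>R nabla (c t) (velocity A S c t) (coord_field A U \<phi> b))"


section \<open>Curves, energy and variations\<close>

definition curves ::
    "('m::topological_space, 'e::euclidean_space) atlas \<Rightarrow> 'm \<Rightarrow> 'm \<Rightarrow> (real \<Rightarrow> 'm) set" where
  "curves A x y = {c. smooth_map_on A {0..1} c \<and> c 0 = x \<and> c 1 = y}"

definition horizontal_curves ::
    "('m::topological_space, 'e::euclidean_space) atlas \<Rightarrow> ('m \<Rightarrow> 'm tvec set) \<Rightarrow> 'm \<Rightarrow> 'm \<Rightarrow>
     (real \<Rightarrow> 'm) set" where
  "horizontal_curves A H x y = {c \<in> curves A x y. \<forall>t\<in>{0..1}. velocity A {0..1} c t \<in> H (c t)}"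

definition energy ::
    "('m::topological_space, 'e::euclidean_space) atlas \<Rightarrow> 'm bilform \<Rightarrow> 'm vfield \<Rightarrow> 'm vfield \<Rightarrow>
     ('m \<Rightarrow> real \<times> real) \<Rightarrow> (real \<Rightarrow> 'm) \<Rightarrow> real" where
  "energy A g \<nu> \<nu>s lam c =
     1/2 * integral {0..1} (\<lambda>t. g (c t) (velocity A {0..1} c t) (velocity A {0..1} c t))
     - integral {0..1} (\<lambda>t. fst (lam (c t)) * flat g \<nu>s (c t) (velocity A {0..1} c t)
                           + snd (lam (c t)) * flat g \<nu> (c t) (velocity A {0..1} c t))"

definition fixed_endpoint_variation ::
    "('m::topological_space, 'e::euclidean_space) atlas \<Rightarrow> (real \<Rightarrow> 'm) \<Rightarrow> real \<Rightarrow>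
     (real \<times> real \<Rightarrow> 'm) \<Rightarrow> bool" where
  "fixed_endpoint_variation A c \<epsilon> F \<longleftrightarrow>
     \<epsilon> > 0 \<and> smooth_map_on A ({-\<epsilon><..<\<epsilon>} \<times> {0..1}) F \<and>
     (\<forall>t\<in>{0..1}. F (0, t) = c t) \<and>
     (\<forall>s\<in>{-\<epsilon><..<\<epsilon>}. F (s, 0) = c 0 \<and> F (s, 1) = c 1)"

end

theory Submission
  imports Defs
begin

text \<open>Write \<open>\<alpha> = \<lambda>\<^sub>1 \<sigma> + \<lambda>\<^sub>2 \<sigma>\<^sup>*\<close>, and let \<open>u\<close> be the velocity of \<open>c\<close> and \<open>w\<close> the variation field. The
  Lagrangian is smooth on the strip \<open>(-\<epsilon>, \<epsilon>) \<times> [0, 1]\<close>, so the energy may be differentiated under the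
  integral sign (\<open>locally_smooth_on_parametric_integral\<close>). At each time the derivative of the
  Lagrangian in the direction of the variation equals the claimed integrand plus the time derivative
  of \<open>g(u, w) - \<alpha>(w)\<close> (\<open>first_variation_pointwise\<close>). That function vanishes at both end points, where
  \<open>w = 0\<close>, so it contributes nothing to the integral.

  The pointwise identity has two parts. For the one-form it is
  \<open>w \<alpha>(u) - u \<alpha>(w) = d\<alpha>(w, u)\<close>: the terms with derivatives of the coefficients come from
  \<open>d\<alpha> = \<Sum> d\<lambda>\<^sub>i \<and> \<sigma>\<^sub>i + \<lambda>\<^sub>i d\<sigma>\<^sub>i\<close> and \<open>\<sigma>\<^sub>i(u) = 0\<close>, and the Lie derivatives from
  \<open>d\<sigma>\<^sub>i(u, \<nu>) = - (L\<^bsub>\<nu>\<^esub> \<sigma>\<^sub>i)(u)\<close>, which is Cartan's formula for the constant function \<open>\<sigma>\<^sub>i(\<nu>)\<close>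
  (\<open>ext_deriv_decomposition\<close>). For the kinetic term (\<open>first_variation_kinetic\<close>), metric compatibility
  gives \<open>w g(u, u)/2 - u g(u, w) = - g(\<nabla>\<^bsub>u\<^esub> u, w) + g(T(w, u), u)\<close>. The torsion of two horizontal
  vectors lies in the null plane, which is orthogonal to \<open>u\<close>, while \<open>g(T(\<nu>, u), u) = (L\<^bsub>\<nu>\<^esub> g)(u, u)/2\<close> by
  the definition of the connection; so only the null components of \<open>w\<close> contribute to the last term.
  Finally \<open>\<nabla>\<^bsub>u\<^esub> u\<close> is horizontal (\<open>acceleration_orthogonal\<close>), so \<open>w\<close> may be replaced by \<open>w\<^sub>H\<close> in the
  first term.

  Tangent vectors are operators on functions, and exterior derivatives, Lie derivatives and
  torsion are given by formulas in vector fields. Most of the work is therefore to express them in a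
  chart by the components of the metric, the Christoffel symbols and the first derivatives of
  coordinate representations, where the identities become multilinear algebra.\<close>


section \<open>Calculus of smooth functions\<close>

lemma Ck_on_SucD: "Ck_on (Suc k) f S \<Longrightarrow> Ck_on k f S"
proof (induction k arbitrary: f)
  case 0
  then show ?case
    by (auto intro!: continuous_at_imp_continuous_on differentiable_imp_continuous_within)
qed auto

lemma Ck_on_subset: "Ck_on k f S \<Longrightarrow> T \<subseteq> S \<Longrightarrow> Ck_on k f T"
  by (induction k arbitrary: f) (auto intro: continuous_on_subset)

lemma Ck_on_cong:
  assumes "Ck_on k f S" "open S" "\<And>x. x \<in> S \<Longrightarrow> f x = g x"
  shows "Ck_on k g S"
  using assms
proof (induction k arbitrary: f g)
  case 0
  then show ?case by (simp cong: continuous_on_cong)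
next
  case (Suc k)
  have d: "(g has_derivative frechet_derivative f (at x)) (at x)" if "x \<in> S" for x
    using Suc.prems that
    by (auto intro: has_derivative_transform_within_open simp: frechet_derivative_works)
  have "Ck_on k (\<lambda>x. frechet_derivative g (at x) v) S" for v
  proof (rule Suc.IH[OF _ \<open>open S\<close>])
    show "Ck_on k (\<lambda>x. frechet_derivative f (at x) v) S" using Suc.prems by simp
  qed (simp add: frechet_derivative_at[OF d, symmetric])
  then show ?case using d by (auto simp: differentiable_def)
qed

lemma Ck_on_derivI:
  assumes "open S" "\<And>x. x \<in> S \<Longrightarrow> (f has_derivative f' x) (at x)"
    and "\<And>v. Ck_on k (\<lambda>x. f' x v) S"
  shows "Ck_on (Suc k) f S"
proof -
  have "Ck_on k (\<lambda>x. frechet_derivative f (at x) v) S" for v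
    by (rule Ck_on_cong[OF assms(3)[of v] assms(1)])
      (simp add: frechet_derivative_at[OF assms(2), symmetric])
  then show ?thesis using assms(2) by (auto simp: differentiable_def)
qed

lemma Ck_on_SucE:
  assumes "Ck_on (Suc k) f S"
  shows "\<And>x. x \<in> S \<Longrightarrow> (f has_derivative frechet_derivative f (at x)) (at x)"
    and "\<And>v. Ck_on k (\<lambda>x. frechet_derivative f (at x) v) S"
  using assms by (auto simp: frechet_derivative_works)

lemma Ck_on_const: "open S \<Longrightarrow> Ck_on k (\<lambda>x. c) S"
  by (induction k arbitrary: c) auto

lemma Ck_on_bounded_linear:
  assumes "bounded_linear L" "open S" "Ck_on k f S"
  shows "Ck_on k (\<lambda>x. L (f x)) S"
  using assms(3)
proof (induction k arbitrary: f)
  case 0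
  then show ?case using assms(1) by (auto intro: bounded_linear.continuous_on)
next
  case (Suc k)
  note f = Ck_on_SucE[OF Suc.prems]
  show ?case
    by (rule Ck_on_derivI[OF \<open>open S\<close>, where f' = "\<lambda>x v. L (frechet_derivative f (at x) v)"])
      (auto intro!: bounded_linear.has_derivative[OF assms(1)] f Suc.IH)
qed

lemma Ck_on_add:
  assumes "open S" "Ck_on k f S" "Ck_on k g S"
  shows "Ck_on k (\<lambda>x. f x + g x) S"
  using assms(2,3)
proof (induction k arbitrary: f g)
  case 0
  then show ?case by (auto intro: continuous_on_add)
next
  case (Suc k)
  note f = Ck_on_SucE[OF Suc.prems(1)] and g = Ck_on_SucE[OF Suc.prems(2)]
  show ?case
    by (rule Ck_on_derivI[OF \<open>open S\<close>]) (rule has_derivative_add f g Suc.IH | assumption)+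
qed

lemma Ck_on_sum:
  assumes "open S" "\<And>i. i \<in> I \<Longrightarrow> Ck_on k (f i) S"
  shows "Ck_on k (\<lambda>x. \<Sum>i\<in>I. f i x) S"
  using assms(2)
  by (induction I rule: infinite_finite_induct) (auto intro!: Ck_on_const Ck_on_add assms(1))

lemma Ck_on_scaleR:
  fixes f :: "'a::euclidean_space \<Rightarrow> real"
  assumes "open S" "Ck_on k f S" "Ck_on k g S"
  shows "Ck_on k (\<lambda>x. f x *\<^sub>R g x) S"
  using assms(2,3)
proof (induction k arbitrary: f g)
  case 0
  then show ?case by (auto intro: continuous_on_scaleR)
next
  case (Suc k)
  note f = Ck_on_SucE[OF Suc.prems(1)] and g = Ck_on_SucE[OF Suc.prems(2)]
  show ?case
    by (rule Ck_on_derivI[OF \<open>open S\<close>])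
      (rule has_derivative_scaleR f g Ck_on_add \<open>open S\<close> Suc.IH Ck_on_SucD[OF Suc.prems(1)]
        Ck_on_SucD[OF Suc.prems(2)] | assumption)+
qed

lemma linear_basis_expand:
  fixes f' :: "'e::euclidean_space \<Rightarrow> 'b::real_vector"
  assumes "linear f'"
  shows "f' v = (\<Sum>b\<in>Basis. (v \<bullet> b) *\<^sub>R f' b)"
proof -
  have "f' v = f' (\<Sum>b\<in>Basis. (v \<bullet> b) *\<^sub>R b)" by (simp add: euclidean_representation)
  also have "\<dots> = (\<Sum>b\<in>Basis. (v \<bullet> b) *\<^sub>R f' b)"
    using assms by (simp add: linear_sum linear_cmul)
  finally show ?thesis .
qed

text \<open>Expanding the inner derivative in a basis writes the derivative of the composite as a sum of
  products of functions of order \<open>k\<close>, which is what makes the induction on the order work.\<close>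

lemma Ck_on_compose:
  fixes f :: "'e::euclidean_space \<Rightarrow> 'b::real_normed_vector" and g :: "'d::euclidean_space \<Rightarrow> 'e"
  assumes "open S" "Ck_on k f T" "Ck_on k g S" "\<And>x. x \<in> S \<Longrightarrow> g x \<in> T"
  shows "Ck_on k (\<lambda>x. f (g x)) S"
  using assms(2,3)
proof (induction k arbitrary: f)
  case 0
  then show ?case using assms(4) by (auto intro: continuous_on_compose2)
next
  case (Suc k)
  note f = Ck_on_SucE[OF Suc.prems(1)] and g = Ck_on_SucE[OF Suc.prems(2)]
  define f' where "f' = (\<lambda>x. frechet_derivative f (at x))"
  define g' where "g' = (\<lambda>x. frechet_derivative g (at x))"
  show ?case
  proof (rule Ck_on_derivI[OF \<open>open S\<close>, where f' = "\<lambda>x v. \<Sum>b\<in>Basis. (g' x v \<bullet> b) *\<^sub>R f' (g x) b"])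
    fix x assume x: "x \<in> S"
    have df: "(f has_derivative f' (g x)) (at (g x))" and dg: "(g has_derivative g' x) (at x)"
      using f g x assms(4) by (auto simp: f'_def g'_def)
    have "(\<lambda>v. f' (g x) (g' x v)) = (\<lambda>v. \<Sum>b\<in>Basis. (g' x v \<bullet> b) *\<^sub>R f' (g x) b)"
      by (rule ext, rule linear_basis_expand) (rule has_derivative_linear[OF df])
    then show "((\<lambda>x. f (g x)) has_derivative
        (\<lambda>v. \<Sum>b\<in>Basis. (g' x v \<bullet> b) *\<^sub>R f' (g x) b)) (at x)"
      using has_derivative_compose[OF dg df] by simp
  next
    fix v
    show "Ck_on k (\<lambda>x. \<Sum>b\<in>Basis. (g' x v \<bullet> b) *\<^sub>R f' (g x) b) S"
      unfolding f'_def g'_def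
      by (intro Ck_on_sum Ck_on_scaleR \<open>open S\<close> Suc.IH f Ck_on_SucD[OF Suc.prems(2)] g
          Ck_on_bounded_linear[OF bounded_linear_inner_left])
  qed
qed

lemma smooth_onD_open: "smooth_on S f \<Longrightarrow> open S"
  by (simp add: smooth_on_def)

lemma smooth_on_has_derivative:
  assumes "smooth_on S f" "x \<in> S"
  shows "(f has_derivative frechet_derivative f (at x)) (at x)"
proof -
  have "Ck_on (Suc 0) f S" using assms(1) unfolding smooth_on_def by (elim conjE allE)
  from Ck_on_SucE(1)[OF this assms(2)] show ?thesis .
qed

lemma smooth_on_frechet_derivative:
  "smooth_on S f \<Longrightarrow> smooth_on S (\<lambda>x. frechet_derivative f (at x) v)"
  unfolding smooth_on_def using Ck_on_SucE(2) by blast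

lemma smooth_on_continuous_on: "smooth_on S f \<Longrightarrow> continuous_on S f"
  unfolding smooth_on_def using Ck_on.simps(1) by blast

lemma smooth_on_subset: "smooth_on S f \<Longrightarrow> open T \<Longrightarrow> T \<subseteq> S \<Longrightarrow> smooth_on T f"
  by (auto simp: smooth_on_def intro: Ck_on_subset)

lemma smooth_on_cong: "smooth_on S f \<Longrightarrow> (\<And>x. x \<in> S \<Longrightarrow> f x = g x) \<Longrightarrow> smooth_on S g"
  by (auto simp: smooth_on_def intro: Ck_on_cong)

lemma smooth_on_const: "open S \<Longrightarrow> smooth_on S (\<lambda>x. c)"
  by (auto simp: smooth_on_def intro: Ck_on_const)

lemma smooth_on_id: "open S \<Longrightarrow> smooth_on S (\<lambda>x. x)"
proof -
  assume S: "open S"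
  have "Ck_on k (\<lambda>x. x) S" for k
    by (cases k) (auto intro!: Ck_on_derivI[OF S, where f' = "\<lambda>_ v. v"] Ck_on_const S)
  then show ?thesis using S by (auto simp: smooth_on_def)
qed

lemma smooth_on_bounded_linear:
  "bounded_linear L \<Longrightarrow> smooth_on S f \<Longrightarrow> smooth_on S (\<lambda>x. L (f x))"
  by (auto simp: smooth_on_def intro: Ck_on_bounded_linear)

lemma smooth_on_inner_left: "smooth_on S f \<Longrightarrow> smooth_on S (\<lambda>x. f x \<bullet> b)"
  by (rule smooth_on_bounded_linear[OF bounded_linear_inner_left])

lemma smooth_on_add: "smooth_on S f \<Longrightarrow> smooth_on S g \<Longrightarrow> smooth_on S (\<lambda>x. f x + g x)"
  by (auto simp: smooth_on_def intro: Ck_on_add)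

lemma smooth_on_sum:
  "open S \<Longrightarrow> (\<And>i. i \<in> I \<Longrightarrow> smooth_on S (f i)) \<Longrightarrow> smooth_on S (\<lambda>x. \<Sum>i\<in>I. f i x)"
  by (auto simp: smooth_on_def intro!: Ck_on_sum)

lemma smooth_on_scaleR:
  "smooth_on S f \<Longrightarrow> smooth_on S g \<Longrightarrow> smooth_on S (\<lambda>x. f x *\<^sub>R g x)"
  by (auto simp: smooth_on_def intro: Ck_on_scaleR)

lemma smooth_on_mult:
  fixes f g :: "'a::euclidean_space \<Rightarrow> real"
  shows "smooth_on S f \<Longrightarrow> smooth_on S g \<Longrightarrow> smooth_on S (\<lambda>x. f x * g x)"
  using smooth_on_scaleR[of S f g] by simp

lemma smooth_on_compose:
  assumes "smooth_on T f" "smooth_on S g" "\<And>x. x \<in> S \<Longrightarrow> g x \<in> T"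
  shows "smooth_on S (\<lambda>x. f (g x))"
  using assms by (auto simp: smooth_on_def intro: Ck_on_compose)

lemma frechet_derivative_inner_left:
  assumes "smooth_on S f" "x \<in> S"
  shows "frechet_derivative (\<lambda>x. f x \<bullet> b) (at x) v = frechet_derivative f (at x) v \<bullet> b"
proof -
  have "((\<lambda>x. f x \<bullet> b) has_derivative (\<lambda>v. frechet_derivative f (at x) v \<bullet> b)) (at x)"
    by (rule has_derivative_inner_left[OF smooth_on_has_derivative[OF assms]])
  then show ?thesis by (simp add: frechet_derivative_at[symmetric])
qed


section \<open>Symmetry of second derivatives\<close>

text \<open>By the mean value theorem, applied once in each direction, the second difference of \<open>f\<close> over
  a parallelogram with sides \<open>h a\<close> and \<open>h b\<close> is \<open>h\<^sup>2\<close> times a value of the iterated directional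
  derivative. Since the second difference is symmetric in \<open>a\<close> and \<open>b\<close>, so is its limit.\<close>

lemma second_difference_limit:
  fixes f :: "'a::euclidean_space \<Rightarrow> real"
  assumes f: "smooth_on S f" and x: "x \<in> S"
  defines "D v \<equiv> (\<lambda>x. frechet_derivative f (at x) v)"
  defines "\<Delta> a b h \<equiv> f (x + h *\<^sub>R a + h *\<^sub>R b) - f (x + h *\<^sub>R a) - f (x + h *\<^sub>R b) + f x"
  shows "((\<lambda>h. \<Delta> a b h / h\<^sup>2) \<longlongrightarrow> frechet_derivative (D a) (at x) b) (at_right 0)"
proof (rule tendstoI)
  fix e :: real assume e: "e > 0"
  define DD where "DD = (\<lambda>x. frechet_derivative (D a) (at x) b)"
  have Da: "smooth_on S (D a)" unfolding D_def by (rule smooth_on_frechet_derivative[OF f])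
  have "continuous_on S DD"
    unfolding DD_def by (rule smooth_on_continuous_on[OF smooth_on_frechet_derivative[OF Da]])
  then have "isCont DD x"
    using smooth_onD_open[OF f] x by (simp add: continuous_on_eq_continuous_at)
  then obtain d1 where d1: "d1 > 0" "\<And>z. dist z x < d1 \<Longrightarrow> dist (DD z) (DD x) < e"
    using e unfolding continuous_at_eps_delta by blast
  obtain d2 where d2: "d2 > 0" "ball x d2 \<subseteq> S"
    using smooth_onD_open[OF f] x open_contains_ball by blast
  \<comment> \<open>For \<open>h < d\<close> the parallelogram lies in both balls; the summand \<open>1\<close> avoids a division by zero.\<close>
  define d where "d = min d1 d2 / (norm a + norm b + 1)"
  have pos: "norm a + norm b + 1 > 0" by (smt (verit) norm_ge_zero)
  have d: "d > 0" unfolding d_def using d1 d2 pos by simp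
  have near: "dist (x + s *\<^sub>R a + t *\<^sub>R b) x < min d1 d2" if "0 \<le> s" "s \<le> h" "0 \<le> t" "t \<le> h" "h < d"
    for s t h
  proof -
    have "dist (x + s *\<^sub>R a + t *\<^sub>R b) x = norm (s *\<^sub>R a + t *\<^sub>R b)" by (simp add: dist_norm add.assoc)
    also have "\<dots> \<le> s * norm a + t * norm b"
      using that by (intro order_trans[OF norm_triangle_ineq]) simp
    also have "\<dots> \<le> h * norm a + h * norm b"
      using that by (intro add_mono mult_right_mono) auto
    also have "\<dots> \<le> h * (norm a + norm b + 1)" using that by (simp add: algebra_simps)
    also have "\<dots> < d * (norm a + norm b + 1)" using that pos by (intro mult_strict_right_mono)
    also have "\<dots> = min d1 d2" using pos by (simp add: d_def)
    finally show ?thesis .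
  qed
  have inS: "x + s *\<^sub>R a + t *\<^sub>R b \<in> S" if "0 \<le> s" "s \<le> h" "0 \<le> t" "t \<le> h" "h < d" for s t h
    using near[OF that] d2 by (auto simp: dist_commute subset_iff)
  have dir: "((\<lambda>s. F (p + s *\<^sub>R v)) has_real_derivative frechet_derivative F (at (p + s *\<^sub>R v)) v) (at s)"
    if F: "smooth_on S F" and p: "p + s *\<^sub>R v \<in> S" for F :: "'a \<Rightarrow> real" and p v s
  proof -
    have 1: "((\<lambda>s. p + s *\<^sub>R v) has_derivative (\<lambda>h. h *\<^sub>R v)) (at s)"
      by (auto intro!: derivative_eq_intros)
    note 2 = has_derivative_compose[OF 1 smooth_on_has_derivative[OF F p]]
    have "linear (frechet_derivative F (at (p + s *\<^sub>R v)))"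
      by (rule has_derivative_linear[OF smooth_on_has_derivative[OF F p]])
    then have "(\<lambda>h. frechet_derivative F (at (p + s *\<^sub>R v)) (h *\<^sub>R v))
        = (*) (frechet_derivative F (at (p + s *\<^sub>R v)) v)"
      by (auto simp: linear_cmul)
    then show ?thesis using 2 by (simp add: has_field_derivative_def)
  qed
  have "dist (\<Delta> a b h / h\<^sup>2) (DD x) < e" if h: "0 < h" "h < d" for h
  proof -
    have "\<exists>\<xi>>0. \<xi> < h \<and> (f ((x + h *\<^sub>R b) + h *\<^sub>R a) - f (x + h *\<^sub>R a)) -
        (f ((x + h *\<^sub>R b) + 0 *\<^sub>R a) - f (x + 0 *\<^sub>R a))
        = (h - 0) * (D a ((x + h *\<^sub>R b) + \<xi> *\<^sub>R a) - D a (x + \<xi> *\<^sub>R a))"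
      unfolding D_def
    proof (rule MVT2[OF \<open>0 < h\<close>])
      fix s assume s: "0 \<le> s" "s \<le> h"
      show "((\<lambda>s. f ((x + h *\<^sub>R b) + s *\<^sub>R a) - f (x + s *\<^sub>R a)) has_real_derivative
          frechet_derivative f (at ((x + h *\<^sub>R b) + s *\<^sub>R a)) a
          - frechet_derivative f (at (x + s *\<^sub>R a)) a) (at s)"
        using inS[of s h h] inS[of s h 0] s h
        by (intro DERIV_diff dir[OF f]) (auto simp: algebra_simps)
    qed
    then obtain \<xi> where xi: "0 < \<xi>" "\<xi> < h"
      "\<Delta> a b h = h * (D a ((x + \<xi> *\<^sub>R a) + h *\<^sub>R b) - D a ((x + \<xi> *\<^sub>R a) + 0 *\<^sub>R b))"
      by (auto simp: \<Delta>_def algebra_simps)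
    have "\<exists>\<eta>>0. \<eta> < h \<and> D a ((x + \<xi> *\<^sub>R a) + h *\<^sub>R b) - D a ((x + \<xi> *\<^sub>R a) + 0 *\<^sub>R b)
        = (h - 0) * DD ((x + \<xi> *\<^sub>R a) + \<eta> *\<^sub>R b)"
      unfolding DD_def
    proof (rule MVT2[OF \<open>0 < h\<close>])
      fix t assume t: "0 \<le> t" "t \<le> h"
      show "((\<lambda>t. D a ((x + \<xi> *\<^sub>R a) + t *\<^sub>R b)) has_real_derivative
          frechet_derivative (D a) (at ((x + \<xi> *\<^sub>R a) + t *\<^sub>R b)) b) (at t)"
        using inS[of \<xi> h t] t h xi by (intro dir[OF Da]) auto
    qed
    then obtain \<eta> where eta: "0 < \<eta>" "\<eta> < h" "\<Delta> a b h = h * (h * DD (x + \<xi> *\<^sub>R a + \<eta> *\<^sub>R b))"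
      using xi by auto
    have "\<Delta> a b h / h\<^sup>2 = DD (x + \<xi> *\<^sub>R a + \<eta> *\<^sub>R b)"
      using eta h by (simp add: power2_eq_square)
    then show ?thesis using d1(2) near[of \<xi> h \<eta>] xi eta h by auto
  qed
  then show "\<forall>\<^sub>F h in at_right 0. dist (\<Delta> a b h / h\<^sup>2) (frechet_derivative (D a) (at x) b) < e"
    using d unfolding eventually_at_right_field DD_def by blast
qed

lemma frechet_derivative_symmetric_real:
  fixes f :: "'a::euclidean_space \<Rightarrow> real"
  assumes f: "smooth_on S f" and x: "x \<in> S"
  shows "frechet_derivative (\<lambda>x. frechet_derivative f (at x) a) (at x) b
       = frechet_derivative (\<lambda>x. frechet_derivative f (at x) b) (at x) a"
proof (rule tendsto_unique[OF _ second_difference_limit[OF f x]])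
  show "((\<lambda>h. (f (x + h *\<^sub>R a + h *\<^sub>R b) - f (x + h *\<^sub>R a) - f (x + h *\<^sub>R b) + f x) / h\<^sup>2)
      \<longlongrightarrow> frechet_derivative (\<lambda>x. frechet_derivative f (at x) b) (at x) a) (at_right 0)"
    using second_difference_limit[OF f x, of b a] by (simp add: algebra_simps)
qed simp

lemma frechet_derivative_symmetric:
  fixes f :: "'a::euclidean_space \<Rightarrow> 'b::euclidean_space"
  assumes f: "smooth_on S f" and x: "x \<in> S"
  shows "frechet_derivative (\<lambda>x. frechet_derivative f (at x) a) (at x) b
       = frechet_derivative (\<lambda>x. frechet_derivative f (at x) b) (at x) a"
proof (rule euclidean_eqI)
  fix i :: 'b
  have *: "frechet_derivative (\<lambda>x. frechet_derivative f (at x) a) (at x) b \<bullet> i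
     = frechet_derivative (\<lambda>x. frechet_derivative (\<lambda>x. f x \<bullet> i) (at x) a) (at x) b" for a b
  proof -
    have "((\<lambda>x. frechet_derivative f (at x) a \<bullet> i) has_derivative
      (\<lambda>b. frechet_derivative (\<lambda>x. frechet_derivative f (at x) a) (at x) b \<bullet> i)) (at x)"
      by (intro has_derivative_inner_left smooth_on_has_derivative[OF _ x]
          smooth_on_frechet_derivative f)
    then have "((\<lambda>x. frechet_derivative (\<lambda>x. f x \<bullet> i) (at x) a) has_derivative
      (\<lambda>b. frechet_derivative (\<lambda>x. frechet_derivative f (at x) a) (at x) b \<bullet> i)) (at x)"
      by (rule has_derivative_transform_within_open[OF _ smooth_onD_open[OF f] x])
        (simp add: frechet_derivative_inner_left[OF f])
    then show ?thesis by (simp add: frechet_derivative_at[symmetric])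
  qed
  show "frechet_derivative (\<lambda>x. frechet_derivative f (at x) a) (at x) b \<bullet> i
       = frechet_derivative (\<lambda>x. frechet_derivative f (at x) b) (at x) a \<bullet> i"
    unfolding * by (rule frechet_derivative_symmetric_real[OF smooth_on_inner_left[OF f] x])
qed


section \<open>Integrals depending on a parameter\<close>

text \<open>The Lagrangian of a variation is a function on a strip that contains its two boundary lines. As
  for curves and variations, its smoothness there means having local smooth extensions.\<close>

definition locally_smooth_on ::
    "'a::euclidean_space set \<Rightarrow> ('a \<Rightarrow> 'b::real_normed_vector) \<Rightarrow> bool" where
  "locally_smooth_on S h \<longleftrightarrow>
     (\<forall>z\<in>S. \<exists>W k. z \<in> W \<and> smooth_on W k \<and> (\<forall>x\<in>S \<inter> W. h x = k x))"

lemma locally_smooth_on_continuous_on: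
  assumes "locally_smooth_on S h"
  shows "continuous_on S h"
  unfolding continuous_on_eq_continuous_within
proof
  fix z assume z: "z \<in> S"
  then obtain W k where W: "z \<in> W" "smooth_on W k" "\<forall>x\<in>S \<inter> W. h x = k x"
    using assms unfolding locally_smooth_on_def by blast
  have "isCont k z"
    using smooth_on_continuous_on[OF W(2)] smooth_onD_open[OF W(2)] W(1)
    by (simp add: continuous_on_eq_continuous_at)
  then have "continuous (at z within S) k" by (rule continuous_at_imp_continuous_at_within)
  moreover have "\<forall>\<^sub>F x in at z within S. k x = h x"
    unfolding eventually_at_topological
    using smooth_onD_open[OF W(2)] W(1,3) by (intro exI[of _ W]) auto
  ultimately show "continuous (at z within S) h"
    using W(1,3) z unfolding continuous_within by (auto elim!: Lim_transform_eventually)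
qed

lemma partial_derivative_of_extension:
  fixes k :: "real \<times> real \<Rightarrow> real"
  assumes k: "smooth_on W k" and z: "(s, t) \<in> W" "s \<in> I" "t \<in> J" "open I"
    and eq: "\<forall>x\<in>(I \<times> J) \<inter> W. h x = k x"
  shows "((\<lambda>s. h (s, t)) has_real_derivative frechet_derivative k (at (s, t)) (1, 0)) (at s)"
proof -
  let ?k' = "frechet_derivative k (at (s, t))"
  have 1: "((\<lambda>s. (s, t)) has_derivative (\<lambda>a. (a, 0))) (at s)"
    by (auto intro!: derivative_eq_intros)
  have k': "(k has_derivative ?k') (at (s, t))" by (rule smooth_on_has_derivative[OF k z(1)])
  have "(\<lambda>a. ?k' (a, 0)) = (*) (?k' (1, 0))"
  proof
    fix a
    have "?k' (a, 0) = ?k' (a *\<^sub>R (1, 0))" by simp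
    also have "\<dots> = a *\<^sub>R ?k' (1, 0)" by (rule linear_cmul[OF has_derivative_linear[OF k']])
    finally show "?k' (a, 0) = ?k' (1, 0) * a" by (simp add: mult.commute)
  qed
  then have 2: "((\<lambda>s. k (s, t)) has_real_derivative ?k' (1, 0)) (at s)"
    using has_derivative_compose[OF 1 k'] by (simp add: has_field_derivative_def)
  have "open ((\<lambda>s. (s, t)) -` W \<inter> I)"
    using smooth_onD_open[OF k] \<open>open I\<close>
    by (intro open_Int open_vimage continuous_intros)
  with 2 show ?thesis
    by (rule has_field_derivative_transform_within_open) (use z eq in auto)
qed

text \<open>The parameter ranges over an open interval, so the partial derivative with respect to it is that
  of any local extension. Hence it is again locally smooth, in particular continuous up to the
  boundary of the strip, which is what the Leibniz rule needs.\<close>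

lemma locally_smooth_on_parametric_integral:
  fixes h :: "real \<times> real \<Rightarrow> real"
  assumes h: "locally_smooth_on ({-\<epsilon><..<\<epsilon>} \<times> {0..1}) h" and eps: "\<epsilon> > 0"
  shows "((\<lambda>s. integral {0..1} (\<lambda>t. h (s, t))) has_real_derivative
           integral {0..1} (\<lambda>t. deriv (\<lambda>s. h (s, t)) 0)) (at 0)"
    and "(\<lambda>t. deriv (\<lambda>s. h (s, t)) 0) integrable_on {0..1}"
proof -
  let ?S = "{-\<epsilon><..<\<epsilon>} \<times> {0..1::real}"
  define h' where "h' = (\<lambda>(s, t). deriv (\<lambda>s. h (s, t)) s)"
  have ext: "\<exists>W k. z \<in> W \<and> smooth_on W k \<and> (\<forall>x\<in>?S \<inter> W. h x = k x)" if "z \<in> ?S" for z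
    using h that unfolding locally_smooth_on_def by blast
  have h'_eq: "h' x = frechet_derivative k (at x) (1, 0)"
    if * : "smooth_on W k" "\<forall>x\<in>?S \<inter> W. h x = k x" and ** : "x \<in> ?S \<inter> W" for W k x
  proof -
    obtain s t where x: "x = (s, t)" "(s, t) \<in> W" "s \<in> {-\<epsilon><..<\<epsilon>}" "t \<in> {0..1}"
      using ** by (cases x) auto
    show ?thesis
      unfolding h'_def x(1) prod.case
      by (rule DERIV_imp_deriv)
        (rule partial_derivative_of_extension[OF *(1) x(2-4) open_greaterThanLessThan *(2)])
  qed
  have d: "((\<lambda>s. h (s, t)) has_real_derivative h' (s, t)) (at s)" if st0: "(s, t) \<in> ?S" for s t
  proof -
    obtain W k where W: "(s, t) \<in> W" "smooth_on W k" "\<forall>x\<in>?S \<inter> W. h x = k x"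
      using ext[OF st0] by blast
    have st: "s \<in> {-\<epsilon><..<\<epsilon>}" "t \<in> {0..1}" using st0 by auto
    have "h' (s, t) = frechet_derivative k (at (s, t)) (1, 0)"
      using h'_eq[OF W(2,3)] W(1) st0 by blast
    then show ?thesis
      using partial_derivative_of_extension[OF W(2,1) st open_greaterThanLessThan W(3)] by simp
  qed
  have "locally_smooth_on ?S h'"
    unfolding locally_smooth_on_def
  proof
    fix z assume "z \<in> ?S"
    from ext[OF this] obtain W k where W: "z \<in> W" "smooth_on W k" "\<forall>x\<in>?S \<inter> W. h x = k x" by blast
    show "\<exists>W k. z \<in> W \<and> smooth_on W k \<and> (\<forall>x\<in>?S \<inter> W. h' x = k x)"
      by (rule exI[of _ W], rule exI[of _ "\<lambda>x. frechet_derivative k (at x) (1, 0)"])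
        (use W(1) smooth_on_frechet_derivative[OF W(2)] h'_eq[OF W(2,3)] in blast)
  qed
  then have c: "continuous_on ?S h'" by (rule locally_smooth_on_continuous_on)
  have slice: "continuous_on {0..1} (\<lambda>t. k (s, t))"
    if "continuous_on ?S k" "s \<in> {-\<epsilon><..<\<epsilon>}" for s and k :: "real \<times> real \<Rightarrow> real"
    by (rule continuous_on_compose2[OF that(1)]) (use that(2) in \<open>auto intro!: continuous_intros\<close>)
  have "((\<lambda>s. integral (cbox 0 1) (\<lambda>t. h (s, t))) has_real_derivative
      integral (cbox 0 1) (\<lambda>t. h' (0, t))) (at 0 within {-\<epsilon><..<\<epsilon>})"
  proof (rule leibniz_rule_field_derivative)
    show "((\<lambda>s. h (s, t)) has_real_derivative h' (s, t)) (at s within {-\<epsilon><..<\<epsilon>})"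
      if "s \<in> {-\<epsilon><..<\<epsilon>}" "t \<in> cbox 0 1" for s t
      using d that by (auto intro: has_field_derivative_at_within)
    show "(\<lambda>t. h (s, t)) integrable_on cbox 0 1" if "s \<in> {-\<epsilon><..<\<epsilon>}" for s
      using slice[OF locally_smooth_on_continuous_on[OF h] that] integrable_continuous_interval
      by auto
    show "continuous_on ({-\<epsilon><..<\<epsilon>} \<times> cbox 0 1) (\<lambda>(s, t). h' (s, t))"
      using c by simp
  qed (use eps in auto)
  then show "((\<lambda>s. integral {0..1} (\<lambda>t. h (s, t))) has_real_derivative
           integral {0..1} (\<lambda>t. deriv (\<lambda>s. h (s, t)) 0)) (at 0)"
    using eps at_within_open[of 0 "{-\<epsilon><..<\<epsilon>}"] by (simp add: h'_def)
  show "(\<lambda>t. deriv (\<lambda>s. h (s, t)) 0) integrable_on {0..1}"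
    using slice[OF c, of 0] eps integrable_continuous_interval by (auto simp: h'_def)
qed


section \<open>Smooth families of bilinear forms\<close>

lemma smooth_on_open_subset_compose:
  "smooth_on T f \<Longrightarrow> smooth_on S g \<Longrightarrow> g ` S \<subseteq> T \<Longrightarrow> smooth_on S (f \<circ> g)"
  unfolding comp_def by (rule smooth_on_compose) auto

lemma has_derivative_smooth_linear_family:
  fixes B :: "'a::euclidean_space \<Rightarrow> 'e::euclidean_space \<Rightarrow> 'b::real_normed_vector"
  assumes B: "\<And>x. x \<in> S \<Longrightarrow> linear (B x)" "\<And>b. smooth_on S (\<lambda>x. B x b)"
    and p: "p \<in> S" and a: "(a has_derivative a') (at p)"
  shows "((\<lambda>x. B x (a x)) has_derivative
    (\<lambda>v. frechet_derivative (\<lambda>x. B x (a p)) (at p) v + B p (a' v))) (at p)"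
proof -
  let ?B' = "\<lambda>b. frechet_derivative (\<lambda>x. B x b) (at p)"
  have S: "open S" using B(2) by (rule smooth_onD_open)
  have B': "((\<lambda>x. B x b) has_derivative ?B' b) (at p)" for b
    by (rule smooth_on_has_derivative[OF B(2) p])
  have sum': "((\<lambda>x. \<Sum>b\<in>Basis. (a x \<bullet> b) *\<^sub>R B x b) has_derivative
      (\<lambda>v. \<Sum>b\<in>Basis. (a p \<bullet> b) *\<^sub>R ?B' b v + (a' v \<bullet> b) *\<^sub>R B p b)) (at p)"
    by (intro has_derivative_sum has_derivative_scaleR has_derivative_inner_left a B')
  have sumc: "((\<lambda>x. \<Sum>b\<in>Basis. (a p \<bullet> b) *\<^sub>R B x b) has_derivative
      (\<lambda>v. \<Sum>b\<in>Basis. (a p \<bullet> b) *\<^sub>R ?B' b v)) (at p)"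
    by (intro has_derivative_sum has_derivative_scaleR_right B')
  have 1: "((\<lambda>x. B x (a x)) has_derivative
      (\<lambda>v. \<Sum>b\<in>Basis. (a p \<bullet> b) *\<^sub>R ?B' b v + (a' v \<bullet> b) *\<^sub>R B p b)) (at p)"
    by (rule has_derivative_transform_within_open[OF sum' S p])
      (rule linear_basis_expand[OF B(1), symmetric])
  have "((\<lambda>x. B x (a p)) has_derivative (\<lambda>v. \<Sum>b\<in>Basis. (a p \<bullet> b) *\<^sub>R ?B' b v)) (at p)"
    by (rule has_derivative_transform_within_open[OF sumc S p])
      (rule linear_basis_expand[OF B(1), symmetric])
  then have 2: "?B' (a p) = (\<lambda>v. \<Sum>b\<in>Basis. (a p \<bullet> b) *\<^sub>R ?B' b v)"
    by (rule frechet_derivative_at[symmetric])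
  have 3: "B p (a' v) = (\<Sum>b\<in>Basis. (a' v \<bullet> b) *\<^sub>R B p b)" for v
    by (rule linear_basis_expand[OF B(1)[OF p]])
  show ?thesis using 1 unfolding 2 3 by (simp add: sum.distrib)
qed

text \<open>The components of a metric in a chart form such a family, with the base point as the parameter.\<close>

definition bilinear_family ::
    "'e::euclidean_space set \<Rightarrow> ('e \<Rightarrow> 'e \<Rightarrow> 'e \<Rightarrow> real) \<Rightarrow> bool" where
  "bilinear_family S G \<longleftrightarrow> (\<forall>x\<in>S. bilinear (G x)) \<and> (\<forall>a b. smooth_on S (\<lambda>x. G x a b))"

text \<open>Only the base point varies; the two vector arguments are held fixed.\<close>

definition dirderiv2 :: "('e::euclidean_space \<Rightarrow> 'e \<Rightarrow> 'e \<Rightarrow> real) \<Rightarrow> 'e \<Rightarrow> 'e \<Rightarrow> 'e \<Rightarrow> 'e \<Rightarrow> real"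
  where "dirderiv2 G x v a b = frechet_derivative (\<lambda>x. G x a b) (at x) v"

lemma bilinear_expand:
  fixes f :: "'e::euclidean_space \<Rightarrow> 'e \<Rightarrow> real"
  assumes "bilinear f"
  shows "f a b = (\<Sum>i\<in>Basis. \<Sum>j\<in>Basis. ((a \<bullet> i) * (b \<bullet> j)) * f i j)"
proof -
  have l: "linear (\<lambda>a. f a b)" "linear (f i)" for i b
    using assms unfolding bilinear_def by blast+
  have "f a b = (\<Sum>i\<in>Basis. (a \<bullet> i) *\<^sub>R f i b)"
    by (rule linear_basis_expand[OF l(1)])
  also have "\<dots> = (\<Sum>i\<in>Basis. (a \<bullet> i) *\<^sub>R (\<Sum>j\<in>Basis. (b \<bullet> j) *\<^sub>R f i j))"
    by (rule sum.cong[OF refl]) (subst linear_basis_expand[OF l(2)], rule refl)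
  finally show ?thesis by (simp add: sum_distrib_left mult.assoc)
qed

context
  fixes S :: "'e::euclidean_space set" and G :: "'e \<Rightarrow> 'e \<Rightarrow> 'e \<Rightarrow> real"
  assumes G: "bilinear_family S G"
begin

lemma bilinear_family_open: "open S"
  using G smooth_onD_open unfolding bilinear_family_def by blast

lemma bilinear_family_bilinear: "x \<in> S \<Longrightarrow> bilinear (G x)"
  using G unfolding bilinear_family_def by blast

lemma bilinear_family_has_derivative:
  "x \<in> S \<Longrightarrow> ((\<lambda>x. G x a b) has_derivative (\<lambda>v. dirderiv2 G x v a b)) (at x)"
  using G smooth_on_has_derivative[of S "\<lambda>x. G x a b" x]
  unfolding bilinear_family_def dirderiv2_def by blast

lemma dirderiv2_expand:
  assumes x: "x \<in> S"
  shows "dirderiv2 G x v a b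
    = (\<Sum>i\<in>Basis. \<Sum>j\<in>Basis. ((a \<bullet> i) * (b \<bullet> j)) * dirderiv2 G x v i j)"
proof -
  have 1: "((\<lambda>x. \<Sum>i\<in>Basis. \<Sum>j\<in>Basis. ((a \<bullet> i) * (b \<bullet> j)) * G x i j) has_derivative
     (\<lambda>v. \<Sum>i\<in>Basis. \<Sum>j\<in>Basis. ((a \<bullet> i) * (b \<bullet> j)) * dirderiv2 G x v i j)) (at x)"
    by (intro has_derivative_sum has_derivative_mult_right bilinear_family_has_derivative x)
  have 2: "((\<lambda>x. G x a b) has_derivative
     (\<lambda>v. \<Sum>i\<in>Basis. \<Sum>j\<in>Basis. ((a \<bullet> i) * (b \<bullet> j)) * dirderiv2 G x v i j)) (at x)"
    by (rule has_derivative_transform_within_open[OF 1 bilinear_family_open x])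
      (rule bilinear_expand[OF bilinear_family_bilinear, symmetric])
  show ?thesis
    using has_derivative_unique[OF 2 bilinear_family_has_derivative[OF x]] by metis
qed

lemma bilinear_dirderiv2:
  assumes "x \<in> S"
  shows "bilinear (dirderiv2 G x v)"
proof -
  have *: "bilinear (\<lambda>a b. \<Sum>i\<in>Basis. \<Sum>j\<in>Basis. ((a \<bullet> i) * (b \<bullet> j)) * m i j)"
    for m :: "'e \<Rightarrow> 'e \<Rightarrow> real"
    unfolding bilinear_def
    by (intro conjI allI linearI)
      (simp_all add: inner_add_left algebra_simps sum.distrib sum_distrib_left)
  have "dirderiv2 G x v
      = (\<lambda>a b. \<Sum>i\<in>Basis. \<Sum>j\<in>Basis. ((a \<bullet> i) * (b \<bullet> j)) * dirderiv2 G x v i j)"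
    by (intro ext) (rule dirderiv2_expand[OF assms])
  then show ?thesis using *[of "dirderiv2 G x v"] by argo
qed

lemma linear_dirderiv2: "x \<in> S \<Longrightarrow> linear (\<lambda>v. dirderiv2 G x v a b)"
  by (rule has_derivative_linear[OF bilinear_family_has_derivative])

text \<open>The product rule for the value of the form on two vectors that, like the base point, depend
  on a parameter.\<close>

lemma bilinear_family_compose_has_derivative:
  fixes y a b :: "'d::real_normed_vector \<Rightarrow> 'e"
  assumes z: "z \<in> T" and y: "(y has_derivative y') (at z within T)" and yz: "y z \<in> S"
    and a: "(a has_derivative a') (at z within T)" and b: "(b has_derivative b') (at z within T)"
  shows "((\<lambda>z. G (y z) (a z) (b z)) has_derivative
    (\<lambda>h. dirderiv2 G (y z) (y' h) (a z) (b z) + G (y z) (a' h) (b z) + G (y z) (a z) (b' h)))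
    (at z within T)"
proof -
  have ev: "\<forall>\<^sub>F z in at z within T. y z \<in> S"
    using has_derivative_continuous[OF y] bilinear_family_open yz
    unfolding continuous_within by (rule topological_tendstoD)
  have Gy: "((\<lambda>z. G (y z) i j) has_derivative (\<lambda>h. dirderiv2 G (y z) (y' h) i j)) (at z within T)"
    for i j
    by (rule has_derivative_compose[OF y bilinear_family_has_derivative[OF yz]])
  let ?E = "\<lambda>h. \<Sum>i\<in>Basis. \<Sum>j\<in>Basis. ((a z \<bullet> i) * (b z \<bullet> j)) * dirderiv2 G (y z) (y' h) i j
       + ((a z \<bullet> i) * (b' h \<bullet> j) + (a' h \<bullet> i) * (b z \<bullet> j)) * G (y z) i j"
  have 1: "((\<lambda>z. \<Sum>i\<in>Basis. \<Sum>j\<in>Basis. ((a z \<bullet> i) * (b z \<bullet> j)) * G (y z) i j)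
      has_derivative ?E) (at z within T)"
    by (intro has_derivative_sum has_derivative_mult has_derivative_inner_left a b Gy)
  have "?E h = dirderiv2 G (y z) (y' h) (a z) (b z) + G (y z) (a' h) (b z) + G (y z) (a z) (b' h)"
    for h
    by (simp only: dirderiv2_expand[OF yz, of "y' h" "a z" "b z"]
        bilinear_expand[OF bilinear_family_bilinear[OF yz], of "a' h" "b z"]
        bilinear_expand[OF bilinear_family_bilinear[OF yz], of "a z" "b' h"])
      (simp add: sum.distrib distrib_right)
  then have 2: "?E = (\<lambda>h. dirderiv2 G (y z) (y' h) (a z) (b z) + G (y z) (a' h) (b z)
      + G (y z) (a z) (b' h))" by blast
  show ?thesis
  proof (rule has_derivative_transform_eventually[OF 1[unfolded 2]])
    show "\<forall>\<^sub>F z in at z within T. (\<Sum>i\<in>Basis. \<Sum>j\<in>Basis. ((a z \<bullet> i) * (b z \<bullet> j)) * G (y z) i j)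
        = G (y z) (a z) (b z)"
      using ev by (rule eventually_mono)
        (rule bilinear_expand[OF bilinear_family_bilinear, symmetric])
    show "(\<Sum>i\<in>Basis. \<Sum>j\<in>Basis. ((a z \<bullet> i) * (b z \<bullet> j)) * G (y z) i j) = G (y z) (a z) (b z)"
      by (rule bilinear_expand[OF bilinear_family_bilinear[OF yz], symmetric])
  qed (rule z)
qed

lemma bilinear_family_compose_smooth:
  fixes y a b :: "'d::euclidean_space \<Rightarrow> 'e"
  assumes y: "smooth_on T y" "\<And>z. z \<in> T \<Longrightarrow> y z \<in> S" and a: "smooth_on T a" and b: "smooth_on T b"
  shows "smooth_on T (\<lambda>z. G (y z) (a z) (b z))"
proof (rule smooth_on_cong)
  have "smooth_on S (\<lambda>x. G x i j)" for i j
    using G by (auto simp: bilinear_family_def)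
  then show "smooth_on T (\<lambda>z. \<Sum>i\<in>Basis. \<Sum>j\<in>Basis. ((a z \<bullet> i) * (b z \<bullet> j)) * G (y z) i j)"
    by (intro smooth_on_sum smooth_onD_open[OF a] smooth_on_mult smooth_on_inner_left a b)
      (rule smooth_on_compose[OF _ y], auto)
  show "(\<Sum>i\<in>Basis. \<Sum>j\<in>Basis. ((a z \<bullet> i) * (b z \<bullet> j)) * G (y z) i j) = G (y z) (a z) (b z)"
    if "z \<in> T" for z
    by (rule bilinear_expand[OF bilinear_family_bilinear[OF y(2)[OF that]], symmetric])
qed

end


section \<open>Smooth functions and vector fields in a chart\<close>

lemma sum_fun_apply: "(\<Sum>i\<in>I. f i) x = (\<Sum>i\<in>I. f i x)"
  by (induction I rule: infinite_finite_induct) auto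

lemma scaleR_fun_apply: "(r *\<^sub>R f) x = r *\<^sub>R f x"
  by (simp add: scaleR_fun_def)

lemma smooth_fun_on_open: "smooth_fun_on A W f \<Longrightarrow> open W"
  by (simp add: smooth_fun_on_def)

lemma smooth_fun_on_smooth_near: "smooth_fun_on A W f \<Longrightarrow> p \<in> W \<Longrightarrow> smooth_near A p f"
  by (auto simp: smooth_near_def)

lemma vfield_on_open: "vfield_on A W X \<Longrightarrow> open W"
  by (simp add: vfield_on_def)

lemma vfield_on_subset: "vfield_on A W X \<Longrightarrow> open V \<Longrightarrow> V \<subseteq> W \<Longrightarrow> vfield_on A V X"
  unfolding vfield_on_def by blast

lemma vfield_on_near: "vfield_on A W X \<Longrightarrow> p \<in> W \<Longrightarrow> vfield_near A p X"
  by (auto simp: vfield_near_def)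

lemma vfield_on_tangent: "vfield_on A W X \<Longrightarrow> p \<in> W \<Longrightarrow> X p \<in> tangent_space A p"
  by (auto simp: vfield_on_def)

lemma vfield_on_smooth:
  "vfield_on A W X \<Longrightarrow> V \<subseteq> W \<Longrightarrow> smooth_fun_on A V f \<Longrightarrow> smooth_fun_on A V (\<lambda>q. X q f)"
  by (auto simp: vfield_on_def)

text \<open>The vector \<open>\<partial> a p\<close> below is the tangent vector at \<open>p\<close> whose coordinate vector is \<open>a\<close>. All
  calculations take place in the image of the chart, and \<open>a\<close> ranges over the whole model space rather
  than over a basis, which keeps sums over indices out of the tensor calculus.\<close>

locale chart =
  fixes A :: "('m::{t2_space,second_countable_topology}, 'e::euclidean_space) atlas"
    and U :: "'m set" and \<phi> :: "'m \<Rightarrow> 'e"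
  assumes atlas: "smooth_atlas A" and chart: "(U, \<phi>) \<in> A"
begin

abbreviation "\<psi> \<equiv> inv_into U \<phi>"

abbreviation frame ("\<partial>") where "\<partial> \<equiv> coord_field A U \<phi>"

lemma chart_facts:
  shows open_U: "open U" and open_range: "open (\<phi> ` U)"
    and homeo: "homeomorphism U (\<phi> ` U) \<phi> \<psi>"
  using atlas chart unfolding smooth_atlas_def by fast+

lemma transition: "(V, \<theta>) \<in> A \<Longrightarrow> smooth_on (\<phi> ` (U \<inter> V)) (\<theta> \<circ> \<psi>)"
  using atlas chart unfolding smooth_atlas_def by fast

lemma psi_phi [simp]: "p \<in> U \<Longrightarrow> \<psi> (\<phi> p) = p"
  by (rule homeomorphism_apply1[OF homeo])

lemma phi_psi [simp]: "x \<in> \<phi> ` U \<Longrightarrow> \<phi> (\<psi> x) = x"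
  by (rule homeomorphism_apply2[OF homeo])

lemma psi_in [simp]: "x \<in> \<phi> ` U \<Longrightarrow> \<psi> x \<in> U"
  using homeo by (auto simp: homeomorphism_def)

lemma continuous_psi: "continuous_on (\<phi> ` U) \<psi>"
  using homeo by (simp add: homeomorphism_def)

lemma open_image:
  assumes "open W"
  shows "open (\<phi> ` (W \<inter> U))"
proof -
  have "\<phi> ` (W \<inter> U) = \<psi> -` W \<inter> \<phi> ` U" by auto
  moreover have "open (\<psi> -` W \<inter> \<phi> ` U)"
    using continuous_psi continuous_on_open_vimage[OF open_range] assms by blast
  ultimately show ?thesis by simp
qed

lemma open_image_subset: "open W \<Longrightarrow> W \<subseteq> U \<Longrightarrow> open (\<phi> ` W)"
  using open_image[of W] by (simp add: Int_absorb2)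

lemma smooth_fun_onD: "smooth_fun_on A W f \<Longrightarrow> smooth_on (\<phi> ` (W \<inter> U)) (f \<circ> \<psi>)"
  using chart by (auto simp: smooth_fun_on_def)

lemma smooth_fun_onD_subset: "smooth_fun_on A W f \<Longrightarrow> W \<subseteq> U \<Longrightarrow> smooth_on (\<phi> ` W) (f \<circ> \<psi>)"
  using smooth_fun_onD[of W f] by (simp add: Int_absorb2)

text \<open>Because transition maps are smooth, a single chart decides smoothness on its domain.\<close>

lemma smooth_fun_onI:
  assumes W: "open W" "W \<subseteq> U" and f: "smooth_on (\<phi> ` W) (f \<circ> \<psi>)"
  shows "smooth_fun_on A W f"
  unfolding smooth_fun_on_def
proof (intro conjI W(1) ballI, clarify)
  fix V \<theta> assume V: "(V, \<theta>) \<in> A"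
  interpret V: chart A V \<theta> using atlas V by unfold_locales
  have s: "smooth_on (\<theta> ` (W \<inter> V)) (\<phi> \<circ> V.\<psi>)"
    by (rule smooth_on_subset[OF V.transition[OF chart] V.open_image[OF W(1)]]) (use W in auto)
  have "smooth_on (\<theta> ` (W \<inter> V)) ((f \<circ> \<psi>) \<circ> (\<phi> \<circ> V.\<psi>))"
    by (rule smooth_on_open_subset_compose[OF f s]) auto
  then show "smooth_on (\<theta> ` (W \<inter> V)) (f \<circ> V.\<psi>)"
    by (rule smooth_on_cong) (use W in auto)
qed

lemma smooth_fun_on_subset:
  assumes "smooth_fun_on A W f" "open V" "V \<subseteq> W"
  shows "smooth_fun_on A V f"
  unfolding smooth_fun_on_def
proof (intro conjI assms ballI, clarify)
  fix V' \<theta> assume V: "(V', \<theta>) \<in> A"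
  interpret V: chart A V' \<theta> using atlas V by unfold_locales
  show "smooth_on (\<theta> ` (V \<inter> V')) (f \<circ> V.\<psi>)"
    by (rule smooth_on_subset[OF V.smooth_fun_onD[OF assms(1)] V.open_image[OF assms(2)]])
      (use assms in auto)
qed

lemma smooth_near_obtain:
  assumes "smooth_near A p f" "p \<in> U" "open V" "p \<in> V"
  obtains W where "p \<in> W" "open W" "W \<subseteq> U" "W \<subseteq> V" "smooth_fun_on A W f"
proof -
  obtain W where W: "p \<in> W" "smooth_fun_on A W f" using assms by (auto simp: smooth_near_def)
  have "open (W \<inter> U \<inter> V)" using smooth_fun_on_open[OF W(2)] open_U assms by auto
  then show thesis
    using that[of "W \<inter> U \<inter> V"] W assms smooth_fun_on_subset[OF W(2), of "W \<inter> U \<inter> V"] by auto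
qed

lemma vfield_near_obtain:
  assumes "vfield_near A p X" "p \<in> U" "open V" "p \<in> V"
  obtains W where "p \<in> W" "open W" "W \<subseteq> U" "W \<subseteq> V" "vfield_on A W X"
proof -
  obtain W where W: "p \<in> W" "vfield_on A W X" using assms by (auto simp: vfield_near_def)
  have "open (W \<inter> U \<inter> V)" using vfield_on_open[OF W(2)] open_U assms by auto
  then show thesis
    using that[of "W \<inter> U \<inter> V"] W assms vfield_on_subset[OF W(2), of "W \<inter> U \<inter> V"] by auto
qed

lemma smooth_near_has_derivative:
  assumes "smooth_near A p f" "p \<in> U"
  shows "((f \<circ> \<psi>) has_derivative (\<lambda>a. \<partial> a p f)) (at (\<phi> p))"
proof -
  obtain W where W: "p \<in> W" "W \<subseteq> U" "smooth_fun_on A W f"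
    by (rule smooth_near_obtain[OF assms open_U assms(2)])
  have "((f \<circ> \<psi>) has_derivative frechet_derivative (f \<circ> \<psi>) (at (\<phi> p))) (at (\<phi> p))"
    by (rule smooth_on_has_derivative[OF smooth_fun_onD_subset[OF W(3,2)]]) (use W in auto)
  then show ?thesis using assms by (simp add: coord_field_def)
qed

lemma frame_eq:
  assumes "smooth_near A p f" "p \<in> U" "((f \<circ> \<psi>) has_derivative f') (at (\<phi> p))"
  shows "\<partial> a p f = f' a"
  using has_derivative_unique[OF smooth_near_has_derivative[OF assms(1,2)] assms(3)] by metis

lemma linear_frame:
  assumes "p \<in> U"
  shows "linear (\<lambda>a. \<partial> a p)"
proof (rule linearI)
  have z: "\<partial> a p f = 0" if "\<not> smooth_near A p f" for a f using that by (simp add: coord_field_def)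
  have l: "linear (\<lambda>a. \<partial> a p f)" if "smooth_near A p f" for f
    by (rule has_derivative_linear[OF smooth_near_has_derivative[OF that assms]])
  show "\<partial> (a + b) p = \<partial> a p + \<partial> b p" for a b
  proof
    fix f show "\<partial> (a + b) p f = (\<partial> a p + \<partial> b p) f"
      by (cases "smooth_near A p f") (auto simp: z linear_add[OF l])
  qed
  show "\<partial> (r *\<^sub>R a) p = r *\<^sub>R \<partial> a p" for r a
  proof
    fix f show "\<partial> (r *\<^sub>R a) p f = (r *\<^sub>R \<partial> a p) f"
      by (cases "smooth_near A p f") (auto simp: z linear_cmul[OF l] scaleR_fun_apply)
  qed
qed

lemma coordinate_smooth: "smooth_fun_on A U (\<lambda>q. \<phi> q \<bullet> b)"
proof (rule smooth_fun_onI[OF open_U order.refl])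
  have "smooth_on (\<phi> ` U) (\<lambda>x. x \<bullet> b)"
    by (rule smooth_on_inner_left[OF smooth_on_id[OF open_range]])
  then show "smooth_on (\<phi> ` U) ((\<lambda>q. \<phi> q \<bullet> b) \<circ> \<psi>)"
    by (rule smooth_on_cong) simp
qed

lemma coordinate_smooth_near: "p \<in> U \<Longrightarrow> smooth_near A p (\<lambda>q. \<phi> q \<bullet> b)"
  by (rule smooth_fun_on_smooth_near[OF coordinate_smooth])

lemma frame_coordinate:
  assumes "p \<in> U"
  shows "\<partial> a p (\<lambda>q. \<phi> q \<bullet> b) = a \<bullet> b"
proof (rule frame_eq[OF coordinate_smooth_near[OF assms] assms])
  have "((\<lambda>x. x \<bullet> b) has_derivative (\<lambda>a. a \<bullet> b)) (at (\<phi> p))"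
    by (auto intro!: derivative_eq_intros)
  then show "((\<lambda>q. \<phi> q \<bullet> b) \<circ> \<psi> has_derivative (\<lambda>a. a \<bullet> b)) (at (\<phi> p))"
    by (rule has_derivative_transform_within_open[OF _ open_range]) (use assms in auto)
qed

text \<open>A tangent vector is an operator, so its coordinate vector is read off from its values on the
  coordinate functions.\<close>

definition coords :: "'m tvec \<Rightarrow> 'e" where
  "coords v = (\<Sum>b\<in>Basis. v (\<lambda>q. \<phi> q \<bullet> b) *\<^sub>R b)"

lemma coords_frame [simp]: "p \<in> U \<Longrightarrow> coords (\<partial> a p) = a"
  by (simp add: coords_def frame_coordinate euclidean_representation)

text \<open>Continuity keeps the curve in the domain of the chart near \<open>t\<close>; without it the derivative of the
  chart expression would say nothing about the curve.\<close>

lemma velocity_frame: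
  assumes t: "at t within S \<noteq> bot" "t \<in> S" and U: "\<gamma> t \<in> U"
    and cont: "continuous (at t within S) \<gamma>"
    and d: "((\<phi> \<circ> \<gamma>) has_vector_derivative a) (at t within S)"
  shows "velocity A S \<gamma> t = \<partial> a (\<gamma> t)"
proof
  fix f
  show "velocity A S \<gamma> t f = \<partial> a (\<gamma> t) f"
  proof (cases "smooth_near A (\<gamma> t) f")
    case True
    have f': "((f \<circ> \<psi>) has_derivative (\<lambda>a. \<partial> a (\<gamma> t) f)) (at ((\<phi> \<circ> \<gamma>) t))"
      using smooth_near_has_derivative[OF True U] by simp
    have 1: "(((f \<circ> \<psi>) \<circ> (\<phi> \<circ> \<gamma>)) has_vector_derivative \<partial> a (\<gamma> t) f) (at t within S)"
      by (rule vector_derivative_diff_chain_within[OF d has_derivative_at_withinI[OF f']])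
    have "\<forall>\<^sub>F s in at t within S. \<gamma> s \<in> U"
      using cont open_U U unfolding continuous_within by (rule topological_tendstoD)
    then have "\<forall>\<^sub>F s in at t within S. ((f \<circ> \<psi>) \<circ> (\<phi> \<circ> \<gamma>)) s = (f \<circ> \<gamma>) s"
      by (rule eventually_mono) simp
    then have "((f \<circ> \<gamma>) has_vector_derivative \<partial> a (\<gamma> t) f) (at t within S)"
      using 1 U t(2) unfolding has_vector_derivative_def
      by (elim has_derivative_transform_eventually) auto
    then show ?thesis
      using True vector_derivative_within[OF t(1)] by (simp add: velocity_def)
  next
    case False
    then show ?thesis by (simp add: velocity_def coord_field_def)
  qed
qed

text \<open>The straight line through \<open>\<phi> p\<close> in direction \<open>a\<close> realises \<open>\<partial> a p\<close> as a velocity; conversely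
  a velocity is determined by the derivative of the curve in the chart.\<close>

lemma tangent_space_eq:
  assumes p: "p \<in> U"
  shows "tangent_space A p = range (\<lambda>a. \<partial> a p)"
proof (intro equalityI subsetI)
  fix v assume "v \<in> tangent_space A p"
  then obtain e c where e: "e > 0" "smooth_map_on A {-e<..<e} c" "c 0 = p"
    "v = velocity A {-e<..<e} c 0" by (auto simp: tangent_space_def)
  let ?S = "{-e<..<e}"
  have 0: "0 \<in> ?S" using e by simp
  obtain W G where W: "0 \<in> W" "smooth_map_open A W G" "\<forall>x\<in>?S \<inter> W. c x = G x"
    using e(2) 0 unfolding smooth_map_on_def by blast
  let ?O = "W \<inter> G -` U"
  have s: "smooth_on ?O (\<phi> \<circ> G)" using W(2) chart by (auto simp: smooth_map_open_def)
  have "G 0 = p" using W e 0 by auto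
  then have 0: "0 \<in> ?O" "0 \<in> ?S \<inter> W" using W p 0 by auto
  have "open (?S \<inter> W)" using W(2) by (auto simp: smooth_map_open_def)
  have cG: "continuous (at 0) c"
  proof -
    have "continuous_on (?S \<inter> W) G"
      using W(2) by (auto simp: smooth_map_open_def intro: continuous_on_subset)
    then have "continuous_on (?S \<inter> W) c"
      by (rule continuous_on_eq) (use W(3) in auto)
    then show ?thesis using 0 \<open>open (?S \<inter> W)\<close> by (simp add: continuous_on_eq_continuous_at)
  qed
  obtain d where "((\<phi> \<circ> G) has_vector_derivative d) (at 0)"
    using smooth_on_has_derivative[OF s 0(1)] vector_derivative_works
    unfolding differentiable_def by blast
  then have "((\<phi> \<circ> c) has_vector_derivative d) (at 0)"
    by (rule has_vector_derivative_transform_within_open[OF _ \<open>open (?S \<inter> W)\<close> 0(2)]) (use W in auto)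
  then have "velocity A ?S c 0 = \<partial> d (c 0)"
    using cG p e by (intro velocity_frame)
      (auto intro: has_vector_derivative_at_within continuous_at_imp_continuous_at_within
        simp: at_within_open[OF _ open_greaterThanLessThan])
  then show "v \<in> range (\<lambda>a. \<partial> a p)" using e by auto
next
  fix v assume "v \<in> range (\<lambda>a. \<partial> a p)"
  then obtain a where v: "v = \<partial> a p" by auto
  define l where "l = (\<lambda>\<tau>::real. \<phi> p + \<tau> *\<^sub>R a)"
  have "open (l -` (\<phi> ` U))" unfolding l_def by (intro open_vimage open_range continuous_intros)
  moreover have "0 \<in> l -` (\<phi> ` U)" using p by (simp add: l_def)
  ultimately obtain e where e: "e > 0" "ball 0 e \<subseteq> l -` (\<phi> ` U)"
    using open_contains_ball by blast
  let ?S = "{-e<..<e}"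
  have lU: "l \<tau> \<in> \<phi> ` U" if "\<tau> \<in> ?S" for \<tau>
    using that e by (auto simp: subset_iff dist_real_def)
  have l: "smooth_on V l" if "open V" for V
    unfolding l_def by (intro smooth_on_add smooth_on_scaleR smooth_on_const smooth_on_id that)
  have cont: "continuous_on ?S (\<psi> \<circ> l)"
    by (intro continuous_on_compose continuous_on_subset[OF continuous_psi]
        smooth_on_continuous_on l) (use lU in auto)
  have "smooth_map_open A ?S (\<psi> \<circ> l)"
    unfolding smooth_map_open_def
  proof (intro conjI ballI cont open_greaterThanLessThan, clarify)
    fix V \<theta> assume V: "(V, \<theta>) \<in> A"
    interpret V: chart A V \<theta> using atlas V by unfold_locales
    have "?S \<inter> (\<psi> \<circ> l) -` V = (\<psi> \<circ> l) -` V \<inter> ?S" by auto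
    also have "open \<dots>"
      using cont continuous_on_open_vimage[OF open_greaterThanLessThan] V.open_U by blast
    finally have "smooth_on (?S \<inter> (\<psi> \<circ> l) -` V) ((\<theta> \<circ> \<psi>) \<circ> l)"
      by (intro smooth_on_open_subset_compose[OF transition[OF V] l])
        (use lU phi_psi in \<open>force simp: image_iff\<close>)+
    then show "smooth_on (?S \<inter> (\<psi> \<circ> l) -` V) (\<theta> \<circ> (\<psi> \<circ> l))" by (simp add: comp_assoc)
  qed
  then have sm: "smooth_map_on A ?S (\<psi> \<circ> l)" unfolding smooth_map_on_def by blast
  have "velocity A ?S (\<psi> \<circ> l) 0 = \<partial> a ((\<psi> \<circ> l) 0)"
  proof (rule velocity_frame)
    show "0 \<in> ?S" using e by simp
    show "at 0 within ?S \<noteq> bot" using e by (simp add: at_within_open[OF _ open_greaterThanLessThan])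
    show "(\<psi> \<circ> l) 0 \<in> U" using p by (simp add: l_def)
    show "continuous (at 0 within ?S) (\<psi> \<circ> l)"
      using cont e unfolding continuous_on_eq_continuous_within by auto
    have "(l has_vector_derivative a) (at 0)"
      unfolding l_def by (auto intro!: derivative_eq_intros)
    then have "(\<phi> \<circ> (\<psi> \<circ> l) has_vector_derivative a) (at 0)"
      by (rule has_vector_derivative_transform_within_open[OF _ open_greaterThanLessThan[of "-e" e]])
        (use e lU in auto)
    then show "(\<phi> \<circ> (\<psi> \<circ> l) has_vector_derivative a) (at 0 within ?S)"
      by (rule has_vector_derivative_at_within)
  qed
  moreover have "(\<psi> \<circ> l) 0 = p" using p by (simp add: l_def)
  ultimately show "v \<in> tangent_space A p"
    using e sm v unfolding tangent_space_def by (auto intro!: exI[of _ e] exI[of _ "\<psi> \<circ> l"])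
qed

lemma frame_tangent: "p \<in> U \<Longrightarrow> \<partial> a p \<in> tangent_space A p"
  by (simp add: tangent_space_eq)

lemma tangent_frame: "p \<in> U \<Longrightarrow> v \<in> tangent_space A p \<Longrightarrow> \<partial> (coords v) p = v"
  by (auto simp: tangent_space_eq)

lemma vfield_on_frame: "vfield_on A U (\<partial> a)"
  unfolding vfield_on_def
proof (intro conjI ballI allI impI open_U)
  fix W and f :: "'m \<Rightarrow> real" assume "W \<subseteq> U \<and> smooth_fun_on A W f"
  then have W: "W \<subseteq> U" "smooth_fun_on A W f" by auto
  show "smooth_fun_on A W (\<lambda>q. \<partial> a q f)"
  proof (rule smooth_fun_onI[OF smooth_fun_on_open[OF W(2)] W(1)])
    have "smooth_on (\<phi> ` W) (\<lambda>x. frechet_derivative (f \<circ> \<psi>) (at x) a)"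
      by (rule smooth_on_frechet_derivative[OF smooth_fun_onD_subset[OF W(2,1)]])
    then show "smooth_on (\<phi> ` W) ((\<lambda>q. \<partial> a q f) \<circ> \<psi>)"
      by (rule smooth_on_cong)
        (use W smooth_fun_on_smooth_near[OF W(2)] in \<open>auto simp: coord_field_def subset_iff\<close>)
  qed
qed (simp add: frame_tangent)

text \<open>Brackets, covariant derivatives and derivatives of tensors evaluated on a vector field depend at
  \<open>p\<close> only on the value and the derivative of its coordinate representation.\<close>

definition rep :: "'m vfield \<Rightarrow> 'e \<Rightarrow> 'e" where
  "rep X x = coords (X (\<psi> x))"

definition drep :: "'m vfield \<Rightarrow> 'm \<Rightarrow> 'e \<Rightarrow> 'e" where
  "drep X p = frechet_derivative (rep X) (at (\<phi> p))"

lemma rep_phi [simp]: "p \<in> U \<Longrightarrow> rep X (\<phi> p) = coords (X p)"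
  by (simp add: rep_def)

lemma rep_smooth:
  assumes X: "vfield_on A W X" and W: "W \<subseteq> U"
  shows "smooth_on (\<phi> ` W) (rep X)"
proof -
  have "smooth_fun_on A W (\<lambda>q. X q (\<lambda>q. \<phi> q \<bullet> b))" for b
    by (rule vfield_on_smooth[OF X order.refl
          smooth_fun_on_subset[OF coordinate_smooth vfield_on_open[OF X] W]])
  from smooth_fun_onD_subset[OF this W]
  have "smooth_on (\<phi> ` W) (\<lambda>x. X (\<psi> x) (\<lambda>q. \<phi> q \<bullet> b))" for b by (simp add: comp_def)
  then show ?thesis
    unfolding rep_def coords_def
    by (intro smooth_on_sum smooth_on_scaleR smooth_on_const open_image_subset[OF vfield_on_open[OF X] W])
qed

lemma vfield_frame: "vfield_on A W X \<Longrightarrow> q \<in> W \<Longrightarrow> q \<in> U \<Longrightarrow> \<partial> (coords (X q)) q = X q"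
  by (rule tangent_frame[OF _ vfield_on_tangent])

lemma vfield_near_frame: "vfield_near A p X \<Longrightarrow> p \<in> U \<Longrightarrow> \<partial> (coords (X p)) p = X p"
  unfolding vfield_near_def using vfield_frame by blast

lemma rep_has_derivative:
  assumes "vfield_near A p X" "p \<in> U"
  shows "(rep X has_derivative drep X p) (at (\<phi> p))"
proof -
  obtain W where W: "p \<in> W" "W \<subseteq> U" "vfield_on A W X"
    by (rule vfield_near_obtain[OF assms open_U assms(2)])
  show ?thesis
    unfolding drep_def by (rule smooth_on_has_derivative[OF rep_smooth[OF W(3,2)]]) (use W in auto)
qed

lemma vfield_near_frame_field: "p \<in> U \<Longrightarrow> vfield_near A p (\<partial> a)"
  by (rule vfield_on_near[OF vfield_on_frame])

lemma drep_frame: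
  assumes "p \<in> U"
  shows "drep (\<partial> a) p v = 0"
proof -
  have "((\<lambda>_. a) has_derivative (\<lambda>_. 0)) (at (\<phi> p))" by simp
  then have "(rep (\<partial> a) has_derivative (\<lambda>_. 0)) (at (\<phi> p))"
    by (rule has_derivative_transform_within_open[OF _ open_range])
      (use assms in \<open>auto simp: rep_def\<close>)
  then show ?thesis
    using has_derivative_unique[OF rep_has_derivative[OF vfield_near_frame_field[OF assms] assms]]
    by metis
qed

text \<open>Both iterated derivatives of \<open>f\<close> consist of a second and a first order term; the second order
  terms cancel by symmetry.\<close>

lemma lie_bracket_frame:
  assumes X: "vfield_near A p X" and Y: "vfield_near A p Y" and p: "p \<in> U"
  shows "lie_bracket A X Y p = \<partial> (drep Y p (coords (X p)) - drep X p (coords (Y p))) p"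
proof
  fix f
  show "lie_bracket A X Y p f = \<partial> (drep Y p (coords (X p)) - drep X p (coords (Y p))) p f"
  proof (cases "smooth_near A p f")
    case True
    obtain W1 where W1: "p \<in> W1" "open W1" "smooth_fun_on A W1 f"
      by (rule smooth_near_obtain[OF True p open_U p])
    obtain W2 where W2: "p \<in> W2" "open W2" "W2 \<subseteq> W1" "vfield_on A W2 X"
      by (rule vfield_near_obtain[OF X p W1(2,1)])
    obtain W where W: "p \<in> W" "open W" "W \<subseteq> U" "W \<subseteq> W2" "vfield_on A W Y"
      by (rule vfield_near_obtain[OF Y p W2(2,1)])
    have f: "smooth_fun_on A W f" and XW: "vfield_on A W X"
      using smooth_fun_on_subset[OF W1(3) W(2)] vfield_on_subset[OF W2(4) W(2)] W W2 by auto
    let ?f = "f \<circ> \<psi>"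
    have sf: "smooth_on (\<phi> ` W) ?f" by (rule smooth_fun_onD_subset[OF f W(3)])
    have pW: "\<phi> p \<in> \<phi> ` W" using W by auto
    let ?D2 = "\<lambda>a b. frechet_derivative (\<lambda>x. frechet_derivative ?f (at x) a) (at (\<phi> p)) b"
    have df: "frechet_derivative ?f (at (\<phi> p)) a = \<partial> a p f" for a
      using True by (simp add: coord_field_def)
    have key: "X p (\<lambda>q. Y q f) = ?D2 (coords (Y p)) (coords (X p)) + \<partial> (drep Y p (coords (X p))) p f"
      if XW: "vfield_on A W X" and YW: "vfield_on A W Y" for X Y
    proof -
      have YX: "vfield_near A p X" "vfield_near A p Y"
        by (rule vfield_on_near[OF XW W(1)], rule vfield_on_near[OF YW W(1)])
      have sY: "smooth_fun_on A W (\<lambda>q. Y q f)" by (rule vfield_on_smooth[OF YW order.refl f])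
      have "((\<lambda>x. frechet_derivative ?f (at x) (rep Y x)) has_derivative
          (\<lambda>v. ?D2 (rep Y (\<phi> p)) v + frechet_derivative ?f (at (\<phi> p)) (drep Y p v))) (at (\<phi> p))"
        by (rule has_derivative_smooth_linear_family[OF _ smooth_on_frechet_derivative[OF sf] pW
              rep_has_derivative[OF YX(2) p]])
          (rule has_derivative_linear[OF smooth_on_has_derivative[OF sf]])
      then have "((\<lambda>q. Y q f) \<circ> \<psi> has_derivative
          (\<lambda>v. ?D2 (rep Y (\<phi> p)) v + frechet_derivative ?f (at (\<phi> p)) (drep Y p v))) (at (\<phi> p))"
      proof (rule has_derivative_transform_within_open[OF _ open_image_subset[OF W(2,3)] pW])
        fix x assume "x \<in> \<phi> ` W"
        then obtain q where q: "q \<in> W" "x = \<phi> q" "q \<in> U" using W by auto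
        have "Y q f = \<partial> (coords (Y q)) q f" using vfield_frame[OF YW q(1,3)] by simp
        also have "\<dots> = frechet_derivative ?f (at x) (rep Y x)"
          using q smooth_fun_on_smooth_near[OF f q(1)] by (simp add: coord_field_def)
        finally show "frechet_derivative ?f (at x) (rep Y x) = ((\<lambda>q. Y q f) \<circ> \<psi>) x"
          using q by simp
      qed
      from frame_eq[OF smooth_fun_on_smooth_near[OF sY W(1)] p this, of "coords (X p)"]
      show ?thesis using vfield_near_frame[OF YX(1) p] p by (simp add: df)
    qed
    have "?D2 (coords (Y p)) (coords (X p)) = ?D2 (coords (X p)) (coords (Y p))"
      by (rule frechet_derivative_symmetric[OF sf pW])
    moreover note linear_diff[OF has_derivative_linear[OF smooth_near_has_derivative[OF True p]]]
    ultimately show ?thesis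
      using True key[OF XW W(5)] key[OF W(5) XW] by (simp add: lie_bracket_def)
  next
    case False
    then show ?thesis by (simp add: lie_bracket_def coord_field_def)
  qed
qed

end


section \<open>Combining vector fields\<close>

lemma smooth_fun_on_mult:
  fixes f h :: "'m::topological_space \<Rightarrow> real"
  assumes "smooth_fun_on A W f" "smooth_fun_on A W h"
  shows "smooth_fun_on A W (\<lambda>q. f q * h q)"
  using assms unfolding smooth_fun_on_def comp_def by (auto intro!: smooth_on_mult)

lemma smooth_fun_on_add:
  assumes "smooth_fun_on A W f" "smooth_fun_on A W h"
  shows "smooth_fun_on A W (\<lambda>q. f q + h q)"
  using assms unfolding smooth_fun_on_def comp_def by (auto intro!: smooth_on_add)

lemma smooth_fun_on_const:
  assumes "smooth_atlas A" "open W"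
  shows "smooth_fun_on A W (\<lambda>q. r)"
  unfolding smooth_fun_on_def comp_def
proof (intro conjI ballI assms(2), clarify)
  fix U \<phi> assume "(U, \<phi>) \<in> A"
  then interpret chart A U \<phi> using assms(1) by unfold_locales
  show "smooth_on (\<phi> ` (W \<inter> U)) (\<lambda>x. r)"
    by (rule smooth_on_const[OF open_image[OF assms(2)]])
qed

lemma obtain_chart:
  assumes "smooth_atlas A"
  obtains U \<phi> where "chart A U \<phi>" "p \<in> U"
proof -
  have "p \<in> (\<Union>(U, \<phi>)\<in>A. U)" using assms by (simp add: smooth_atlas_def)
  then obtain U \<phi> where "(U, \<phi>) \<in> A" "p \<in> U" by auto
  then show thesis using assms that[of U \<phi>] by (simp add: chart_def)
qed

lemma subspace_tangent_space:
  assumes "smooth_atlas A"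
  shows "subspace (tangent_space A p)"
proof -
  obtain U \<phi> where "chart A U \<phi>" and p: "p \<in> U" by (rule obtain_chart[OF assms])
  then interpret chart A U \<phi> by simp
  show ?thesis
    unfolding tangent_space_eq[OF p] by (rule linear_subspace_image[OF linear_frame[OF p]]) simp
qed

lemma vfield_on_scaleR:
  fixes A :: "('m::{t2_space,second_countable_topology}, 'e::euclidean_space) atlas"
  assumes A: "smooth_atlas A" and f: "smooth_fun_on A W f" and X: "vfield_on A W X"
  shows "vfield_on A W (\<lambda>q. f q *\<^sub>R X q)"
proof -
  have t: "f q *\<^sub>R X q \<in> tangent_space A q" if "q \<in> W" for q
    by (rule subspace_scale[OF subspace_tangent_space[OF A] vfield_on_tangent[OF X that]])
  have s: "smooth_fun_on A V (\<lambda>q. (f q *\<^sub>R X q) h)" if V: "V \<subseteq> W" "smooth_fun_on A V h" for V h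
  proof -
    obtain U \<phi> where "chart A U \<phi>" by (rule obtain_chart[OF A])
    then have "smooth_fun_on A V f"
      using chart.smooth_fun_on_subset[OF _ f] V smooth_fun_on_open by blast
    then show ?thesis
      using smooth_fun_on_mult[OF _ vfield_on_smooth[OF X V]] by (simp add: scaleR_fun_apply)
  qed
  show ?thesis unfolding vfield_on_def using t s vfield_on_open[OF X] by blast
qed

lemma vfield_on_sum:
  fixes A :: "('m::{t2_space,second_countable_topology}, 'e::euclidean_space) atlas"
  assumes A: "smooth_atlas A" and W: "open W" and X: "\<And>i. i \<in> I \<Longrightarrow> vfield_on A W (X i)"
  shows "vfield_on A W (\<lambda>q. \<Sum>i\<in>I. X i q)"
proof -
  have t: "(\<Sum>i\<in>I. X i q) \<in> tangent_space A q" if "q \<in> W" for q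
    by (rule subspace_sum[OF subspace_tangent_space[OF A]]) (rule vfield_on_tangent[OF X that])
  have s: "smooth_fun_on A V (\<lambda>q. (\<Sum>i\<in>I. X i q) h)" if V: "V \<subseteq> W" "smooth_fun_on A V h" for V h
  proof -
    have "i \<in> I \<Longrightarrow> smooth_fun_on A V (\<lambda>q. X i q h)" for i
      by (rule vfield_on_smooth[OF X V])
    then have "smooth_fun_on A V (\<lambda>q. \<Sum>i\<in>I. X i q h)"
      using smooth_fun_on_open[OF V(2)]
      by (induction I rule: infinite_finite_induct)
        (auto intro!: smooth_fun_on_const[OF A] smooth_fun_on_add)
    then show ?thesis by (simp add: sum_fun_apply)
  qed
  show ?thesis unfolding vfield_on_def using t s W by blast
qed


section \<open>Metric, exterior and Lie derivatives in a chart\<close>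

text \<open>A formula in vector fields defines a value on tangent vectors once that value does not depend on
  the extensions; an extension has to exist for the value to be unique.\<close>

lemma eval1_eq:
  assumes "\<And>X. vfield_near A p X \<Longrightarrow> X p = u \<Longrightarrow> \<Phi> X p = r"
    and "vfield_near A p X" "X p = u"
  shows "eval1 A \<Phi> p u = r"
  unfolding eval1_def using assms by (intro the_equality) blast+

lemma eval2_eq:
  assumes "\<And>X Y. vfield_near A p X \<Longrightarrow> vfield_near A p Y \<Longrightarrow> X p = u \<Longrightarrow> Y p = v \<Longrightarrow> \<Phi> X Y p = r"
    and "vfield_near A p X" "X p = u" "vfield_near A p Y" "Y p = v"
  shows "eval2 A \<Phi> p u v = r"
  unfolding eval2_def using assms by (intro the_equality) blast+

locale metric_chart = chart +
  fixes g :: "'a bilform"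
  assumes metric: "lorentzian_metric A g"
begin

lemma g_sym: "u \<in> tangent_space A p \<Longrightarrow> v \<in> tangent_space A p \<Longrightarrow> g p u v = g p v u"
  using metric unfolding lorentzian_metric_def by blast

lemma g_combine:
  "u \<in> tangent_space A p \<Longrightarrow> v \<in> tangent_space A p \<Longrightarrow> w \<in> tangent_space A p \<Longrightarrow>
    g p (r *\<^sub>R u + v) w = r * g p u w + g p v w"
  using metric unfolding lorentzian_metric_def by blast

lemma g_smooth:
  "vfield_on A W X \<Longrightarrow> vfield_on A W Y \<Longrightarrow> smooth_fun_on A W (\<lambda>p. g p (X p) (Y p))"
  using metric unfolding lorentzian_metric_def by blast

definition G :: "'b \<Rightarrow> 'b \<Rightarrow> 'b \<Rightarrow> real" where
  "G x a b = g (\<psi> x) (\<partial> a (\<psi> x)) (\<partial> b (\<psi> x))"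

lemma G_frame: "p \<in> U \<Longrightarrow> g p (\<partial> a p) (\<partial> b p) = G (\<phi> p) a b"
  by (simp add: G_def)

lemma G_sym: "x \<in> \<phi> ` U \<Longrightarrow> G x a b = G x b a"
  unfolding G_def by (rule g_sym; rule frame_tangent; simp)

lemma G_family: "bilinear_family (\<phi> ` U) G"
  unfolding bilinear_family_def
proof (intro conjI ballI allI)
  fix x assume x: "x \<in> \<phi> ` U"
  let ?p = "\<psi> x"
  have p: "?p \<in> U" using x by simp
  note t = frame_tangent[OF p]
  note lf = linear_frame[OF p]
  have add: "G x (a + b) w = G x a w + G x b w" for a b w
    using g_combine[OF t t t, where r = 1] by (simp add: G_def linear_add[OF lf])
  have z: "G x 0 w = 0" for w using add[of 0 0 w] by simp
  have scale: "G x (r *\<^sub>R a) w = r * G x a w" for r a w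
    using g_combine[OF t t[of 0] t, where r = r] z[of w]
    by (simp add: G_def linear_cmul[OF lf] linear_0[OF lf])
  have "linear (\<lambda>a. G x a w)" for w by (rule linearI) (simp_all add: add scale)
  moreover have "G x w = (\<lambda>a. G x a w)" for w using G_sym[OF x] by blast
  ultimately show "bilinear (G x)" unfolding bilinear_def by (metis (lifting))
next
  fix a b
  have "smooth_on (\<phi> ` U) ((\<lambda>p. g p (\<partial> a p) (\<partial> b p)) \<circ> \<psi>)"
    by (rule smooth_fun_onD_subset[OF g_smooth[OF vfield_on_frame vfield_on_frame] order.refl])
  then show "smooth_on (\<phi> ` U) (\<lambda>x. G x a b)" by (simp add: comp_def G_def)
qed

abbreviation dG :: "'a \<Rightarrow> 'b \<Rightarrow> 'b \<Rightarrow> 'b \<Rightarrow> real" where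
  "dG p \<equiv> dirderiv2 G (\<phi> p)"

lemma bilinear_G: "p \<in> U \<Longrightarrow> bilinear (G (\<phi> p))"
  by (rule bilinear_family_bilinear[OF G_family]) simp

lemma bilinear_dG: "p \<in> U \<Longrightarrow> bilinear (dG p v)"
  by (rule bilinear_dirderiv2[OF G_family]) simp

lemma linear_dG: "p \<in> U \<Longrightarrow> linear (\<lambda>v. dG p v a b)"
  by (rule linear_dirderiv2[OF G_family]) simp

lemma metric_vfields:
  assumes X: "vfield_near A p X" and Y: "vfield_near A p Y" and p: "p \<in> U"
  shows "\<partial> a p (\<lambda>q. g q (X q) (Y q)) = dG p a (coords (X p)) (coords (Y p))
    + G (\<phi> p) (drep X p a) (coords (Y p)) + G (\<phi> p) (coords (X p)) (drep Y p a)"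
proof -
  obtain W1 where W1: "p \<in> W1" "open W1" "vfield_on A W1 X"
    by (rule vfield_near_obtain[OF X p open_U p])
  obtain W where W: "p \<in> W" "open W" "W \<subseteq> U" "W \<subseteq> W1" "vfield_on A W Y"
    by (rule vfield_near_obtain[OF Y p W1(2,1)])
  have XW: "vfield_on A W X" by (rule vfield_on_subset[OF W1(3) W(2,4)])
  have x: "\<phi> p \<in> \<phi> ` U" using p by simp
  have "((\<lambda>x. G x (rep X x) (rep Y x)) has_derivative
    (\<lambda>a. dG p a (rep X (\<phi> p)) (rep Y (\<phi> p)) + G (\<phi> p) (drep X p a) (rep Y (\<phi> p))
      + G (\<phi> p) (rep X (\<phi> p)) (drep Y p a))) (at (\<phi> p))"
    by (rule bilinear_family_compose_has_derivative[OF G_family UNIV_I has_derivative_ident x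
          rep_has_derivative[OF X p] rep_has_derivative[OF Y p]])
  then have "((\<lambda>q. g q (X q) (Y q)) \<circ> \<psi> has_derivative
    (\<lambda>a. dG p a (rep X (\<phi> p)) (rep Y (\<phi> p)) + G (\<phi> p) (drep X p a) (rep Y (\<phi> p))
      + G (\<phi> p) (rep X (\<phi> p)) (drep Y p a))) (at (\<phi> p))"
  proof (rule has_derivative_transform_within_open[OF _ open_image_subset[OF W(2,3)]])
    fix x assume "x \<in> \<phi> ` W"
    then obtain q where q: "q \<in> W" "x = \<phi> q" "q \<in> U" using W by auto
    show "G x (rep X x) (rep Y x) = ((\<lambda>q. g q (X q) (Y q)) \<circ> \<psi>) x"
      using q vfield_frame[OF XW q(1,3)] vfield_frame[OF W(5) q(1,3)] by (simp add: G_def)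
  qed (use W in auto)
  from frame_eq[OF smooth_fun_on_smooth_near[OF g_smooth[OF XW W(5)] W(1)] p this, of a]
  show ?thesis using p by simp
qed

lemma flat_frame:
  assumes "vfield_near A p N" "p \<in> U"
  shows "flat g N p (\<partial> a p) = G (\<phi> p) (coords (N p)) a"
  using vfield_near_frame[OF assms] G_frame[OF assms(2), of "coords (N p)" a] by (simp add: flat_def)

lemmas G_bilinear_simps =
  bilinear_ladd[OF bilinear_G] bilinear_radd[OF bilinear_G] bilinear_lsub[OF bilinear_G]
  bilinear_rsub[OF bilinear_G] bilinear_lmul[OF bilinear_G] bilinear_rmul[OF bilinear_G]

text \<open>In this lemma and the next two, the derivatives of the extensions cancel against the
  bracket. What remains is visibly independent of the extensions.\<close>

lemma ext_deriv_frame: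
  assumes N: "vfield_near A p N" and p: "p \<in> U"
  shows "ext_deriv A (flat g N) p (\<partial> a p) (\<partial> b p)
    = dG p a (coords (N p)) b + G (\<phi> p) (drep N p a) b
      - dG p b (coords (N p)) a - G (\<phi> p) (drep N p b) a"
  unfolding ext_deriv_def
proof (rule eval2_eq[OF _ vfield_near_frame_field[OF p] refl vfield_near_frame_field[OF p] refl])
  fix X Y assume X: "vfield_near A p X" "X p = \<partial> a p" and Y: "vfield_near A p Y" "Y p = \<partial> b p"
  have c: "coords (X p) = a" "coords (Y p) = b" using X Y p by simp_all
  have XY: "X p (\<lambda>q. flat g N q (Y q)) = dG p a (coords (N p)) b + G (\<phi> p) (drep N p a) b
      + G (\<phi> p) (coords (N p)) (drep Y p a)"
    using metric_vfields[OF N Y(1) p, of a] c X by (simp add: flat_def)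
  have YX: "Y p (\<lambda>q. flat g N q (X q)) = dG p b (coords (N p)) a + G (\<phi> p) (drep N p b) a
      + G (\<phi> p) (coords (N p)) (drep X p b)"
    using metric_vfields[OF N X(1) p, of b] c Y by (simp add: flat_def)
  have br: "flat g N p (lie_bracket A X Y p)
      = G (\<phi> p) (coords (N p)) (drep Y p a) - G (\<phi> p) (coords (N p)) (drep X p b)"
    unfolding lie_bracket_frame[OF X(1) Y(1) p] flat_frame[OF N p] c
    by (rule bilinear_rsub[OF bilinear_G[OF p]])
  show "X p (\<lambda>q. flat g N q (Y q)) - Y p (\<lambda>q. flat g N q (X q)) - flat g N p (lie_bracket A X Y p)
    = dG p a (coords (N p)) b + G (\<phi> p) (drep N p a) b
      - dG p b (coords (N p)) a - G (\<phi> p) (drep N p b) a"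
    unfolding XY YX br by simp
qed

lemma lie_form_frame:
  assumes Z: "vfield_near A p Z" and N: "vfield_near A p N" and p: "p \<in> U"
  shows "lie_form A Z (flat g N) p (\<partial> a p)
    = dG p (coords (Z p)) (coords (N p)) a + G (\<phi> p) (drep N p (coords (Z p))) a
      + G (\<phi> p) (coords (N p)) (drep Z p a)"
  unfolding lie_form_def
proof (rule eval1_eq[OF _ vfield_near_frame_field[OF p] refl])
  fix X assume X: "vfield_near A p X" "X p = \<partial> a p"
  have c: "coords (X p) = a" using X p by simp
  let ?z = "coords (Z p)"
  have ZX: "Z p (\<lambda>q. flat g N q (X q)) = dG p ?z (coords (N p)) a + G (\<phi> p) (drep N p ?z) a
      + G (\<phi> p) (coords (N p)) (drep X p ?z)"
    using metric_vfields[OF N X(1) p, of ?z] c vfield_near_frame[OF Z p] by (simp add: flat_def)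
  have br: "flat g N p (lie_bracket A Z X p)
      = G (\<phi> p) (coords (N p)) (drep X p ?z) - G (\<phi> p) (coords (N p)) (drep Z p a)"
    unfolding lie_bracket_frame[OF Z X(1) p] flat_frame[OF N p] c
    by (rule bilinear_rsub[OF bilinear_G[OF p]])
  show "Z p (\<lambda>q. flat g N q (X q)) - flat g N p (lie_bracket A Z X p)
    = dG p ?z (coords (N p)) a + G (\<phi> p) (drep N p ?z) a + G (\<phi> p) (coords (N p)) (drep Z p a)"
    unfolding ZX br by simp
qed

lemma lie_metric_frame:
  assumes Z: "vfield_near A p Z" and p: "p \<in> U"
  shows "lie_metric A Z g p (\<partial> a p) (\<partial> b p)
    = dG p (coords (Z p)) a b + G (\<phi> p) (drep Z p a) b + G (\<phi> p) a (drep Z p b)"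
  unfolding lie_metric_def
proof (rule eval2_eq[OF _ vfield_near_frame_field[OF p] refl vfield_near_frame_field[OF p] refl])
  fix X Y assume X: "vfield_near A p X" "X p = \<partial> a p" and Y: "vfield_near A p Y" "Y p = \<partial> b p"
  have c: "coords (X p) = a" "coords (Y p) = b" using X Y p by simp_all
  let ?z = "coords (Z p)"
  have ZXY: "Z p (\<lambda>q. g q (X q) (Y q)) = dG p ?z a b + G (\<phi> p) (drep X p ?z) b
      + G (\<phi> p) a (drep Y p ?z)"
    using metric_vfields[OF X(1) Y(1) p, of ?z] c vfield_near_frame[OF Z p] by simp
  show "Z p (\<lambda>q. g q (X q) (Y q)) - g p (lie_bracket A Z X p) (Y p)
      - g p (X p) (lie_bracket A Z Y p)
    = dG p ?z a b + G (\<phi> p) (drep Z p a) b + G (\<phi> p) a (drep Z p b)"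
    unfolding ZXY lie_bracket_frame[OF Z X(1) p] lie_bracket_frame[OF Z Y(1) p] X(2) Y(2)
      G_frame[OF p] by (simp add: p G_bilinear_simps)
qed

lemma linear_coords: "linear coords"
  by (rule linearI)
    (simp_all add: coords_def scaleR_fun_apply scaleR_add_left sum.distrib scaleR_sum_right)

text \<open>Non-degeneracy: in a pseudo-orthonormal basis the representing vector can be written down.\<close>

lemma metric_represents:
  assumes p: "p \<in> U" and l: "linear l"
  shows "\<exists>t. \<forall>a. G (\<phi> p) t a = l a"
proof -
  obtain e :: "'b \<Rightarrow> 'a tvec" and b0 where e: "span (e ` Basis) = tangent_space A p"
    and ge: "\<And>b b'. b \<in> Basis \<Longrightarrow> b' \<in> Basis \<Longrightarrow>
      g p (e b) (e b') = (if b = b' then if b = b0 then -1 else 1 else 0)"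
  proof -
    have "\<exists>(e :: 'b \<Rightarrow> 'a tvec). \<exists>b0\<in>Basis. span (e ` Basis) = tangent_space A p \<and>
      (\<forall>b\<in>Basis. \<forall>b'\<in>Basis.
         g p (e b) (e b') = (if b = b' then if b = b0 then -1 else 1 else 0))"
      using metric unfolding lorentzian_metric_def by blast
    then show thesis by (elim exE bexE conjE) (rule that, auto)
  qed
  \<comment> \<open>\<open>s b\<close> is the sign of \<open>g\<close> on the basis vector \<open>e b\<close>.\<close>
  define f where "f = (\<lambda>b. coords (e b))"
  define s where "s = (\<lambda>b. if b = b0 then -1 else 1 :: real)"
  define t where "t = (\<Sum>b\<in>Basis. (s b * l (f b)) *\<^sub>R f b)"
  have ef: "e b = \<partial> (f b) p" if "b \<in> Basis" for b
    using tangent_frame[OF p] e span_base[of "e b" "e ` Basis"] that by (simp add: f_def)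
  have Gf: "G (\<phi> p) (f b) (f b') = (if b = b' then s b else 0)" if "b \<in> Basis" "b' \<in> Basis" for b b'
    using ge[OF that] ef that G_frame[OF p] by (simp add: s_def)
  have lt: "linear (G (\<phi> p) t)" "\<And>b. linear (\<lambda>a. G (\<phi> p) a b)"
    using bilinear_G[OF p] unfolding bilinear_def by blast+
  have tf: "G (\<phi> p) t (f b') = l (f b')" if b': "b' \<in> Basis" for b'
  proof -
    have "G (\<phi> p) t (f b') = (\<Sum>b\<in>Basis. (s b * l (f b)) * G (\<phi> p) (f b) (f b'))"
      unfolding t_def linear_sum[OF lt(2)] by (simp add: linear_cmul[OF lt(2)])
    also have "\<dots> = (\<Sum>b\<in>Basis. if b = b' then (s b * l (f b)) * s b else 0)"
      by (rule sum.cong) (use Gf b' in auto)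
    also have "\<dots> = l (f b')" using b' by (simp add: s_def)
    finally show ?thesis .
  qed
  have "G (\<phi> p) t a = l a" for a
  proof (rule linear_eq_on[OF lt(1) l])
    show "G (\<phi> p) t v = l v" if "v \<in> f ` Basis" for v using that tf by auto
    have "coords (\<partial> a p) \<in> coords ` span (e ` Basis)" using frame_tangent[OF p] e by auto
    also have "coords ` span (e ` Basis) = span (coords ` e ` Basis)"
      by (rule linear_span_image[OF linear_coords, symmetric])
    finally show "a \<in> span (f ` Basis)" using p by (simp add: f_def image_image)
  qed
  then show ?thesis by blast
qed

end


section \<open>Metric connections in a chart\<close>

locale connection_chart = metric_chart +
  fixes nabla :: "'a connection"
  assumes affine: "affine_connection A nabla" and compatible: "metric_connection A g nabla"
begin

lemma nabla_combine:
  "u \<in> tangent_space A p \<Longrightarrow> v \<in> tangent_space A p \<Longrightarrow> vfield_near A p Y \<Longrightarrow>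
    nabla p (r *\<^sub>R u + v) Y = r *\<^sub>R nabla p u Y + nabla p v Y"
  using affine unfolding affine_connection_def by blast

lemma nabla_add:
  "v \<in> tangent_space A p \<Longrightarrow> vfield_near A p Y \<Longrightarrow> vfield_near A p Z \<Longrightarrow>
    nabla p v (\<lambda>q. Y q + Z q) = nabla p v Y + nabla p v Z"
  using affine unfolding affine_connection_def by blast

lemma nabla_leibniz:
  "v \<in> tangent_space A p \<Longrightarrow> vfield_near A p Y \<Longrightarrow> smooth_near A p f \<Longrightarrow>
    nabla p v (\<lambda>q. f q *\<^sub>R Y q) = v f *\<^sub>R Y p + f p *\<^sub>R nabla p v Y"
  using affine unfolding affine_connection_def by blast

lemma nabla_vfield: "vfield_on A W X \<Longrightarrow> vfield_on A W Y \<Longrightarrow> vfield_on A W (\<lambda>p. nabla p (X p) Y)"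
  using affine unfolding affine_connection_def by blast

text \<open>Multiplying by the indicator function of a neighbourhood, which is smooth near the point and
  has derivative \<open>0\<close> there, shows that covariant derivatives are local.\<close>

lemma nabla_germ:
  assumes p: "p \<in> U" "p \<in> W" and W: "open W" and Y: "vfield_near A p Y" and Z: "vfield_near A p Z"
    and v: "v \<in> tangent_space A p" and eq: "\<And>q. q \<in> W \<Longrightarrow> Y q = Z q"
  shows "nabla p v Y = nabla p v Z"
proof -
  define f :: "'a \<Rightarrow> real" where "f = indicator W"
  have UW: "open (W \<inter> U)" using W open_U by auto
  have "smooth_fun_on A (W \<inter> U) f"
    by (rule smooth_fun_onI[OF UW], simp,
        rule smooth_on_cong[OF smooth_on_const[OF open_image[OF W], of 1]]) (auto simp: f_def)
  then have f: "smooth_near A p f" by (rule smooth_fun_on_smooth_near) (use p in auto)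
  have "((\<lambda>_. 1 :: real) has_derivative (\<lambda>_. 0)) (at (\<phi> p))" by simp
  then have "(f \<circ> \<psi> has_derivative (\<lambda>_. 0)) (at (\<phi> p))"
    by (rule has_derivative_transform_within_open[OF _ open_image[OF W]])
      (use p in \<open>auto simp: f_def\<close>)
  from frame_eq[OF f p(1) this] have "v f = 0" using tangent_frame[OF p(1) v] by metis
  then have *: "nabla p v (\<lambda>q. f q *\<^sub>R X q) = nabla p v X" if "vfield_near A p X" for X
    using nabla_leibniz[OF v that f] p by (simp add: f_def)
  have "(\<lambda>q. f q *\<^sub>R Y q) = (\<lambda>q. f q *\<^sub>R Z q)" 
  proof
    fix q show "f q *\<^sub>R Y q = f q *\<^sub>R Z q" by (cases "q \<in> W") (simp_all add: f_def eq)
  qed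
  then show ?thesis using *[OF Y] *[OF Z] by simp
qed

lemma nabla_sum:
  assumes v: "v \<in> tangent_space A p" and W: "p \<in> W" "open W"
    and X: "\<And>i. i \<in> I \<Longrightarrow> vfield_on A W (X i)" and I: "finite I"
  shows "nabla p v (\<lambda>q. \<Sum>i\<in>I. X i q) = (\<Sum>i\<in>I. nabla p v (X i))"
  using I X
proof (induction I rule: finite_induct)
  case empty
  have "vfield_on A W (\<lambda>q. \<Sum>i\<in>{}. X i q)" by (rule vfield_on_sum[OF atlas W(2)]) simp
  then have "vfield_near A p (\<lambda>q. 0)" using W by (auto intro: vfield_on_near)
  from nabla_add[OF v this this] show ?case by (simp del: zero_fun_apply)
next
  case (insert i I)
  have "vfield_near A p (X i)" "vfield_near A p (\<lambda>q. \<Sum>i\<in>I. X i q)"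
    using insert.prems W by (auto intro!: vfield_on_near[OF _ W(1)] vfield_on_sum atlas)
  from nabla_add[OF v this] insert show ?case by (simp only: sum.insert insert_iff simp_thms)
qed

text \<open>The Christoffel symbols of the chart, contracted with two coordinate vectors.\<close>

definition \<Gamma> :: "'a \<Rightarrow> 'b \<Rightarrow> 'b \<Rightarrow> 'b" where
  "\<Gamma> p a b = (\<Sum>j\<in>Basis. (b \<bullet> j) *\<^sub>R coords (nabla p (\<partial> a p) (\<partial> j)))"

lemma nabla_frame_tangent: "p \<in> U \<Longrightarrow> nabla p (\<partial> a p) (\<partial> b) \<in> tangent_space A p"
  by (rule vfield_on_tangent[OF nabla_vfield[OF vfield_on_frame vfield_on_frame]])

lemma frame_\<Gamma>:
  assumes "p \<in> U"
  shows "\<partial> (\<Gamma> p a b) p = (\<Sum>j\<in>Basis. (b \<bullet> j) *\<^sub>R nabla p (\<partial> a p) (\<partial> j))"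
  unfolding \<Gamma>_def linear_sum[OF linear_frame[OF assms]] linear_cmul[OF linear_frame[OF assms]]
  by (simp add: tangent_frame[OF assms nabla_frame_tangent[OF assms]])

lemma bilinear_\<Gamma>:
  assumes p: "p \<in> U"
  shows "bilinear (\<Gamma> p)"
proof -
  note l = linear_frame[OF p]
  have add: "nabla p (\<partial> (a + b) p) (\<partial> j) = nabla p (\<partial> a p) (\<partial> j) + nabla p (\<partial> b p) (\<partial> j)"
    for a b j
    using nabla_combine[OF frame_tangent[OF p] frame_tangent[OF p] vfield_near_frame_field[OF p],
        of 1 a b j] by (simp add: linear_add[OF l])
  have z: "nabla p (\<partial> 0 p) (\<partial> j) = 0" for j using add[of 0 0 j] by simp
  have scale: "nabla p (\<partial> (r *\<^sub>R a) p) (\<partial> j) = r *\<^sub>R nabla p (\<partial> a p) (\<partial> j)" for r a j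
    using nabla_combine[OF frame_tangent[OF p] frame_tangent[OF p] vfield_near_frame_field[OF p],
        of r a 0 j] z[of j] by (simp add: linear_cmul[OF l] linear_0[OF l])
  show ?thesis
    unfolding bilinear_def \<Gamma>_def
    by (intro conjI allI linearI)
      (simp_all add: add scale linear_add[OF linear_coords] linear_cmul[OF linear_coords]
        inner_add_left scaleR_add_left scaleR_add_right sum.distrib scaleR_sum_right mult.commute)
qed

text \<open>Near \<open>p\<close> the field is a combination of coordinate fields with smooth coefficients, to which
  additivity and the Leibniz rule apply; locality allows this replacement.\<close>

lemma nabla_frame:
  assumes Y: "vfield_near A p Y" and p: "p \<in> U"
  shows "nabla p (\<partial> a p) Y = \<partial> (drep Y p a + \<Gamma> p a (coords (Y p))) p"
proof -
  obtain W where W: "p \<in> W" "open W" "W \<subseteq> U" "vfield_on A W Y"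
    by (rule vfield_near_obtain[OF Y p open_U p])
  define f where "f = (\<lambda>j q. Y q (\<lambda>q. \<phi> q \<bullet> j))"
  have f: "smooth_fun_on A W (f j)" for j
    unfolding f_def
    by (rule vfield_on_smooth[OF W(4) order.refl smooth_fun_on_subset[OF coordinate_smooth W(2,3)]])
  have fc: "f j q = coords (Y q) \<bullet> j" if "j \<in> Basis" for j q
    unfolding f_def coords_def using that by (simp add: inner_sum_left inner_Basis if_distrib cong: if_cong)
  have fr: "vfield_on A W (\<partial> j)" for j by (rule vfield_on_subset[OF vfield_on_frame W(2,3)])
  have fX: "vfield_on A W (\<lambda>q. f j q *\<^sub>R \<partial> j q)" for j by (rule vfield_on_scaleR[OF atlas f fr])
  have t: "\<partial> a p \<in> tangent_space A p" by (rule frame_tangent[OF p])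
  have d: "\<partial> a p (f j) = drep Y p a \<bullet> j" if j: "j \<in> Basis" for j
  proof (rule frame_eq[OF smooth_fun_on_smooth_near[OF f W(1)] p])
    have "f j \<circ> \<psi> = (\<lambda>x. rep Y x \<bullet> j)" by (auto simp: fc[OF j] rep_def)
    then show "(f j \<circ> \<psi> has_derivative (\<lambda>a. drep Y p a \<bullet> j)) (at (\<phi> p))"
      using has_derivative_inner_left[OF rep_has_derivative[OF Y p]] by simp
  qed
  have "nabla p (\<partial> a p) Y = nabla p (\<partial> a p) (\<lambda>q. \<Sum>j\<in>Basis. f j q *\<^sub>R \<partial> j q)"
  proof (rule nabla_germ[OF p W(1,2) Y _ t])
    show "vfield_near A p (\<lambda>q. \<Sum>j\<in>Basis. f j q *\<^sub>R \<partial> j q)"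
      by (rule vfield_on_near[OF vfield_on_sum[OF atlas W(2) fX] W(1)])
    fix q assume q: "q \<in> W"
    then have qU: "q \<in> U" using W by auto
    have "Y q = \<partial> (coords (Y q)) q" by (rule vfield_frame[OF W(4) q qU, symmetric])
    also have "\<dots> = (\<Sum>j\<in>Basis. (coords (Y q) \<bullet> j) *\<^sub>R \<partial> j q)"
      by (rule linear_basis_expand[OF linear_frame[OF qU]])
    finally show "Y q = (\<Sum>j\<in>Basis. f j q *\<^sub>R \<partial> j q)" by (simp add: fc)
  qed
  also have "\<dots> = (\<Sum>j\<in>Basis. nabla p (\<partial> a p) (\<lambda>q. f j q *\<^sub>R \<partial> j q))"
    by (rule nabla_sum[OF t W(1,2) fX finite_Basis])
  also have "\<dots> = (\<Sum>j\<in>Basis. (drep Y p a \<bullet> j) *\<^sub>R \<partial> j p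
      + (coords (Y p) \<bullet> j) *\<^sub>R nabla p (\<partial> a p) (\<partial> j))"
    by (rule sum.cong[OF refl])
      (simp add: nabla_leibniz[OF t vfield_near_frame_field[OF p] smooth_fun_on_smooth_near[OF f W(1)]] d,
       simp add: fc)
  also have "\<dots> = \<partial> (drep Y p a) p + \<partial> (\<Gamma> p a (coords (Y p))) p"
    unfolding frame_\<Gamma>[OF p] sum.distrib
    by (subst linear_basis_expand[OF linear_frame[OF p], of "drep Y p a"]) (rule refl)
  also have "\<dots> = \<partial> (drep Y p a + \<Gamma> p a (coords (Y p))) p"
    by (rule linear_add[OF linear_frame[OF p], symmetric])
  finally show ?thesis .
qed

text \<open>The derivatives of \<open>X\<close> and \<open>Y\<close> cancel against the bracket, so the torsion is a tensor. This is what
  allows torsion conditions on sections of subbundles to be used at single vectors.\<close>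

lemma torsion_frame:
  assumes X: "vfield_near A p X" and Y: "vfield_near A p Y" and p: "p \<in> U"
  shows "torsion A nabla X Y p
    = \<partial> (\<Gamma> p (coords (X p)) (coords (Y p)) - \<Gamma> p (coords (Y p)) (coords (X p))) p"
proof -
  have "torsion A nabla X Y p = nabla p (\<partial> (coords (X p)) p) Y - nabla p (\<partial> (coords (Y p)) p) X
      - lie_bracket A X Y p"
    using vfield_near_frame[OF X p] vfield_near_frame[OF Y p] by (simp add: torsion_def)
  then show ?thesis
    unfolding nabla_frame[OF X p] nabla_frame[OF Y p] lie_bracket_frame[OF X Y p]
    by (simp add: linear_diff[OF linear_frame[OF p], symmetric])
qed

lemma metric_compatible_frame:
  assumes p: "p \<in> U"
  shows "dG p a b c = G (\<phi> p) (\<Gamma> p a b) c + G (\<phi> p) b (\<Gamma> p a c)"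
proof -
  note near = vfield_near_frame_field[OF p]
  have n: "nabla p (\<partial> a p) (\<partial> b) = \<partial> (\<Gamma> p a b) p" for a b
    using nabla_frame[OF near p] p by (simp add: drep_frame)
  have "\<partial> a p (\<lambda>q. g q (\<partial> b q) (\<partial> c q)) = g p (nabla p (\<partial> a p) (\<partial> b)) (\<partial> c p)
      + g p (\<partial> b p) (nabla p (\<partial> a p) (\<partial> c))"
    using compatible frame_tangent[OF p] near unfolding metric_connection_def by blast
  then have "\<partial> a p (\<lambda>q. g q (\<partial> b q) (\<partial> c q)) = G (\<phi> p) (\<Gamma> p a b) c + G (\<phi> p) b (\<Gamma> p a c)"
    by (simp add: n G_frame[OF p])
  then show ?thesis
    using metric_vfields[OF near near p, of a b c] p
    by (simp add: drep_frame bilinear_lzero[OF bilinear_G] bilinear_rzero[OF bilinear_G])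
qed

end


section \<open>Sections of subbundles\<close>

lemma section_on_subset:
  "section_on A W V X \<Longrightarrow> open W' \<Longrightarrow> W' \<subseteq> W \<Longrightarrow> section_on A W' V X"
  unfolding section_on_def using vfield_on_subset by blast

lemma smooth_subbundle_frame:
  assumes "smooth_subbundle A r V"
  obtains W E where "p \<in> W" "\<forall>i<r. vfield_on A W (E i)"
    "\<forall>q\<in>W. inj_on (\<lambda>i. E i q) {..<r}"
    "\<forall>q\<in>W. V q = span ((\<lambda>i. E i q) ` {..<r})"
proof -
  obtain W E where "p \<in> W \<and> (\<forall>i<r. vfield_on A W (E i)) \<and>
        (\<forall>q\<in>W. inj_on (\<lambda>i. E i q) {..<r} \<and> independent ((\<lambda>i. E i q) ` {..<r}) \<and>
               V q = span ((\<lambda>i. E i q) ` {..<r}))"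
    using spec[OF assms[unfolded smooth_subbundle_def], of p] by (elim exE)
  then show thesis by (intro that[of W E]) auto
qed

lemma subbundle_subspace:
  assumes "smooth_subbundle A r V"
  shows "subspace (V p)"
proof -
  obtain W E where "p \<in> W" "\<forall>i<r. vfield_on A W (E i)"
    "\<forall>q\<in>W. inj_on (\<lambda>i. E i q) {..<r}"
    "\<forall>q\<in>W. V q = span ((\<lambda>i. E i q) ` {..<r})"
    by (rule smooth_subbundle_frame[OF assms, of p])
  then show ?thesis by simp
qed

lemma subbundle_tangent:
  assumes A: "smooth_atlas A" and V: "smooth_subbundle A r V"
  shows "V p \<subseteq> tangent_space A p"
proof -
  obtain W E where W: "p \<in> W" "\<forall>i<r. vfield_on A W (E i)"
    "\<forall>q\<in>W. inj_on (\<lambda>i. E i q) {..<r}"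
    "\<forall>q\<in>W. V q = span ((\<lambda>i. E i q) ` {..<r})"
    by (rule smooth_subbundle_frame[OF V, of p])
  have "(\<lambda>i. E i p) ` {..<r} \<subseteq> tangent_space A p"
    using W vfield_on_tangent[of A W "E _" p] by auto
  then show ?thesis unfolding bspec[OF W(4,1)] by (rule span_minimal[OF _ subspace_tangent_space[OF A]])
qed

lemma line_subbundle_multiple:
  assumes V: "smooth_subbundle A 1 V" and v: "v \<in> V p" "v \<noteq> 0" and x: "x \<in> V p"
  obtains r where "x = r *\<^sub>R v"
proof -
  obtain W E where W: "p \<in> W" "\<forall>i<1::nat. vfield_on A W (E i)"
    "\<forall>q\<in>W. inj_on (\<lambda>i. E i q) {..<1::nat}"
    "\<forall>q\<in>W. V q = span ((\<lambda>i. E i q) ` {..<1::nat})"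
    by (rule smooth_subbundle_frame[OF V, of p])
  note E = bspec[OF W(4,1)]
  have "(\<lambda>i. E i p) ` {..<1::nat} = {E 0 p}" by auto
  then have "V p = range (\<lambda>k. k *\<^sub>R E 0 p)" unfolding E by (simp only: span_singleton)
  then obtain a b where ab: "v = a *\<^sub>R E 0 p" "x = b *\<^sub>R E 0 p" using v x by auto
  with v have "a \<noteq> 0" by auto
  then have "x = (b / a) *\<^sub>R v" by (simp only: ab scaleR_scaleR) simp
  then show thesis by (rule that)
qed

text \<open>The section has constant coefficients in a local frame. Rank \<open>0\<close> is treated separately because an
  empty frame does not make its domain open.\<close>

lemma subbundle_section_through:
  fixes A :: "('m::{t2_space,second_countable_topology}, 'e::euclidean_space) atlas"
  assumes A: "smooth_atlas A" and V: "smooth_subbundle A r V" and v: "v \<in> V p"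
  obtains W X where "p \<in> W" "section_on A W V X" "X p = v"
proof -
  obtain W E where W: "p \<in> W" "\<forall>i<r. vfield_on A W (E i)"
    "\<forall>q\<in>W. inj_on (\<lambda>i. E i q) {..<r}"
    "\<forall>q\<in>W. V q = span ((\<lambda>i. E i q) ` {..<r})"
    by (rule smooth_subbundle_frame[OF V, of p])
  note E = W(3,4)
  have "v \<in> span ((\<lambda>i. E i p) ` {..<r})" using E W(1) v by auto
  then obtain u where "v = (\<Sum>e\<in>(\<lambda>i. E i p) ` {..<r}. u e *\<^sub>R e)"
    unfolding span_finite[OF finite_imageI[OF finite_lessThan]] by (elim rangeE)
  then have v_eq: "v = (\<Sum>i<r. u (E i p) *\<^sub>R E i p)"
    using E W(1) by (simp add: sum.reindex)
  define X where "X = (\<lambda>q. \<Sum>i<r. u (E i p) *\<^sub>R E i q)"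
  show thesis
  proof (cases "r = 0")
    case True
    have z: "X = (\<lambda>q. 0)" by (simp add: X_def True)
    have "vfield_on A UNIV X"
      using vfield_on_sum[OF A open_UNIV, of "{}"] by (simp add: z del: zero_fun_apply)
    then show thesis
      using that[of UNIV X] v_eq subspace_0[OF subbundle_subspace[OF V]]
      by (simp add: section_on_def z True)
  next
    case False
    then have "open W" using W(2) vfield_on_open by blast
    then have "vfield_on A W X"
      unfolding X_def using W(2)
      by (intro vfield_on_sum[OF A] vfield_on_scaleR[OF A smooth_fun_on_const[OF A]]) auto
    moreover have "X q \<in> V q" if "q \<in> W" for q
      unfolding X_def
      by (rule subspace_sum[OF subbundle_subspace[OF V]], rule subspace_scale[OF subbundle_subspace[OF V]])
        (use E that in \<open>auto intro: span_base\<close>)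
    ultimately show thesis using that[of W X] W(1) v_eq by (simp add: section_on_def X_def)
  qed
qed


section \<open>The canonical Witt connection in a chart\<close>

locale witt_chart = connection_chart +
  fixes Vp Vps Vq :: "'a \<Rightarrow> 'a tvec set" and \<nu> \<nu>s :: "'a vfield"
  assumes witt: "witt_structure A g Vp Vps Vq \<nu> \<nu>s"
    and canonical: "canonical_witt_connection A g Vq \<nu> \<nu>s nabla"
begin

lemma witt_subbundles:
  shows Vp: "smooth_subbundle A 1 Vp" and Vps: "smooth_subbundle A 1 Vps"
    and Vq: "\<exists>r. smooth_subbundle A r Vq"
  using witt unfolding witt_structure_def by - (elim conjE, assumption)+

lemma Vq_subspace: "subspace (Vq p)"
  using Vq subbundle_subspace by blast

lemma Vq_tangent: "z \<in> Vq p \<Longrightarrow> z \<in> tangent_space A p"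
  using Vq subbundle_tangent[OF atlas] by blast

lemma witt_decomposition:
  assumes "v \<in> tangent_space A p"
  shows "\<exists>x y z. x \<in> Vp p \<and> y \<in> Vps p \<and> z \<in> Vq p \<and> v = x + y + z"
proof -
  have "\<forall>p. \<forall>v\<in>tangent_space A p.
      \<exists>!(x, y, z). x \<in> Vp p \<and> y \<in> Vps p \<and> z \<in> Vq p \<and> v = x + y + z"
    using witt unfolding witt_structure_def by (elim conjE)
  from ex1_implies_ex[OF bspec[OF spec[OF this] assms]] show ?thesis
    unfolding split_paired_Ex prod.case .
qed

lemma witt_orthogonal:
  assumes "x \<in> Vp p" "y \<in> Vps p" "z \<in> Vq p"
  shows "g p (x + y) z = 0"
proof -
  have "\<forall>p. \<forall>x\<in>Vp p. \<forall>y\<in>Vps p. \<forall>z\<in>Vq p. g p (x + y) z = 0"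
    using witt unfolding witt_structure_def by (elim conjE)
  then show ?thesis using assms by blast
qed

lemma witt_null: "x \<in> Vp p \<Longrightarrow> g p x x = 0" "y \<in> Vps p \<Longrightarrow> g p y y = 0"
proof -
  have "\<forall>p. \<forall>x\<in>Vp p. g p x x = 0" "\<forall>p. \<forall>y\<in>Vps p. g p y y = 0"
    using witt unfolding witt_structure_def by - (elim conjE, assumption)+
  then show "x \<in> Vp p \<Longrightarrow> g p x x = 0" "y \<in> Vps p \<Longrightarrow> g p y y = 0" by blast+
qed

lemma witt_positive:
  assumes "z \<in> Vq p" "g p z z = 0"
  shows "z = 0"
proof -
  have "\<forall>p. \<forall>z\<in>Vq p. z \<noteq> 0 \<longrightarrow> g p z z > 0"
    using witt unfolding witt_structure_def by (elim conjE)
  then show ?thesis using assms by (metis less_irrefl)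
qed

lemma witt_frame:
  shows "vfield_on A UNIV \<nu>" "vfield_on A UNIV \<nu>s" "\<nu> p \<in> Vp p" "\<nu>s p \<in> Vps p"
    "\<nu> p \<noteq> 0" "\<nu>s p \<noteq> 0" "g p (\<nu> p) (\<nu>s p) = 1"
proof -
  have "section_on A UNIV Vp \<nu>" "section_on A UNIV Vps \<nu>s"
    "\<forall>p. \<nu> p \<noteq> 0" "\<forall>p. \<nu>s p \<noteq> 0" "\<forall>p. g p (\<nu> p) (\<nu>s p) = 1"
    using witt unfolding witt_structure_def by - (elim conjE, assumption)+
  then show "vfield_on A UNIV \<nu>" "vfield_on A UNIV \<nu>s" "\<nu> p \<in> Vp p" "\<nu>s p \<in> Vps p"
    "\<nu> p \<noteq> 0" "\<nu>s p \<noteq> 0" "g p (\<nu> p) (\<nu>s p) = 1"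
    by (simp_all add: section_on_def)
qed

lemma \<nu>_near: "vfield_near A p \<nu>" and \<nu>s_near: "vfield_near A p \<nu>s"
  using vfield_on_near[OF witt_frame(1)] vfield_on_near[OF witt_frame(2)] by simp_all

abbreviation n :: "'a \<Rightarrow> 'b" where "n p \<equiv> coords (\<nu> p)"

abbreviation ns :: "'a \<Rightarrow> 'b" where "ns p \<equiv> coords (\<nu>s p)"

lemma frame_n: "p \<in> U \<Longrightarrow> \<partial> (n p) p = \<nu> p" and frame_ns: "p \<in> U \<Longrightarrow> \<partial> (ns p) p = \<nu>s p"
  by (simp_all add: vfield_near_frame[OF \<nu>_near] vfield_near_frame[OF \<nu>s_near])

definition horizontal :: "'a \<Rightarrow> 'b \<Rightarrow> bool" where
  "horizontal p u \<longleftrightarrow> \<partial> u p \<in> Vq p"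

lemma G_null_frame:
  assumes p: "p \<in> U"
  shows "G (\<phi> p) (n p) (n p) = 0" "G (\<phi> p) (ns p) (ns p) = 0"
    "G (\<phi> p) (n p) (ns p) = 1" "G (\<phi> p) (ns p) (n p) = 1"
  using witt_null(1)[OF witt_frame(3)] witt_null(2)[OF witt_frame(4)] witt_frame(7)
    G_sym[of "\<phi> p" "ns p" "n p"] p
  by (simp_all add: G_frame[OF p, symmetric] frame_n frame_ns)

lemma G_horizontal:
  assumes p: "p \<in> U" and u: "horizontal p u"
  shows "G (\<phi> p) (n p) u = 0" "G (\<phi> p) (ns p) u = 0" "G (\<phi> p) u (n p) = 0" "G (\<phi> p) u (ns p) = 0"
proof -
  have u: "\<partial> u p \<in> Vq p" using u by (simp add: horizontal_def)
  have "g p (\<nu> p + 0) (\<partial> u p) = 0" "g p (0 + \<nu>s p) (\<partial> u p) = 0"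
    using witt_orthogonal[OF witt_frame(3) _ u] witt_orthogonal[OF _ witt_frame(4) u]
      subspace_0[OF subbundle_subspace[OF Vp]] subspace_0[OF subbundle_subspace[OF Vps]] by blast+
  then show *: "G (\<phi> p) (n p) u = 0" "G (\<phi> p) (ns p) u = 0"
    by (simp_all only: add_0_left add_0_right G_frame[OF p, symmetric] frame_n[OF p] frame_ns[OF p])
  show "G (\<phi> p) u (n p) = 0" "G (\<phi> p) u (ns p) = 0"
    using * G_sym[of "\<phi> p" u] p by simp_all
qed

definition hproj :: "'a \<Rightarrow> 'b \<Rightarrow> 'b" where
  "hproj p a = a - G (\<phi> p) (ns p) a *\<^sub>R n p - G (\<phi> p) (n p) a *\<^sub>R ns p"

lemma hproj_decomposition:
  "a = hproj p a + G (\<phi> p) (ns p) a *\<^sub>R n p + G (\<phi> p) (n p) a *\<^sub>R ns p"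
  by (simp add: hproj_def)

lemma hcomp_frame:
  assumes p: "p \<in> U"
  shows "hcomp g \<nu> \<nu>s p (\<partial> a p) = \<partial> (hproj p a) p"
  unfolding hcomp_def hproj_def flat_frame[OF \<nu>_near p] flat_frame[OF \<nu>s_near p]
    linear_diff[OF linear_frame[OF p]] linear_cmul[OF linear_frame[OF p]] frame_n[OF p] frame_ns[OF p]
  by (rule refl)

text \<open>Pairing the Witt decomposition of a vector with \<open>\<nu>s\<close> and \<open>\<nu>\<close> reads off its components along \<open>\<nu>\<close>
  and \<open>\<nu>s\<close>.\<close>

lemma horizontal_hproj:
  assumes p: "p \<in> U"
  shows "horizontal p (hproj p a)"
proof -
  obtain x y z where xyz: "x \<in> Vp p" "y \<in> Vps p" "z \<in> Vq p" "\<partial> a p = x + y + z"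
    using witt_decomposition[OF frame_tangent[OF p]] by blast
  obtain r where r: "x = r *\<^sub>R \<nu> p" by (rule line_subbundle_multiple[OF Vp witt_frame(3,5) xyz(1)])
  obtain s where s: "y = s *\<^sub>R \<nu>s p" by (rule line_subbundle_multiple[OF Vps witt_frame(4,6) xyz(2)])
  have z: "\<partial> (coords z) p = z" by (rule tangent_frame[OF p Vq_tangent[OF xyz(3)]])
  then have h: "horizontal p (coords z)" using xyz by (simp add: horizontal_def)
  have "coords (\<partial> a p) = coords (r *\<^sub>R \<nu> p + s *\<^sub>R \<nu>s p + z)" using xyz r s by (simp only:)
  then have a: "a = r *\<^sub>R n p + s *\<^sub>R ns p + coords z"
    by (simp only: coords_frame[OF p] linear_add[OF linear_coords] linear_cmul[OF linear_coords])
  have "G (\<phi> p) (ns p) a = r" "G (\<phi> p) (n p) a = s"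
    unfolding a using G_null_frame[OF p] G_horizontal[OF p h] p by (simp_all add: G_bilinear_simps)
  then have "hproj p a = coords z" using a by (simp add: hproj_def)
  then show ?thesis using h by simp
qed

lemma horizontal_section:
  assumes "horizontal p u" "p \<in> U"
  obtains W X where "p \<in> W" "section_on A W Vq X" "X p = \<partial> u p"
  using subbundle_section_through[OF atlas] Vq assms unfolding horizontal_def by metis

text \<open>The torsion of two horizontal vectors lies in the null plane, hence is orthogonal to
  horizontal vectors.\<close>

lemma torsion_horizontal:
  assumes p: "p \<in> U" and u: "horizontal p u" and h: "horizontal p h"
  shows "G (\<phi> p) u (\<Gamma> p h u - \<Gamma> p u h) = 0"
proof -
  obtain W1 X where X: "p \<in> W1" "section_on A W1 Vq X" "X p = \<partial> h p"
    by (rule horizontal_section[OF h p])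
  obtain W2 Y where Y: "p \<in> W2" "section_on A W2 Vq Y" "Y p = \<partial> u p"
    by (rule horizontal_section[OF u p])
  let ?W = "W1 \<inter> W2"
  have "open ?W" using X Y by (auto simp: section_on_def vfield_on_def)
  then have XY: "section_on A ?W Vq X" "section_on A ?W Vq Y"
    using section_on_subset X(2) Y(2) by blast+
  obtain a b where "torsion A nabla X Y p = a *\<^sub>R \<nu> p + b *\<^sub>R \<nu>s p"
    using canonical XY X(1) Y(1) unfolding canonical_witt_connection_def by (meson IntI)
  moreover have "vfield_near A p X" "vfield_near A p Y"
    using X Y vfield_on_near unfolding section_on_def by blast+
  ultimately have "\<partial> (\<Gamma> p h u - \<Gamma> p u h) p = a *\<^sub>R \<nu> p + b *\<^sub>R \<nu>s p"
    using torsion_frame[of p X Y] p X Y by simp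
  then have "\<Gamma> p h u - \<Gamma> p u h = a *\<^sub>R n p + b *\<^sub>R ns p"
    using coords_frame[OF p, of "\<Gamma> p h u - \<Gamma> p u h"]
    by (simp only: linear_add[OF linear_coords] linear_cmul[OF linear_coords])
  then show ?thesis using G_horizontal[OF p u] p by (simp add: G_bilinear_simps)
qed

text \<open>The defining condition of \<open>witt_T\<close> has a solution because the metric is non-degenerate, so that the
  functional is represented by some vector, whose horizontal part represents it on \<open>Vq\<close>. The solution
  is unique because the metric is positive definite on \<open>Vq\<close>.\<close>

lemma witt_T_frame:
  assumes p: "p \<in> U" and N: "vfield_near A p N"
  shows "witt_T A g Vq N p (\<partial> u p) \<in> Vq p"
    and "horizontal p h \<Longrightarrow> g p (witt_T A g Vq N p (\<partial> u p)) (\<partial> h p)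
      = 1/2 * lie_metric A N g p (\<partial> u p) (\<partial> h p)"
proof -
  let ?P = "\<lambda>\<tau>. \<tau> \<in> Vq p \<and> (\<forall>y\<in>Vq p. g p \<tau> y = 1/2 * lie_metric A N g p (\<partial> u p) y)"
  have Vq_frame: "\<partial> (coords y) p = y" "horizontal p (coords y)" if "y \<in> Vq p" for y
    using tangent_frame[OF p Vq_tangent[OF that]] that by (simp_all add: horizontal_def)
  have dN: "linear (drep N p)" by (rule has_derivative_linear[OF rep_has_derivative[OF N p]])
  have "linear (\<lambda>a. 1/2 * lie_metric A N g p (\<partial> u p) (\<partial> a p))"
    unfolding lie_metric_frame[OF N p]
    by (rule linearI) (simp_all add: p G_bilinear_simps bilinear_radd[OF bilinear_dG]
        bilinear_rmul[OF bilinear_dG] linear_add[OF dN] linear_cmul[OF dN] algebra_simps)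
  from metric_represents[OF p this]
  obtain t where t: "G (\<phi> p) t a = 1/2 * lie_metric A N g p (\<partial> u p) (\<partial> a p)" for a
    by blast
  have "\<exists>!\<tau>. ?P \<tau>"
  proof (rule ex1I)
    show "?P (\<partial> (hproj p t) p)"
    proof (intro conjI ballI)
      show "\<partial> (hproj p t) p \<in> Vq p" using horizontal_hproj[OF p] by (simp add: horizontal_def)
      fix y assume y: "y \<in> Vq p"
      have "G (\<phi> p) (hproj p t) (coords y) = G (\<phi> p) t (coords y)"
        unfolding hproj_def using G_horizontal[OF p Vq_frame(2)[OF y]] p
        by (simp add: G_bilinear_simps)
      then show "g p (\<partial> (hproj p t) p) y = 1/2 * lie_metric A N g p (\<partial> u p) y"
        using t[of "coords y"] G_frame[OF p, of "hproj p t" "coords y"] Vq_frame(1)[OF y] by simp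
    qed
  next
    fix \<tau> assume \<tau>: "?P \<tau>"
    let ?s = "\<partial> (hproj p t) p"
    define d where "d = coords \<tau> - hproj p t"
    have dd: "\<partial> d p = \<tau> - ?s"
      unfolding d_def linear_diff[OF linear_frame[OF p]] using Vq_frame(1) \<tau> by simp
    have "?s \<in> Vq p" using horizontal_hproj[OF p] by (simp add: horizontal_def)
    then have dV: "\<partial> d p \<in> Vq p" unfolding dd using \<tau> subspace_diff[OF Vq_subspace] by blast
    have dh: "horizontal p d" using dV by (simp add: horizontal_def)
    have "g p \<tau> (\<partial> d p) = 1/2 * lie_metric A N g p (\<partial> u p) (\<partial> d p)" using \<tau> dV by blast
    moreover have "g p \<tau> (\<partial> d p) = G (\<phi> p) (coords \<tau>) d"
      using \<tau> G_frame[OF p, of "coords \<tau>" d] Vq_frame(1) by simp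
    ultimately have "G (\<phi> p) (coords \<tau>) d = G (\<phi> p) t d" by (simp only: t)
    moreover have "G (\<phi> p) (hproj p t) d = G (\<phi> p) t d"
      unfolding hproj_def using G_horizontal[OF p dh] p by (simp add: G_bilinear_simps)
    ultimately have "G (\<phi> p) d d = 0" unfolding d_def using p by (simp add: G_bilinear_simps)
    then have "\<partial> d p = 0" using witt_positive[OF dV] G_frame[OF p, of d d] by simp
    then show "\<tau> = ?s" using dd by simp
  qed
  from theI'[OF this] have *: "?P (witt_T A g Vq N p (\<partial> u p))" unfolding witt_T_def .
  then show "witt_T A g Vq N p (\<partial> u p) \<in> Vq p" by blast
  show "g p (witt_T A g Vq N p (\<partial> u p)) (\<partial> h p) = 1/2 * lie_metric A N g p (\<partial> u p) (\<partial> h p)"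
    if "horizontal p h" using * that by (simp add: horizontal_def)
qed

text \<open>Of the prescribed torsion of a null frame field and a horizontal vector, only the part in \<open>Vq\<close>
  survives the pairing with a horizontal vector.\<close>

lemma torsion_null:
  assumes p: "p \<in> U" and u: "horizontal p u"
  shows "G (\<phi> p) u (\<Gamma> p (n p) u - \<Gamma> p u (n p)) = 1/2 * lie_metric A \<nu> g p (\<partial> u p) (\<partial> u p)"
    and "G (\<phi> p) u (\<Gamma> p (ns p) u - \<Gamma> p u (ns p)) = 1/2 * lie_metric A \<nu>s g p (\<partial> u p) (\<partial> u p)"
proof -
  obtain W X where X: "p \<in> W" "section_on A W Vq X" "X p = \<partial> u p"
    by (rule horizontal_section[OF u p])
  have Xn: "vfield_near A p X" using X vfield_on_near unfolding section_on_def by blast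
  have key: "G (\<phi> p) u (\<Gamma> p (coords (N p)) u - \<Gamma> p u (coords (N p)))
      = 1/2 * lie_metric A N g p (\<partial> u p) (\<partial> u p)"
    if N: "vfield_near A p N"
      and T: "torsion A nabla N X p = a *\<^sub>R \<nu>s p - b *\<^sub>R \<nu> p + witt_T A g Vq N p (X p)"
    for N a b
  proof -
    define \<tau> where "\<tau> = witt_T A g Vq N p (\<partial> u p)"
    have \<tau>: "\<partial> (coords \<tau>) p = \<tau>" unfolding \<tau>_def
      by (rule tangent_frame[OF p Vq_tangent[OF witt_T_frame(1)[OF p N]]])
    have "\<partial> (\<Gamma> p (coords (N p)) u - \<Gamma> p u (coords (N p))) p = a *\<^sub>R \<nu>s p - b *\<^sub>R \<nu> p + \<tau>"
      using torsion_frame[OF N Xn p] T X(3) p by (simp add: \<tau>_def)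
    then have "\<Gamma> p (coords (N p)) u - \<Gamma> p u (coords (N p)) = a *\<^sub>R ns p - b *\<^sub>R n p + coords \<tau>"
      using coords_frame[OF p, of "\<Gamma> p (coords (N p)) u - \<Gamma> p u (coords (N p))"]
      by (simp only: linear_add[OF linear_coords] linear_diff[OF linear_coords]
          linear_cmul[OF linear_coords])
    then have "G (\<phi> p) u (\<Gamma> p (coords (N p)) u - \<Gamma> p u (coords (N p))) = G (\<phi> p) (coords \<tau>) u"
      using G_horizontal[OF p u] G_sym[of "\<phi> p" u "coords \<tau>"] p by (simp add: G_bilinear_simps)
    also have "\<dots> = 1/2 * lie_metric A N g p (\<partial> u p) (\<partial> u p)"
      using witt_T_frame(2)[OF p N u, of u] G_frame[OF p, of "coords \<tau>" u] \<tau>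
      by (simp add: \<tau>_def)
    finally show ?thesis .
  qed
  have "torsion A nabla \<nu> X p = ext_deriv A (flat g \<nu>) p (\<nu> p) (X p) *\<^sub>R \<nu>s p
          - (1/2 * lie_metric A X g p (\<nu> p) (\<nu>s p)) *\<^sub>R \<nu> p + witt_T A g Vq \<nu> p (X p)"
    using canonical X unfolding canonical_witt_connection_def by blast
  from key[OF \<nu>_near this]
  show "G (\<phi> p) u (\<Gamma> p (n p) u - \<Gamma> p u (n p)) = 1/2 * lie_metric A \<nu> g p (\<partial> u p) (\<partial> u p)" .
  define e where "e = ext_deriv A (flat g \<nu>s) p (\<nu>s p) (X p)"
  define m where "m = 1/2 * lie_metric A X g p (\<nu> p) (\<nu>s p)"
  have "torsion A nabla \<nu>s X p = e *\<^sub>R \<nu> p - m *\<^sub>R \<nu>s p + witt_T A g Vq \<nu>s p (X p)"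
    using canonical X unfolding canonical_witt_connection_def e_def m_def by blast
  then have "torsion A nabla \<nu>s X p = (- m) *\<^sub>R \<nu>s p - (- e) *\<^sub>R \<nu> p + witt_T A g Vq \<nu>s p (X p)"
    unfolding scaleR_minus_left by (simp only: diff_conv_add_uminus minus_minus add.commute)
  from key[OF \<nu>s_near this]
  show "G (\<phi> p) u (\<Gamma> p (ns p) u - \<Gamma> p u (ns p)) = 1/2 * lie_metric A \<nu>s g p (\<partial> u p) (\<partial> u p)" .
qed

text \<open>The acceleration of a horizontal curve is horizontal. Here \<open>u\<close> is the velocity, \<open>a\<close> the second
  derivative of the curve in the chart, and the last hypothesis is the derivative of \<open>g(u, N) = 0\<close>.
  By metric compatibility the claim is \<open>g(u, \<nabla>\<^bsub>u\<^esub> N) = 0\<close>. As \<open>\<nabla>\<^bsub>u\<^esub> N\<close> differs from the derivative of \<open>u\<close>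
  along \<open>N\<close> by torsion and bracket, \<open>g(u, \<nabla>\<^bsub>u\<^esub> N) = (L\<^bsub>N\<^esub> g)(u, u)/2 - g(T(N, u), u)\<close>, and the
  torsion hypothesis says that these two terms agree.\<close>

lemma acceleration_orthogonal:
  assumes p: "p \<in> U" and N: "vfield_near A p N"
    and T: "G (\<phi> p) u (\<Gamma> p (coords (N p)) u - \<Gamma> p u (coords (N p)))
      = 1/2 * lie_metric A N g p (\<partial> u p) (\<partial> u p)"
    and d: "dG p u u (coords (N p)) + G (\<phi> p) a (coords (N p)) + G (\<phi> p) u (drep N p u) = 0"
  shows "G (\<phi> p) (a + \<Gamma> p u u) (coords (N p)) = 0"
proof -
  have x: "\<phi> p \<in> \<phi> ` U" using p by simp
  have "dG p (coords (N p)) u u = 2 * G (\<phi> p) u (\<Gamma> p (coords (N p)) u)"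
    using metric_compatible_frame[OF p, of "coords (N p)" u u] G_sym[OF x] by simp
  then show ?thesis
    using T d metric_compatible_frame[OF p, of u u "coords (N p)"] G_sym[OF x, of u "drep N p u"]
    by (simp add: lie_metric_frame[OF N p] p G_bilinear_simps)
qed

text \<open>In coordinates the left-hand side is what remains of the difference of the derivative of
  \<open>g(u, u)/2\<close> along the variation and the derivative of \<open>g(u, w)\<close> along the curve, once the mixed
  second derivatives of the variation have cancelled.\<close>

lemma first_variation_kinetic:
  assumes p: "p \<in> U" and u: "horizontal p u"
    and d: "dG p u u (n p) + G (\<phi> p) a (n p) + G (\<phi> p) u (drep \<nu> p u) = 0"
    and ds: "dG p u u (ns p) + G (\<phi> p) a (ns p) + G (\<phi> p) u (drep \<nu>s p u) = 0"
  shows "1/2 * dG p w u u - dG p u u w - G (\<phi> p) a w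
    = - G (\<phi> p) (a + \<Gamma> p u u) (hproj p w)
      + G (\<phi> p) (ns p) w * (1/2 * lie_metric A \<nu> g p (\<partial> u p) (\<partial> u p))
      + G (\<phi> p) (n p) w * (1/2 * lie_metric A \<nu>s g p (\<partial> u p) (\<partial> u p))"
proof -
  let ?x = "\<phi> p" and ?\<sigma> = "G (\<phi> p) (ns p) w" and ?\<sigma>s = "G (\<phi> p) (n p) w" and ?h = "hproj p w"
  have x: "?x \<in> \<phi> ` U" using p by simp
  note blG = bilinear_ladd[OF bilinear_\<Gamma>[OF p]] bilinear_radd[OF bilinear_\<Gamma>[OF p]]
    bilinear_lmul[OF bilinear_\<Gamma>[OF p]] bilinear_rmul[OF bilinear_\<Gamma>[OF p]]
  define T where "T = (\<lambda>w. G ?x u (\<Gamma> p w u - \<Gamma> p u w))"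
  have lT: "T (v + v') = T v + T v'" "T (r *\<^sub>R v) = r * T v" for v v' r
    unfolding T_def by (simp_all add: p G_bilinear_simps blG algebra_simps)
  have "1/2 * dG p w u u = G ?x u (\<Gamma> p w u)"
    using metric_compatible_frame[OF p, of w u u] G_sym[OF x] by simp
  then have lhs: "1/2 * dG p w u u - dG p u u w - G ?x a w = T w - G ?x (a + \<Gamma> p u u) w"
    using metric_compatible_frame[OF p, of u u w] by (simp add: T_def p G_bilinear_simps)
  have "T w = T (?h + ?\<sigma> *\<^sub>R n p + ?\<sigma>s *\<^sub>R ns p)" by (simp only: hproj_decomposition[symmetric])
  also have "\<dots> = T ?h + ?\<sigma> * T (n p) + ?\<sigma>s * T (ns p)" by (simp only: lT)
  also have "\<dots> = ?\<sigma> * (1/2 * lie_metric A \<nu> g p (\<partial> u p) (\<partial> u p))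
      + ?\<sigma>s * (1/2 * lie_metric A \<nu>s g p (\<partial> u p) (\<partial> u p))"
    unfolding T_def torsion_horizontal[OF p u horizontal_hproj[OF p]] torsion_null[OF p u] by simp
  finally have Tw: "T w = \<dots>" .
  have "G ?x (a + \<Gamma> p u u) w = G ?x (a + \<Gamma> p u u) (?h + ?\<sigma> *\<^sub>R n p + ?\<sigma>s *\<^sub>R ns p)"
    by (simp only: hproj_decomposition[symmetric])
  also have "\<dots> = G ?x (a + \<Gamma> p u u) ?h"
    using acceleration_orthogonal[OF p \<nu>_near torsion_null(1)[OF p u] d]
      acceleration_orthogonal[OF p \<nu>s_near torsion_null(2)[OF p u] ds]
    by (simp only: bilinear_radd[OF bilinear_G[OF p]] bilinear_rmul[OF bilinear_G[OF p]]) simp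
  finally show ?thesis unfolding lhs Tw by simp
qed

text \<open>As \<open>g(N, M)\<close> is constant for \<open>N\<close>, \<open>M\<close> in the null frame, Cartan's formula reduces
  \<open>L\<^bsub>M\<^esub> g(N, \<cdot>)\<close> to the contraction of \<open>d g(N, \<cdot>)\<close> with \<open>M\<close>.\<close>

lemma ext_deriv_null:
  assumes p: "p \<in> U" and N: "vfield_near A p N" and M: "vfield_near A p M"
    and const: "\<And>q. g q (N q) (M q) = r"
  shows "ext_deriv A (flat g N) p (\<partial> u p) (\<partial> (coords (M p)) p)
    = - lie_form A M (flat g N) p (\<partial> u p)"
proof -
  have d: "((\<lambda>_. r) \<circ> \<psi> has_derivative (\<lambda>_. 0)) (at (\<phi> p))" by (simp add: comp_def)
  have "smooth_near A p (\<lambda>q. r)"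
    by (rule smooth_fun_on_smooth_near[OF smooth_fun_on_const[OF atlas open_U] p])
  from frame_eq[OF this p d] have "\<partial> u p (\<lambda>q. r) = 0" .
  then have "\<partial> u p (\<lambda>q. g q (N q) (M q)) = 0" by (simp only: const)
  then show ?thesis
    unfolding metric_vfields[OF N M p] ext_deriv_frame[OF N p] lie_form_frame[OF M N p] by simp
qed

lemma ext_deriv_decomposition:
  assumes p: "p \<in> U" and N: "vfield_near A p N"
    and const: "\<And>q. g q (N q) (\<nu> q) = r" "\<And>q. g q (N q) (\<nu>s q) = s"
  shows "ext_deriv A (flat g N) p (\<partial> u p) (\<partial> w p)
    = ext_deriv A (flat g N) p (\<partial> u p) (\<partial> (hproj p w) p)
      - G (\<phi> p) (ns p) w * lie_form A \<nu> (flat g N) p (\<partial> u p)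
      - G (\<phi> p) (n p) w * lie_form A \<nu>s (flat g N) p (\<partial> u p)"
proof -
  define E where "E = (\<lambda>w. ext_deriv A (flat g N) p (\<partial> u p) (\<partial> w p))"
  have dN: "linear (drep N p)" by (rule has_derivative_linear[OF rep_has_derivative[OF N p]])
  have lE: "E (v + v') = E v + E v'" "E (r *\<^sub>R v) = r * E v" for v v' r
    unfolding E_def ext_deriv_frame[OF N p]
    by (simp_all add: p G_bilinear_simps bilinear_radd[OF bilinear_dG] bilinear_rmul[OF bilinear_dG]
        linear_add[OF linear_dG] linear_cmul[OF linear_dG] linear_add[OF dN] linear_cmul[OF dN]
        algebra_simps)
  have "E w = E (hproj p w + G (\<phi> p) (ns p) w *\<^sub>R n p + G (\<phi> p) (n p) w *\<^sub>R ns p)"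
    by (simp only: hproj_decomposition[symmetric])
  also have "\<dots> = E (hproj p w) + G (\<phi> p) (ns p) w * E (n p) + G (\<phi> p) (n p) w * E (ns p)"
    by (simp only: lE)
  finally show ?thesis
    unfolding E_def ext_deriv_null[OF p N \<nu>_near const(1)] ext_deriv_null[OF p N \<nu>s_near const(2)]
    by simp
qed

end


section \<open>Variations in a chart\<close>

lemma smooth_on_slices:
  fixes k :: "real \<times> real \<Rightarrow> 'b::real_normed_vector"
  assumes k: "smooth_on W k" and z: "(s, t) \<in> W"
  shows "((\<lambda>r. k (r, t)) has_vector_derivative frechet_derivative k (at (s, t)) (1, 0)) (at s)"
    and "((\<lambda>r. k (s, r)) has_vector_derivative frechet_derivative k (at (s, t)) (0, 1)) (at t)"
proof -
  let ?k' = "frechet_derivative k (at (s, t))"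
  have k': "(k has_derivative ?k') (at (s, t))" by (rule smooth_on_has_derivative[OF k z])
  have 1: "((\<lambda>r. (r, t)) has_derivative (\<lambda>a. a *\<^sub>R (1, 0))) (at s)"
    and 2: "((\<lambda>r. (s, r)) has_derivative (\<lambda>a. a *\<^sub>R (0, 1))) (at t)"
    by (auto intro!: derivative_eq_intros)
  have *: "(\<lambda>a. ?k' (a *\<^sub>R v)) = (\<lambda>a. a *\<^sub>R ?k' v)" for v
    by (rule ext) (rule linear_cmul[OF has_derivative_linear[OF k']])
  show "((\<lambda>r. k (r, t)) has_vector_derivative ?k' (1, 0)) (at s)"
    using has_derivative_compose[OF 1 k'] unfolding has_vector_derivative_def * .
  show "((\<lambda>r. k (s, r)) has_vector_derivative ?k' (0, 1)) (at t)"
    using has_derivative_compose[OF 2 k'] unfolding has_vector_derivative_def * .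
qed

lemma eventually_slices:
  fixes W :: "(real \<times> real) set"
  assumes "open W" "(s, t) \<in> W"
  shows "\<forall>\<^sub>F r in at s within I. r \<in> I \<and> (r, t) \<in> W"
    and "\<forall>\<^sub>F r in at t within J. r \<in> J \<and> (s, r) \<in> W"
proof -
  have "open ((\<lambda>r. (r, t)) -` W)" "open ((\<lambda>r. (s, r)) -` W)"
    using assms(1) by (auto intro!: open_vimage continuous_intros)
  then show "\<forall>\<^sub>F r in at s within I. r \<in> I \<and> (r, t) \<in> W"
    "\<forall>\<^sub>F r in at t within J. r \<in> J \<and> (s, r) \<in> W"
    using assms(2) unfolding eventually_at_topological
    by (intro exI[of _ "(\<lambda>r. (r, t)) -` W"], simp, intro exI[of _ "(\<lambda>r. (s, r)) -` W"], simp)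
qed

lemma has_vector_derivative_transform_eventually:
  assumes "(f has_vector_derivative d) (at t within I)" "\<forall>\<^sub>F r in at t within I. f r = h r"
    "f t = h t" "t \<in> I"
  shows "(h has_vector_derivative d) (at t within I)"
  using assms unfolding has_vector_derivative_def by (rule has_derivative_transform_eventually)

lemma at_within_unit_interval: "t \<in> {0..1} \<Longrightarrow> at t within {0..1::real} \<noteq> bot"
  using connected_imp_perfect[of "{0..1::real}" t] trivial_limit_within[of t "{0..1}"]
  by (auto simp: atLeastAtMost_singleton_iff)

context chart
begin

lemma velocity_along:
  assumes t: "t \<in> I" "at t within I \<noteq> bot" and k: "(k has_vector_derivative d) (at t within I)"
    and kt: "k t \<in> \<phi> ` U" "\<gamma> t = \<psi> (k t)"
    and ev: "\<forall>\<^sub>F r in at t within I. k r \<in> \<phi> ` U \<and> \<gamma> r = \<psi> (k r)"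
  shows "velocity A I \<gamma> t = \<partial> d (\<gamma> t)"
proof (rule velocity_frame[OF t(2,1)])
  show "\<gamma> t \<in> U" using kt by simp
  have "isCont \<psi> (k t)"
    using continuous_psi kt(1) unfolding continuous_on_eq_continuous_at[OF open_range] by blast
  then have "((\<lambda>r. \<psi> (k r)) \<longlongrightarrow> \<psi> (k t)) (at t within I)"
    using has_vector_derivative_continuous[OF k] isCont_tendsto_compose
    unfolding continuous_within by blast
  then show "continuous (at t within I) \<gamma>"
    unfolding continuous_within kt(2)
    by (rule Lim_transform_eventually) (use ev in \<open>auto elim!: eventually_mono\<close>)
  show "(\<phi> \<circ> \<gamma> has_vector_derivative d) (at t within I)"
    by (rule has_vector_derivative_transform_eventually[OF k _ _ t(1)])
      (use ev kt in \<open>auto elim!: eventually_mono\<close>)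
qed

lemma smooth_map_in_chart:
  assumes F: "smooth_map_on A S F" and z: "z \<in> S" "F z \<in> U"
  obtains W y where "z \<in> W" "smooth_on W y" "y ` W \<subseteq> \<phi> ` U" "\<forall>x\<in>S \<inter> W. F x = \<psi> (y x)"
proof -
  obtain V H where V: "z \<in> V" "smooth_map_open A V H" "\<forall>x\<in>S \<inter> V. F x = H x"
    using F z(1) unfolding smooth_map_on_def by blast
  have "smooth_on (V \<inter> H -` U) (\<phi> \<circ> H)" using V(2) chart by (auto simp: smooth_map_open_def)
  then show thesis using V z by (intro that[of "V \<inter> H -` U" "\<phi> \<circ> H"]) auto
qed

end

text \<open>The map \<open>y\<close> is the variation read in the chart. Its domain \<open>W\<close> is open in the plane and may reach
  beyond the strip, so that partial derivatives at the boundary times are two-sided.\<close>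

locale variation_chart = witt_chart +
  fixes \<epsilon> :: real and F :: "real \<times> real \<Rightarrow> 'a" and W :: "(real \<times> real) set"
    and y :: "real \<times> real \<Rightarrow> 'b"
  assumes \<epsilon>: "\<epsilon> > 0" and y: "smooth_on W y" and y_range: "y ` W \<subseteq> \<phi> ` U"
    and F_y: "\<forall>z\<in>({-\<epsilon><..<\<epsilon>} \<times> {0..1}) \<inter> W. F z = \<psi> (y z)"
begin

abbreviation strip :: "(real \<times> real) set" where "strip \<equiv> {-\<epsilon><..<\<epsilon>} \<times> {0..1}"

definition ys :: "real \<times> real \<Rightarrow> 'b" where "ys z = frechet_derivative y (at z) (1, 0)"

definition yt :: "real \<times> real \<Rightarrow> 'b" where "yt z = frechet_derivative y (at z) (0, 1)"

lemma open_W: "open W" by (rule smooth_onD_open[OF y])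

lemma ys_smooth: "smooth_on W ys" and yt_smooth: "smooth_on W yt"
  unfolding ys_def yt_def by (rule smooth_on_frechet_derivative[OF y])+

lemma y_in: "z \<in> W \<Longrightarrow> y z \<in> \<phi> ` U"
  using y_range by blast

lemma F_in: "z \<in> strip \<Longrightarrow> z \<in> W \<Longrightarrow> F z \<in> U" and \<phi>_F: "z \<in> strip \<Longrightarrow> z \<in> W \<Longrightarrow> \<phi> (F z) = y z"
  using F_y y_in by auto

lemma velocity_t:
  assumes z: "(s, t) \<in> strip" "(s, t) \<in> W" and \<gamma>: "\<And>r. r \<in> {0..1} \<Longrightarrow> \<gamma> r = F (s, r)"
  shows "velocity A {0..1} \<gamma> t = \<partial> (yt (s, t)) (F (s, t))"
proof -
  have t: "t \<in> {0..1}" "s \<in> {-\<epsilon><..<\<epsilon>}" using z by auto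
  have "velocity A {0..1} \<gamma> t = \<partial> (yt (s, t)) (\<gamma> t)"
  proof (rule velocity_along[OF t(1) at_within_unit_interval[OF t(1)]])
    show "((\<lambda>r. y (s, r)) has_vector_derivative yt (s, t)) (at t within {0..1})"
      unfolding yt_def by (rule has_vector_derivative_at_within[OF smooth_on_slices(2)[OF y z(2)]])
    show "y (s, t) \<in> \<phi> ` U" by (rule y_in[OF z(2)])
    show "\<gamma> t = \<psi> (y (s, t))" using \<gamma> t z F_y by auto
    show "\<forall>\<^sub>F r in at t within {0..1}. y (s, r) \<in> \<phi> ` U \<and> \<gamma> r = \<psi> (y (s, r))"
      by (rule eventually_mono[OF eventually_slices(2)[OF open_W z(2)]])
        (use \<gamma> t F_y y_in in auto)
  qed
  then show ?thesis using \<gamma> t by simp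
qed

lemma velocity_s:
  assumes z: "(s, t) \<in> strip" "(s, t) \<in> W"
  shows "velocity A {-\<epsilon><..<\<epsilon>} (\<lambda>s. F (s, t)) s = \<partial> (ys (s, t)) (F (s, t))"
proof -
  have s: "t \<in> {0..1}" "s \<in> {-\<epsilon><..<\<epsilon>}" using z by auto
  show ?thesis
  proof (rule velocity_along[OF s(2)])
    show "at s within {-\<epsilon><..<\<epsilon>} \<noteq> bot"
      unfolding at_within_open[OF s(2) open_greaterThanLessThan] by simp
    show "((\<lambda>r. y (r, t)) has_vector_derivative ys (s, t)) (at s within {-\<epsilon><..<\<epsilon>})"
      unfolding ys_def by (rule has_vector_derivative_at_within[OF smooth_on_slices(1)[OF y z(2)]])
    show "y (s, t) \<in> \<phi> ` U" by (rule y_in[OF z(2)])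
    show "F (s, t) = \<psi> (y (s, t))" using z F_y by auto
    show "\<forall>\<^sub>F r in at s within {-\<epsilon><..<\<epsilon>}. y (r, t) \<in> \<phi> ` U \<and> F (r, t) = \<psi> (y (r, t))"
      by (rule eventually_mono[OF eventually_slices(1)[OF open_W z(2)]])
        (use s F_y y_in in auto)
  qed
qed

text \<open>With \<open>b = yt\<close> these two functions are the terms of the Lagrangian; with \<open>b = ys\<close> they are the terms
  of the function whose time derivative integrates to the boundary contribution.\<close>

definition pairing :: "(real \<times> real \<Rightarrow> 'b) \<Rightarrow> real \<times> real \<Rightarrow> real" where
  "pairing b z = G (y z) (yt z) (b z)"

definition weighted :: "('a \<Rightarrow> real) \<Rightarrow> 'a vfield \<Rightarrow> (real \<times> real \<Rightarrow> 'b) \<Rightarrow> real \<times> real \<Rightarrow> real"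
  where "weighted l N b z = l (\<psi> (y z)) * G (y z) (rep N (y z)) (b z)"

lemma rep_UNIV_smooth: "vfield_on A UNIV N \<Longrightarrow> smooth_on (\<phi> ` U) (rep N)"
  by (rule rep_smooth[OF vfield_on_subset[OF _ open_U]]) auto

lemma rep_y_smooth: "vfield_on A UNIV N \<Longrightarrow> smooth_on W (\<lambda>z. rep N (y z))"
  by (rule smooth_on_compose[OF rep_UNIV_smooth y y_in])

lemma l_y_smooth: "smooth_fun_on A UNIV l \<Longrightarrow> smooth_on W (\<lambda>z. l (\<psi> (y z)))"
  using smooth_on_compose[OF smooth_fun_onD_subset[OF smooth_fun_on_subset[OF _ open_U] order.refl]
      y y_in, of UNIV l]
  by (simp add: comp_def)

lemma pairing_smooth: "smooth_on W b \<Longrightarrow> smooth_on W (pairing b)"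
  unfolding pairing_def by (rule bilinear_family_compose_smooth[OF G_family y y_in yt_smooth])

lemma weighted_smooth:
  "smooth_fun_on A UNIV l \<Longrightarrow> vfield_on A UNIV N \<Longrightarrow> smooth_on W b \<Longrightarrow> smooth_on W (weighted l N b)"
  unfolding weighted_def
  by (intro smooth_on_mult l_y_smooth bilinear_family_compose_smooth[OF G_family y y_in rep_y_smooth])

lemma pairing_eq:
  assumes z: "z \<in> strip" "z \<in> W"
  shows "pairing b z = g (F z) (\<partial> (yt z) (F z)) (\<partial> (b z) (F z))"
  by (simp add: pairing_def G_frame[OF F_in[OF z]] \<phi>_F[OF z])

lemma weighted_eq:
  assumes z: "z \<in> strip" "z \<in> W" and N: "vfield_on A UNIV N"
  shows "weighted l N b z = l (F z) * flat g N (F z) (\<partial> (b z) (F z))"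
  unfolding weighted_def flat_frame[OF vfield_on_near[OF N UNIV_I] F_in[OF z]]
  using F_in[OF z] by (simp add: \<phi>_F[OF z, symmetric])

lemma y_has_derivative: "z \<in> W \<Longrightarrow> (y has_derivative frechet_derivative y (at z)) (at z)"
  by (rule smooth_on_has_derivative[OF y])

lemma pairing_derivative:
  assumes z: "z \<in> strip" "z \<in> W" and b: "smooth_on W b"
  shows "frechet_derivative (pairing b) (at z) h
    = dG (F z) (frechet_derivative y (at z) h) (yt z) (b z)
      + G (\<phi> (F z)) (frechet_derivative yt (at z) h) (b z)
      + G (\<phi> (F z)) (yt z) (frechet_derivative b (at z) h)"
  unfolding pairing_def[abs_def] \<phi>_F[OF z]
  by (rule fun_cong[OF frechet_derivative_at[OF bilinear_family_compose_has_derivative[OF G_family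
        UNIV_I y_has_derivative[OF z(2)] y_in[OF z(2)] smooth_on_has_derivative[OF yt_smooth z(2)]
        smooth_on_has_derivative[OF b z(2)]], symmetric]])

lemma weighted_derivative:
  assumes z: "z \<in> strip" "z \<in> W" and b: "smooth_on W b"
    and N: "vfield_on A UNIV N" and l: "smooth_fun_on A UNIV l"
  shows "frechet_derivative (weighted l N b) (at z) h
    = l (F z) * (dG (F z) (frechet_derivative y (at z) h) (coords (N (F z))) (b z)
        + G (\<phi> (F z)) (drep N (F z) (frechet_derivative y (at z) h)) (b z)
        + G (\<phi> (F z)) (coords (N (F z))) (frechet_derivative b (at z) h))
      + \<partial> (frechet_derivative y (at z) h) (F z) l * G (\<phi> (F z)) (coords (N (F z))) (b z)"
proof -
  let ?y' = "frechet_derivative y (at z)" and ?p = "F z"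
  have p: "?p \<in> U" "\<phi> ?p = y z" using F_in[OF z] \<phi>_F[OF z] by simp_all
  have N': "((\<lambda>z. rep N (y z)) has_derivative (\<lambda>h. drep N ?p (?y' h))) (at z)"
    using has_derivative_compose[OF y_has_derivative[OF z(2)]]
      rep_has_derivative[OF vfield_on_near[OF N UNIV_I] p(1)] unfolding p(2) by blast
  have l': "((\<lambda>z. l (\<psi> (y z))) has_derivative (\<lambda>h. \<partial> (?y' h) ?p l)) (at z)"
    using has_derivative_compose[OF y_has_derivative[OF z(2)]]
      smooth_near_has_derivative[OF smooth_fun_on_smooth_near[OF l UNIV_I] p(1)]
    unfolding p(2) comp_def by blast
  note has_derivative_mult[OF l' bilinear_family_compose_has_derivative[OF G_family UNIV_I
        y_has_derivative[OF z(2)] y_in[OF z(2)] N' smooth_on_has_derivative[OF b z(2)]]]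
  note frechet_derivative_at[OF this, symmetric]
  then show ?thesis
    unfolding weighted_def[abs_def] p(2)
    using p rep_phi[OF p(1), of N] psi_phi[OF p(1)] by simp
qed

lemma mixed_partials: "z \<in> W \<Longrightarrow>
  frechet_derivative yt (at z) (1, 0) = frechet_derivative ys (at z) (0, 1)"
  unfolding ys_def[abs_def] yt_def[abs_def] by (rule frechet_derivative_symmetric[OF y])

lemma horizontal_yt:
  assumes c: "\<And>r. r \<in> {0..1} \<Longrightarrow> c r = F (0, r)" and r: "r \<in> {0..1}" "(0, r) \<in> W"
    and hor: "velocity A {0..1} c r \<in> Vq (c r)"
  shows "horizontal (F (0, r)) (yt (0, r))"
  using velocity_t[of 0 r c] c r hor \<epsilon> by (simp add: horizontal_def)

text \<open>Differentiating the orthogonality of the velocity and \<open>N\<close> in \<open>t\<close> gives the hypothesis on the second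
  derivative in \<open>acceleration_orthogonal\<close>. Orthogonality is known only for times in the unit interval,
  so the derivative is one-sided at its ends.\<close>

lemma horizontal_derivative:
  assumes t: "t \<in> {0..1}" "(0, t) \<in> W" and N: "vfield_on A UNIV N"
    and N0: "\<And>r. r \<in> {0..1} \<Longrightarrow> (0, r) \<in> W
      \<Longrightarrow> G (\<phi> (F (0, r))) (yt (0, r)) (coords (N (F (0, r)))) = 0"
  defines "p \<equiv> F (0, t)" and "u \<equiv> yt (0, t)"
  shows "dG p u u (coords (N p)) + G (\<phi> p) (frechet_derivative yt (at (0, t)) (0, 1)) (coords (N p))
    + G (\<phi> p) u (drep N p u) = 0"
proof -
  let ?b = "\<lambda>z. rep N (y z)" and ?z = "(0, t)"
  have z: "?z \<in> strip" "?z \<in> W" using t \<epsilon> by auto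
  have b: "smooth_on W ?b" by (rule rep_y_smooth[OF N])
  have p: "p \<in> U" "\<phi> p = y ?z" using F_in[OF z] \<phi>_F[OF z] by (simp_all add: p_def)
  have zero: "pairing ?b (0, r) = 0" if "r \<in> {0..1}" "(0, r) \<in> W" for r
  proof -
    have r: "(0, r) \<in> strip" using that \<epsilon> by auto
    show ?thesis
      using N0[OF that] F_in[OF r that(2)] rep_phi[OF F_in[OF r that(2)], of N]
      by (simp add: pairing_def \<phi>_F[OF r that(2)])
  qed
  have "((\<lambda>r. 0) has_vector_derivative frechet_derivative (pairing ?b) (at ?z) (0, 1)) (at t within {0..1})"
    by (rule has_vector_derivative_transform_eventually[OF
          has_vector_derivative_at_within[OF smooth_on_slices(2)[OF pairing_smooth[OF b] z(2)]]
          eventually_mono[OF eventually_slices(2)[OF open_W z(2)]]])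
      (use zero t in auto)
  moreover have "((\<lambda>r. 0 :: real) has_vector_derivative 0) (at t within {0..1})" by simp
  ultimately have 0: "frechet_derivative (pairing ?b) (at ?z) (0, 1) = 0"
    using vector_derivative_unique_within[OF at_within_unit_interval[OF t(1)]] by blast
  have "(?b has_derivative (\<lambda>h. drep N p (frechet_derivative y (at ?z) h))) (at ?z)"
    using has_derivative_compose[OF y_has_derivative[OF z(2)]]
      rep_has_derivative[OF vfield_on_near[OF N UNIV_I] p(1)] unfolding p(2) by blast
  then have b': "frechet_derivative ?b (at ?z) (0, 1) = drep N p u"
    unfolding u_def yt_def by (rule fun_cong[OF frechet_derivative_at[symmetric]])
  show ?thesis
    using 0 pairing_derivative[OF z b, of "(0, 1)"] b' rep_phi[OF p(1), of N]
    by (simp add: p_def[symmetric] u_def[symmetric] yt_def[symmetric] p(2))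
qed

text \<open>The covariant derivative along a curve is computed at each time in a chosen chart, which has to be
  the one at hand.\<close>

lemma cov_deriv_along_frame:
  assumes c: "\<And>r. r \<in> {0..1} \<Longrightarrow> c r = F (0, r)" and t: "t \<in> {0..1}" "(0, t) \<in> W"
    and some: "(SOME ch. ch \<in> A \<and> c t \<in> fst ch) = (U, \<phi>)"
  defines "p \<equiv> F (0, t)" and "u \<equiv> yt (0, t)"
  shows "cov_deriv_along A nabla {0..1} c (velocity A {0..1} c) t
    = \<partial> (frechet_derivative yt (at (0, t)) (0, 1) + \<Gamma> p u u) p"
proof -
  let ?a = "frechet_derivative yt (at (0, t)) (0, 1)"
  have z: "(0, t) \<in> strip" "(0, t) \<in> W" using t \<epsilon> by auto
  have ct: "c t = p" using c t by (simp add: p_def)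
  have p: "p \<in> U" using F_in[OF z] by (simp add: p_def)
  have v: "velocity A {0..1} c r = \<partial> (yt (0, r)) (F (0, r))" if "r \<in> {0..1}" "(0, r) \<in> W" for r
    by (rule velocity_t) (use that c \<epsilon> in auto)
  have v_coord: "velocity A {0..1} c r (\<lambda>q. \<phi> q \<bullet> b) = yt (0, r) \<bullet> b"
    if "r \<in> {0..1}" "(0, r) \<in> W" for r b
    unfolding v[OF that] by (rule frame_coordinate) (use that \<epsilon> F_in in auto)
  have d: "vector_derivative (\<lambda>r. velocity A {0..1} c r (\<lambda>q. \<phi> q \<bullet> b)) (at t within {0..1}) = ?a \<bullet> b"
    for b
  proof (rule vector_derivative_within[OF at_within_unit_interval[OF t(1)]])
    have "((\<lambda>r. yt (0, r) \<bullet> b) has_vector_derivative ?a \<bullet> b) (at t within {0..1})"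
      by (rule bounded_linear.has_vector_derivative[OF bounded_linear_inner_left
            has_vector_derivative_at_within[OF smooth_on_slices(2)[OF yt_smooth z(2)]]])
    then show "((\<lambda>r. velocity A {0..1} c r (\<lambda>q. \<phi> q \<bullet> b)) has_vector_derivative ?a \<bullet> b)
        (at t within {0..1})"
      by (rule has_vector_derivative_transform_eventually[OF _
            eventually_mono[OF eventually_slices(2)[OF open_W z(2)]]])
        (use v_coord t in auto)
  qed
  have "cov_deriv_along A nabla {0..1} c (velocity A {0..1} c) t
    = (\<Sum>b\<in>Basis. (?a \<bullet> b) *\<^sub>R \<partial> b p + (u \<bullet> b) *\<^sub>R nabla p (\<partial> u p) (\<partial> b))"
    unfolding cov_deriv_along_def some Let_def prod.case
    unfolding d v[OF t] ct u_def p_def frame_coordinate[OF F_in[OF z]] by (rule refl)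
  also have "\<dots> = (\<Sum>b\<in>Basis. (?a \<bullet> b) *\<^sub>R \<partial> b p) + \<partial> (\<Gamma> p u u) p"
    unfolding frame_\<Gamma>[OF p] by (rule sum.distrib)
  also have "\<dots> = \<partial> ?a p + \<partial> (\<Gamma> p u u) p"
    unfolding linear_basis_expand[OF linear_frame[OF p], of ?a, symmetric] by (rule refl)
  also have "\<dots> = \<partial> (?a + \<Gamma> p u u) p" by (rule linear_add[OF linear_frame[OF p], symmetric])
  finally show ?thesis .
qed

lemma vector_derivative_along:
  assumes c: "\<And>r. r \<in> {0..1} \<Longrightarrow> c r = F (0, r)" and t: "t \<in> {0..1}" "(0, t) \<in> W"
    and l: "smooth_fun_on A UNIV l"
  shows "vector_derivative (\<lambda>r. l (c r)) (at t within {0..1}) = \<partial> (yt (0, t)) (F (0, t)) l"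
proof (rule vector_derivative_within[OF at_within_unit_interval[OF t(1)]])
  let ?z = "(0, t)"
  have z: "?z \<in> strip" "?z \<in> W" using t \<epsilon> by auto
  have p: "F ?z \<in> U" "\<phi> (F ?z) = y ?z" using F_in[OF z] \<phi>_F[OF z] by simp_all
  have "((\<lambda>z. l (\<psi> (y z))) has_derivative (\<lambda>h. \<partial> (frechet_derivative y (at ?z) h) (F ?z) l)) (at ?z)"
    using has_derivative_compose[OF y_has_derivative[OF z(2)]]
      smooth_near_has_derivative[OF smooth_fun_on_smooth_near[OF l UNIV_I] p(1)]
    unfolding p(2) comp_def by blast
  then have "frechet_derivative (\<lambda>z. l (\<psi> (y z))) (at ?z) (0, 1) = \<partial> (yt ?z) (F ?z) l"
    unfolding yt_def by (rule fun_cong[OF frechet_derivative_at[symmetric]])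
  then have "((\<lambda>r. l (\<psi> (y (0, r)))) has_vector_derivative \<partial> (yt ?z) (F ?z) l) (at t within {0..1})"
    using has_vector_derivative_at_within[OF smooth_on_slices(2)[OF l_y_smooth[OF l] z(2)]]
    by (simp only:)
  then show "((\<lambda>r. l (c r)) has_vector_derivative \<partial> (yt ?z) (F ?z) l) (at t within {0..1})"
    by (rule has_vector_derivative_transform_eventually[OF _
          eventually_mono[OF eventually_slices(2)[OF open_W z(2)]]])
      (use F_y \<epsilon> c t in auto)
qed

end


section \<open>The first variation formula\<close>

context variation_chart
begin

lemma lagrangian_in_chart:
  assumes "(s, t) \<in> strip" "(s, t) \<in> W"
  shows "g (F (s, t)) (velocity A {0..1} (\<lambda>t. F (s, t)) t) (velocity A {0..1} (\<lambda>t. F (s, t)) t)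
      = pairing yt (s, t)"
    and "vfield_on A UNIV N \<Longrightarrow>
      l (F (s, t)) * flat g N (F (s, t)) (velocity A {0..1} (\<lambda>t. F (s, t)) t)
      = weighted l N yt (s, t)"
  using velocity_t[OF assms, of "\<lambda>t. F (s, t)"] pairing_eq[OF assms, of yt]
    weighted_eq[OF assms, of N l yt] by simp_all

text \<open>The mixed second derivatives of the variation occur on both sides with the same coefficients and
  cancel. What remains is the kinetic identity and, for each of the two forms, its exterior derivative
  together with the derivative of its coefficient; the term containing the derivative of the
  coefficient along the variation vanishes because the velocity is horizontal.\<close>

lemma first_variation_coordinates:
  assumes t: "t \<in> {0..1}" "(0, t) \<in> W"
    and c: "\<And>r. r \<in> {0..1} \<Longrightarrow> c r = F (0, r)"
    and hor: "\<And>r. r \<in> {0..1} \<Longrightarrow> velocity A {0..1} c r \<in> Vq (c r)"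
    and l: "smooth_fun_on A UNIV l1" "smooth_fun_on A UNIV l2"
  defines "p \<equiv> F (0, t)" and "u \<equiv> yt (0, t)" and "w \<equiv> ys (0, t)"
    and "a \<equiv> frechet_derivative yt (at (0, t)) (0, 1)"
  shows "1/2 * frechet_derivative (pairing yt) (at (0, t)) (1, 0)
      - (frechet_derivative (weighted l1 \<nu>s yt) (at (0, t)) (1, 0)
        + frechet_derivative (weighted l2 \<nu> yt) (at (0, t)) (1, 0))
    = (- G (\<phi> p) (a + \<Gamma> p u u) (hproj p w)
        + l1 p * ext_deriv A (flat g \<nu>s) p (\<partial> u p) (\<partial> (hproj p w) p)
        + l2 p * ext_deriv A (flat g \<nu>) p (\<partial> u p) (\<partial> (hproj p w) p)
        + G (\<phi> p) (ns p) w * (\<partial> u p l1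
            - l1 p * lie_form A \<nu> (flat g \<nu>s) p (\<partial> u p)
            - l2 p * lie_form A \<nu> (flat g \<nu>) p (\<partial> u p)
            + 1/2 * lie_metric A \<nu> g p (\<partial> u p) (\<partial> u p))
        + G (\<phi> p) (n p) w * (\<partial> u p l2
            - l1 p * lie_form A \<nu>s (flat g \<nu>s) p (\<partial> u p)
            - l2 p * lie_form A \<nu>s (flat g \<nu>) p (\<partial> u p)
            + 1/2 * lie_metric A \<nu>s g p (\<partial> u p) (\<partial> u p)))
      + (frechet_derivative (pairing ys) (at (0, t)) (0, 1)
        - (frechet_derivative (weighted l1 \<nu>s ys) (at (0, t)) (0, 1)
          + frechet_derivative (weighted l2 \<nu> ys) (at (0, t)) (0, 1)))"
proof -
  have z: "(0, t) \<in> strip" "(0, t) \<in> W" using t \<epsilon> by auto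
  have p: "p \<in> U" unfolding p_def by (rule F_in[OF z])
  let ?x = "\<phi> p"
  define m where "m = frechet_derivative ys (at (0, t)) (0, 1)"
  have hor': "horizontal (F (0, r)) (yt (0, r))" "F (0, r) \<in> U" if "r \<in> {0..1}" "(0, r) \<in> W" for r
    using horizontal_yt[OF c that hor[OF that(1)]] F_in[of "(0, r)"] that \<epsilon> by auto
  have u: "horizontal p u" using hor'(1)[OF t] by (simp add: p_def u_def)
  note Gu = G_horizontal[OF p u]
  note N = witt_frame(1,2)
  note folds = p_def[symmetric] u_def[symmetric] w_def[symmetric] a_def[symmetric]
    m_def[symmetric] yt_def[of "(0, t)", symmetric] ys_def[of "(0, t)", symmetric]
    mixed_partials[OF z(2)]
  have d: "dG p u u (n p) + G ?x a (n p) + G ?x u (drep \<nu> p u) = 0"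
    using horizontal_derivative[OF t N(1) G_horizontal(3)[OF hor'(2) hor'(1)]]
    by (simp add: folds)
  have ds: "dG p u u (ns p) + G ?x a (ns p) + G ?x u (drep \<nu>s p u) = 0"
    using horizontal_derivative[OF t N(2) G_horizontal(4)[OF hor'(2) hor'(1)]]
    by (simp add: folds)
  have K: "frechet_derivative (pairing yt) (at (0, t)) (1, 0) = dG p w u u + 2 * G ?x u m"
    using pairing_derivative[OF z yt_smooth, of "(1, 0)"] G_sym[of ?x m u] p by (simp add: folds)
  have P: "frechet_derivative (pairing ys) (at (0, t)) (0, 1)
      = dG p u u w + G ?x a w + G ?x u m"
    using pairing_derivative[OF z ys_smooth, of "(0, 1)"] by (simp add: folds)
  have Ks: "frechet_derivative (weighted l1 \<nu>s yt) (at (0, t)) (1, 0)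
      = l1 p * (dG p w (ns p) u + G ?x (drep \<nu>s p w) u + G ?x (ns p) m)"
    using weighted_derivative[OF z yt_smooth N(2) l(1), of "(1, 0)"] Gu by (simp add: folds)
  have Kn: "frechet_derivative (weighted l2 \<nu> yt) (at (0, t)) (1, 0)
      = l2 p * (dG p w (n p) u + G ?x (drep \<nu> p w) u + G ?x (n p) m)"
    using weighted_derivative[OF z yt_smooth N(1) l(2), of "(1, 0)"] Gu by (simp add: folds)
  have Ps: "frechet_derivative (weighted l1 \<nu>s ys) (at (0, t)) (0, 1)
      = l1 p * (dG p u (ns p) w + G ?x (drep \<nu>s p u) w + G ?x (ns p) m) + \<partial> u p l1 * G ?x (ns p) w"
    using weighted_derivative[OF z ys_smooth N(2) l(1), of "(0, 1)"] by (simp add: folds)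
  have Pn: "frechet_derivative (weighted l2 \<nu> ys) (at (0, t)) (0, 1)
      = l2 p * (dG p u (n p) w + G ?x (drep \<nu> p u) w + G ?x (n p) m) + \<partial> u p l2 * G ?x (n p) w"
    using weighted_derivative[OF z ys_smooth N(1) l(2), of "(0, 1)"] by (simp add: folds)
  note kin = first_variation_kinetic[OF p u d ds, of w]
  have const: "g q (\<nu> q) (\<nu> q) = 0" "g q (\<nu> q) (\<nu>s q) = 1"
    "g q (\<nu>s q) (\<nu>s q) = 0" "g q (\<nu>s q) (\<nu> q) = 1" for q
    using witt_null(1)[OF witt_frame(3)] witt_null(2)[OF witt_frame(4)] witt_frame(7)[of q]
      g_sym[OF vfield_on_tangent[OF N(2) UNIV_I] vfield_on_tangent[OF N(1) UNIV_I]] by simp_all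
  have es: "dG p u (ns p) w + G ?x (drep \<nu>s p u) w - dG p w (ns p) u - G ?x (drep \<nu>s p w) u
    = ext_deriv A (flat g \<nu>s) p (\<partial> u p) (\<partial> (hproj p w) p)
      - G ?x (ns p) w * lie_form A \<nu> (flat g \<nu>s) p (\<partial> u p)
      - G ?x (n p) w * lie_form A \<nu>s (flat g \<nu>s) p (\<partial> u p)"
    using ext_deriv_decomposition[OF p \<nu>s_near const(4,3), of u w] ext_deriv_frame[OF \<nu>s_near p, of u w]
    by (simp only:)
  have en: "dG p u (n p) w + G ?x (drep \<nu> p u) w - dG p w (n p) u - G ?x (drep \<nu> p w) u
    = ext_deriv A (flat g \<nu>) p (\<partial> u p) (\<partial> (hproj p w) p)
      - G ?x (ns p) w * lie_form A \<nu> (flat g \<nu>) p (\<partial> u p)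
      - G ?x (n p) w * lie_form A \<nu>s (flat g \<nu>) p (\<partial> u p)"
    using ext_deriv_decomposition[OF p \<nu>_near const(1,2), of u w] ext_deriv_frame[OF \<nu>_near p, of u w]
    by (simp only:)
  have "1/2 * frechet_derivative (pairing yt) (at (0, t)) (1, 0)
      - (frechet_derivative (weighted l1 \<nu>s yt) (at (0, t)) (1, 0)
        + frechet_derivative (weighted l2 \<nu> yt) (at (0, t)) (1, 0))
      - (frechet_derivative (pairing ys) (at (0, t)) (0, 1)
        - (frechet_derivative (weighted l1 \<nu>s ys) (at (0, t)) (0, 1)
          + frechet_derivative (weighted l2 \<nu> ys) (at (0, t)) (0, 1)))
    = (1/2 * dG p w u u - dG p u u w - G ?x a w)
      + l1 p * (dG p u (ns p) w + G ?x (drep \<nu>s p u) w - dG p w (ns p) u - G ?x (drep \<nu>s p w) u)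
      + l2 p * (dG p u (n p) w + G ?x (drep \<nu> p u) w - dG p w (n p) u - G ?x (drep \<nu> p w) u)
      + \<partial> u p l1 * G ?x (ns p) w + \<partial> u p l2 * G ?x (n p) w"
    unfolding K P Ks Kn Ps Pn by (simp add: algebra_simps)
  then show ?thesis
    unfolding kin es en by (simp add: algebra_simps)
qed

text \<open>The number \<open>b\<close> is the time derivative of \<open>g(c', w) - \<alpha>(w)\<close>, which integrates to a boundary term.\<close>

lemma first_variation_pointwise:
  assumes t: "t \<in> {0..1}" "(0, t) \<in> W"
    and c: "\<And>r. r \<in> {0..1} \<Longrightarrow> c r = F (0, r)"
    and hor: "\<And>r. r \<in> {0..1} \<Longrightarrow> velocity A {0..1} c r \<in> Vq (c r)"
    and some: "(SOME ch. ch \<in> A \<and> c t \<in> fst ch) = (U, \<phi>)"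
    and l: "smooth_fun_on A UNIV l1" "smooth_fun_on A UNIV l2"
  defines "c' \<equiv> velocity A {0..1} c" and "w \<equiv> \<lambda>t. velocity A {-\<epsilon><..<\<epsilon>} (\<lambda>s. F (s, t)) 0"
    and "v \<equiv> \<lambda>s t. velocity A {0..1} (\<lambda>t. F (s, t)) t"
  shows "\<exists>b. ((\<lambda>t. g (c t) (c' t) (w t)
        - (l1 (c t) * flat g \<nu>s (c t) (w t) + l2 (c t) * flat g \<nu> (c t) (w t)))
      has_vector_derivative b) (at t within {0..1}) \<and>
    1/2 * deriv (\<lambda>s. g (F (s, t)) (v s t) (v s t)) 0
      - deriv (\<lambda>s. l1 (F (s, t)) * flat g \<nu>s (F (s, t)) (v s t)
          + l2 (F (s, t)) * flat g \<nu> (F (s, t)) (v s t)) 0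
    = (- g (c t) (cov_deriv_along A nabla {0..1} c c' t) (hcomp g \<nu> \<nu>s (c t) (w t))
        + l1 (c t) * ext_deriv A (flat g \<nu>s) (c t) (c' t) (hcomp g \<nu> \<nu>s (c t) (w t))
        + l2 (c t) * ext_deriv A (flat g \<nu>) (c t) (c' t) (hcomp g \<nu> \<nu>s (c t) (w t))
        + flat g \<nu>s (c t) (w t) *
            (vector_derivative (\<lambda>t. l1 (c t)) (at t within {0..1})
             - l1 (c t) * lie_form A \<nu> (flat g \<nu>s) (c t) (c' t)
             - l2 (c t) * lie_form A \<nu> (flat g \<nu>) (c t) (c' t)
             + 1/2 * lie_metric A \<nu> g (c t) (c' t) (c' t))
        + flat g \<nu> (c t) (w t) *
            (vector_derivative (\<lambda>t. l2 (c t)) (at t within {0..1})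
             - l1 (c t) * lie_form A \<nu>s (flat g \<nu>s) (c t) (c' t)
             - l2 (c t) * lie_form A \<nu>s (flat g \<nu>) (c t) (c' t)
             + 1/2 * lie_metric A \<nu>s g (c t) (c' t) (c' t))) + b"
proof -
  have strip: "(0, r) \<in> strip" if "r \<in> {0..1}" for r using that \<epsilon> by auto
  have z: "(0, t) \<in> strip" "(0, t) \<in> W" using strip t by auto
  have I: "0 \<in> {-\<epsilon><..<\<epsilon>}" using \<epsilon> by simp
  note N = witt_frame(1,2)
  let ?p = "F (0, t)" and ?D = "\<lambda>k. frechet_derivative k (at (0, t))"
  have p: "?p \<in> U" by (rule F_in[OF z])
  have ct: "c t = ?p" by (rule c[OF t(1)])
  have c'r: "c' r = \<partial> (yt (0, r)) (F (0, r))" if "r \<in> {0..1}" "(0, r) \<in> W" for r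
    unfolding c'_def by (rule velocity_t[OF strip[OF that(1)] that(2) c])
  have wr: "w r = \<partial> (ys (0, r)) (F (0, r))" if "r \<in> {0..1}" "(0, r) \<in> W" for r
    unfolding w_def by (rule velocity_s[OF strip[OF that(1)] that(2)])
  define B where "B = (\<lambda>z. pairing ys z - (weighted l1 \<nu>s ys z + weighted l2 \<nu> ys z))"
  define b where "b = ?D (pairing ys) (0, 1)
    - (?D (weighted l1 \<nu>s ys) (0, 1) + ?D (weighted l2 \<nu> ys) (0, 1))"
  have sm: "smooth_on W (pairing ys)" "smooth_on W (weighted l1 \<nu>s ys)" "smooth_on W (weighted l2 \<nu> ys)"
    by (rule pairing_smooth[OF ys_smooth] weighted_smooth[OF l(1) N(2) ys_smooth]
        weighted_smooth[OF l(2) N(1) ys_smooth])+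
  have "((\<lambda>r. B (0, r)) has_vector_derivative b) (at t)"
    unfolding B_def b_def
    by (intro has_vector_derivative_diff has_vector_derivative_add smooth_on_slices(2)[OF _ z(2)] sm)
  then have b': "((\<lambda>r. B (0, r)) has_vector_derivative b) (at t within {0..1})"
    by (rule has_vector_derivative_at_within)
  have B: "B (0, r) = g (c r) (c' r) (w r)
        - (l1 (c r) * flat g \<nu>s (c r) (w r) + l2 (c r) * flat g \<nu> (c r) (w r))"
    if r: "r \<in> {0..1}" "(0, r) \<in> W" for r
    unfolding B_def c[OF r(1)] c'r[OF r] wr[OF r]
      pairing_eq[OF strip[OF r(1)] r(2)] weighted_eq[OF strip[OF r(1)] r(2) N(1)]
      weighted_eq[OF strip[OF r(1)] r(2) N(2)] by (rule refl)
  from b' have 1: "((\<lambda>t. g (c t) (c' t) (w t)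
        - (l1 (c t) * flat g \<nu>s (c t) (w t) + l2 (c t) * flat g \<nu> (c t) (w t)))
      has_vector_derivative b) (at t within {0..1})"
    by (rule has_vector_derivative_transform_eventually[OF _
          eventually_mono[OF eventually_slices(2)[OF open_W z(2)]]]) (use B t in auto)
  have e1: "\<forall>x\<in>strip \<inter> W. (case x of (s, t) \<Rightarrow> g (F (s, t)) (v s t) (v s t)) = pairing yt x"
    by (auto simp: v_def lagrangian_in_chart(1))
  have d1: "deriv (\<lambda>s. g (F (s, t)) (v s t) (v s t)) 0 = ?D (pairing yt) (1, 0)"
    by (rule DERIV_imp_deriv)
      (rule partial_derivative_of_extension[OF pairing_smooth[OF yt_smooth] z(2) I t(1)
          open_greaterThanLessThan e1, unfolded prod.case])
  have sw: "smooth_on W (\<lambda>z. weighted l1 \<nu>s yt z + weighted l2 \<nu> yt z)"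
    by (intro smooth_on_add weighted_smooth l N yt_smooth)
  have "((\<lambda>z. weighted l1 \<nu>s yt z + weighted l2 \<nu> yt z) has_derivative
      (\<lambda>h. ?D (weighted l1 \<nu>s yt) h + ?D (weighted l2 \<nu> yt) h)) (at (0, t))"
    by (intro has_derivative_add smooth_on_has_derivative[OF _ z(2)] weighted_smooth l N yt_smooth)
  then have Dw: "?D (\<lambda>z. weighted l1 \<nu>s yt z + weighted l2 \<nu> yt z) (1, 0)
      = ?D (weighted l1 \<nu>s yt) (1, 0) + ?D (weighted l2 \<nu> yt) (1, 0)"
    by (rule fun_cong[OF frechet_derivative_at[symmetric]])
  have e2: "\<forall>x\<in>strip \<inter> W. (case x of (s, t) \<Rightarrow> l1 (F (s, t)) * flat g \<nu>s (F (s, t)) (v s t)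
      + l2 (F (s, t)) * flat g \<nu> (F (s, t)) (v s t)) = weighted l1 \<nu>s yt x + weighted l2 \<nu> yt x"
    by (auto simp: v_def lagrangian_in_chart(2) N)
  have d2: "deriv (\<lambda>s. l1 (F (s, t)) * flat g \<nu>s (F (s, t)) (v s t)
          + l2 (F (s, t)) * flat g \<nu> (F (s, t)) (v s t)) 0
      = ?D (weighted l1 \<nu>s yt) (1, 0) + ?D (weighted l2 \<nu> yt) (1, 0)"
    unfolding Dw[symmetric]
    by (rule DERIV_imp_deriv)
      (rule partial_derivative_of_extension[OF sw z(2) I t(1) open_greaterThanLessThan e2,
          unfolded prod.case])
  have cov: "cov_deriv_along A nabla {0..1} c c' t
      = \<partial> (?D yt (0, 1) + \<Gamma> ?p (yt (0, t)) (yt (0, t))) ?p"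
    unfolding c'_def by (rule cov_deriv_along_frame[OF c t some])
  have l': "vector_derivative (\<lambda>t. l1 (c t)) (at t within {0..1}) = \<partial> (yt (0, t)) ?p l1"
    "vector_derivative (\<lambda>t. l2 (c t)) (at t within {0..1}) = \<partial> (yt (0, t)) ?p l2"
    by (rule vector_derivative_along[OF c t l(1)], assumption, rule vector_derivative_along[OF c t l(2)])
  show ?thesis
  proof (intro exI[of _ b] conjI 1)
    show "1/2 * deriv (\<lambda>s. g (F (s, t)) (v s t) (v s t)) 0
      - deriv (\<lambda>s. l1 (F (s, t)) * flat g \<nu>s (F (s, t)) (v s t)
          + l2 (F (s, t)) * flat g \<nu> (F (s, t)) (v s t)) 0
    = (- g (c t) (cov_deriv_along A nabla {0..1} c c' t) (hcomp g \<nu> \<nu>s (c t) (w t))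
        + l1 (c t) * ext_deriv A (flat g \<nu>s) (c t) (c' t) (hcomp g \<nu> \<nu>s (c t) (w t))
        + l2 (c t) * ext_deriv A (flat g \<nu>) (c t) (c' t) (hcomp g \<nu> \<nu>s (c t) (w t))
        + flat g \<nu>s (c t) (w t) *
            (vector_derivative (\<lambda>t. l1 (c t)) (at t within {0..1})
             - l1 (c t) * lie_form A \<nu> (flat g \<nu>s) (c t) (c' t)
             - l2 (c t) * lie_form A \<nu> (flat g \<nu>) (c t) (c' t)
             + 1/2 * lie_metric A \<nu> g (c t) (c' t) (c' t))
        + flat g \<nu> (c t) (w t) *
            (vector_derivative (\<lambda>t. l2 (c t)) (at t within {0..1})
             - l1 (c t) * lie_form A \<nu>s (flat g \<nu>s) (c t) (c' t)
             - l2 (c t) * lie_form A \<nu>s (flat g \<nu>) (c t) (c' t)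
             + 1/2 * lie_metric A \<nu>s g (c t) (c' t) (c' t))) + b"
      unfolding d1 d2 cov l'
        wr[OF t] c'r[OF t] ct hcomp_frame[OF p] flat_frame[OF \<nu>_near p] flat_frame[OF \<nu>s_near p]
        G_frame[OF p] b_def
      by (rule first_variation_coordinates[OF t c hor l])
  qed
qed

end

lemma smooth_fun_on_bounded_linear:
  assumes "bounded_linear L" "smooth_fun_on A W f"
  shows "smooth_fun_on A W (\<lambda>q. L (f q))"
  using assms(2) unfolding smooth_fun_on_def comp_def
  by (auto intro!: smooth_on_bounded_linear[OF assms(1)])

theorem proposition4p2:
  fixes A :: "('m::{t2_space,second_countable_topology}, 'e::euclidean_space) atlas"
    and g :: "'m bilform"
    and Vp Vps Vq :: "'m \<Rightarrow> 'm tvec set"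
    and \<nu> \<nu>s :: "'m vfield"
    and \<sigma> \<sigma>s :: "'m oneform"
    and nabla :: "'m connection"
    and lam :: "'m \<Rightarrow> real \<times> real"
    and lam1 lam2 :: "real \<Rightarrow> real"
    and x y :: 'm
    and c :: "real \<Rightarrow> 'm"
    and \<epsilon> :: real
    and F :: "real \<times> real \<Rightarrow> 'm"
    and c' w wH :: "real \<Rightarrow> 'm tvec"
  assumes "smooth_atlas A"
    and "lorentzian_metric A g"
    and "witt_structure A g Vp Vps Vq \<nu> \<nu>s"
    and "canonical_witt_connection A g Vq \<nu> \<nu>s nabla"
    and "smooth_fun_on A UNIV lam"
    and "c \<in> horizontal_curves A Vq x y"
    and "fixed_endpoint_variation A c \<epsilon> F"
    and sigma: "\<sigma> = flat g \<nu>s" "\<sigma>s = flat g \<nu>"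
    and lam_c: "lam1 = (\<lambda>t. fst (lam (c t)))" "lam2 = (\<lambda>t. snd (lam (c t)))"
    and c': "c' = velocity A {0..1} c"
    and w: "w = (\<lambda>t. velocity A {-\<epsilon><..<\<epsilon>} (\<lambda>s. F (s, t)) 0)"
    and wH: "wH = (\<lambda>t. hcomp g \<nu> \<nu>s (c t) (w t))"
  shows "((\<lambda>s. energy A g \<nu> \<nu>s lam (\<lambda>t. F (s, t))) has_real_derivative
      integral {0..1} (\<lambda>t.
        - g (c t) (cov_deriv_along A nabla {0..1} c c' t) (wH t)
        + lam1 t * ext_deriv A \<sigma> (c t) (c' t) (wH t)
        + lam2 t * ext_deriv A \<sigma>s (c t) (c' t) (wH t)
        + \<sigma> (c t) (w t) *
            (vector_derivative lam1 (at t within {0..1})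
             - lam1 t * lie_form A \<nu> \<sigma> (c t) (c' t)
             - lam2 t * lie_form A \<nu> \<sigma>s (c t) (c' t)
             + 1/2 * lie_metric A \<nu> g (c t) (c' t) (c' t))
        + \<sigma>s (c t) (w t) *
            (vector_derivative lam2 (at t within {0..1})
             - lam1 t * lie_form A \<nu>s \<sigma> (c t) (c' t)
             - lam2 t * lie_form A \<nu>s \<sigma>s (c t) (c' t)
             + 1/2 * lie_metric A \<nu>s g (c t) (c' t) (c' t)))) (at 0)"
  (is "(_ has_real_derivative integral {0..1} ?I) _")
proof -
  have \<epsilon>: "\<epsilon> > 0" and F: "smooth_map_on A ({-\<epsilon><..<\<epsilon>} \<times> {0..1}) F"
    and F0: "\<And>t. t \<in> {0..1} \<Longrightarrow> c t = F (0, t)"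
    and ends: "\<And>s. s \<in> {-\<epsilon><..<\<epsilon>} \<Longrightarrow> F (s, 0) = c 0 \<and> F (s, 1) = c 1"
    using assms(7) by (simp_all add: fixed_endpoint_variation_def)
  have hor: "velocity A {0..1} c t \<in> Vq (c t)" if "t \<in> {0..1}" for t
    using assms(6) that by (simp add: horizontal_curves_def)
  let ?S = "{-\<epsilon><..<\<epsilon>} \<times> {0..1::real}"
  define l1 l2 where "l1 = (\<lambda>q. fst (lam q))" and "l2 = (\<lambda>q. snd (lam q))"
  have l: "smooth_fun_on A UNIV l1" "smooth_fun_on A UNIV l2"
    unfolding l1_def l2_def
    by (rule smooth_fun_on_bounded_linear[OF bounded_linear_fst assms(5)],
        rule smooth_fun_on_bounded_linear[OF bounded_linear_snd assms(5)])
  have witt_chart: "witt_chart A U \<phi> g nabla Vp Vps Vq \<nu> \<nu>s" if "(U, \<phi>) \<in> A" for U \<phi>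
    using assms(1-4) that by unfold_locales (auto simp: canonical_witt_connection_def)
  have in_chart: "\<exists>W y. z \<in> W \<and> variation_chart A U \<phi> g nabla Vp Vps Vq \<nu> \<nu>s \<epsilon> F W y"
    if U: "(U, \<phi>) \<in> A" and z: "z \<in> ?S" "F z \<in> U" for U \<phi> z
  proof -
    interpret witt_chart A U \<phi> g nabla Vp Vps Vq \<nu> \<nu>s by (rule witt_chart[OF U])
    obtain W y where "z \<in> W" "smooth_on W y" "y ` W \<subseteq> \<phi> ` U" "\<forall>x\<in>?S \<inter> W. F x = \<psi> (y x)"
      by (rule smooth_map_in_chart[OF F z])
    then have "variation_chart A U \<phi> g nabla Vp Vps Vq \<nu> \<nu>s \<epsilon> F W y"
      using \<epsilon> by (intro variation_chart.intro[OF witt_chart_axioms] variation_chart_axioms.intro)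
    then show ?thesis using \<open>z \<in> W\<close> by blast
  qed
  define v where "v = (\<lambda>s t. velocity A {0..1} (\<lambda>t. F (s, t)) t)"
  define h1 where "h1 = (\<lambda>(s, t). g (F (s, t)) (v s t) (v s t))"
  define h2 where "h2 = (\<lambda>(s, t). l1 (F (s, t)) * flat g \<nu>s (F (s, t)) (v s t)
      + l2 (F (s, t)) * flat g \<nu> (F (s, t)) (v s t))"
  \<comment> \<open>In a chart the integrands of both integrals in the energy have smooth extensions.\<close>
  have ext: "\<exists>W k1 k2. z \<in> W \<and> smooth_on W k1 \<and> smooth_on W k2
      \<and> (\<forall>x\<in>?S \<inter> W. h1 x = k1 x \<and> h2 x = k2 x)" if z: "z \<in> ?S" for z
  proof -
    obtain U \<phi> where U: "(U, \<phi>) \<in> A" "F z \<in> U"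
      using obtain_chart[OF assms(1), of "F z"] chart.chart by metis
    obtain W y where W: "z \<in> W" "variation_chart A U \<phi> g nabla Vp Vps Vq \<nu> \<nu>s \<epsilon> F W y"
      using in_chart[OF U(1) z U(2)] by blast
    interpret variation_chart A U \<phi> g nabla Vp Vps Vq \<nu> \<nu>s \<epsilon> F W y by (rule W(2))
    show ?thesis
      using W(1) lagrangian_in_chart(1) lagrangian_in_chart(2)[OF _ _ witt_frame(1)]
        lagrangian_in_chart(2)[OF _ _ witt_frame(2)]
      by (intro exI[of _ W] exI[of _ "pairing yt"]
          exI[of _ "\<lambda>z. weighted l1 \<nu>s yt z + weighted l2 \<nu> yt z"] conjI pairing_smooth smooth_on_add
          weighted_smooth l witt_frame(1,2) yt_smooth)
        (auto simp: h1_def h2_def v_def)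
  qed
  have ls: "locally_smooth_on ?S h1" "locally_smooth_on ?S h2"
    unfolding locally_smooth_on_def using ext by meson+
  note D1 = locally_smooth_on_parametric_integral[OF ls(1) \<epsilon>]
    and D2 = locally_smooth_on_parametric_integral[OF ls(2) \<epsilon>]
  let ?d1 = "\<lambda>t. deriv (\<lambda>s. h1 (s, t)) 0" and ?d2 = "\<lambda>t. deriv (\<lambda>s. h2 (s, t)) 0"
  have energy: "(\<lambda>s. energy A g \<nu> \<nu>s lam (\<lambda>t. F (s, t)))
      = (\<lambda>s. 1/2 * integral {0..1} (\<lambda>t. h1 (s, t)) - integral {0..1} (\<lambda>t. h2 (s, t)))"
    by (simp add: energy_def h1_def h2_def v_def l1_def l2_def)
  have deriv: "((\<lambda>s. energy A g \<nu> \<nu>s lam (\<lambda>t. F (s, t))) has_real_derivative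
      1/2 * integral {0..1} ?d1 - integral {0..1} ?d2) (at 0)"
    unfolding energy by (intro DERIV_diff DERIV_cmult D1(1) D2(1))
  define B where "B = (\<lambda>t. g (c t) (c' t) (w t)
        - (l1 (c t) * flat g \<nu>s (c t) (w t) + l2 (c t) * flat g \<nu> (c t) (w t)))"
  \<comment> \<open>At each time the calculation takes place in the chart chosen by \<open>cov_deriv_along\<close>.\<close>
  have pointwise: "\<exists>b. (B has_vector_derivative b) (at t within {0..1})
      \<and> 1/2 * ?d1 t - ?d2 t = ?I t + b" if t: "t \<in> {0..1}" for t
  proof -
    obtain U \<phi> where some: "(SOME ch. ch \<in> A \<and> c t \<in> fst ch) = (U, \<phi>)" by fastforce
    obtain U' \<phi>' where "(U', \<phi>') \<in> A" "c t \<in> U'"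
      using obtain_chart[OF assms(1), of "c t"] chart.chart by metis
    then have "\<exists>ch. ch \<in> A \<and> c t \<in> fst ch" by auto
    from someI_ex[OF this] have U: "(U, \<phi>) \<in> A" "c t \<in> U" by (simp_all add: some)
    have z: "(0, t) \<in> ?S" "F (0, t) \<in> U" using t \<epsilon> U(2) F0[OF t] by auto
    obtain W y where W: "(0, t) \<in> W" "variation_chart A U \<phi> g nabla Vp Vps Vq \<nu> \<nu>s \<epsilon> F W y"
      using in_chart[OF U(1) z] by blast
    show ?thesis
      using variation_chart.first_variation_pointwise[OF W(2) t W(1) F0 hor some l]
      unfolding B_def sigma lam_c c' w wH h1_def h2_def v_def l1_def l2_def prod.case .
  qed
  then obtain b where b: "(B has_vector_derivative b t) (at t within {0..1})"
    "1/2 * ?d1 t - ?d2 t = ?I t + b t" if "t \<in> {0..1}" for t by metis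
  \<comment> \<open>At the end points the variation is constant in \<open>s\<close>, so \<open>w\<close> vanishes there.\<close>
  have w0: "B t = 0" if t: "t = 0 \<or> t = 1" for t
  proof -
    have t01: "t \<in> {0..1}" using t by auto
    obtain U \<phi> where U: "(U, \<phi>) \<in> A" "c t \<in> U"
      using obtain_chart[OF assms(1), of "c t"] chart.chart by metis
    interpret witt_chart A U \<phi> g nabla Vp Vps Vq \<nu> \<nu>s by (rule witt_chart[OF U(1)])
    have 0: "0 \<in> {-\<epsilon><..<\<epsilon>}" using \<epsilon> by simp
    have const: "F (s, t) = \<psi> (\<phi> (c t))" if "s \<in> {-\<epsilon><..<\<epsilon>}" for s
      using ends[OF that] t U by auto
    have "velocity A {-\<epsilon><..<\<epsilon>} (\<lambda>s. F (s, t)) 0 = frame 0 (F (0, t))"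
    proof (rule velocity_along[OF 0])
      show "at 0 within {-\<epsilon><..<\<epsilon>} \<noteq> bot"
        unfolding at_within_open[OF 0 open_greaterThanLessThan] by simp
      show "\<forall>\<^sub>F r in at 0 within {-\<epsilon><..<\<epsilon>}. \<phi> (c t) \<in> \<phi> ` U \<and> F (r, t) = \<psi> (\<phi> (c t))"
        using const U(2) unfolding eventually_at_filter by (auto intro: always_eventually)
    qed (use const[OF 0] U in auto)
    then have w: "w t = frame 0 (c t)" unfolding w F0[OF t01] .
    have "frame (coords (c' t)) (c t) = c' t"
      unfolding c' by (rule tangent_frame[OF U(2) Vq_tangent[OF hor[OF t01]]])
    then have "g (c t) (c' t) (w t) = 0"
      using G_frame[OF U(2), of "coords (c' t)" 0] w bilinear_rzero[OF bilinear_G[OF U(2)]] by simp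
    then show ?thesis
      unfolding B_def w flat_frame[OF \<nu>_near U(2)] flat_frame[OF \<nu>s_near U(2)]
      by (simp add: bilinear_rzero[OF bilinear_G[OF U(2)]])
  qed
  \<comment> \<open>The fundamental theorem of calculus does not ask \<open>b\<close> to be continuous. Hence the claimed integrand
    inherits integrability from the derivative of the Lagrangian and from \<open>b\<close>.\<close>
  have B: "(b has_integral 0) {0..1}"
    using fundamental_theorem_of_calculus[of 0 1 B b] b(1) w0[of 0] w0[of 1] by simp
  have "((\<lambda>t. 1/2 * ?d1 t - ?d2 t) has_integral
      1/2 * integral {0..1} ?d1 - integral {0..1} ?d2) {0..1}"
    by (intro has_integral_diff has_integral_mult_right integrable_integral D1(2) D2(2))
  from has_integral_diff[OF this B]
  have "((\<lambda>t. 1/2 * ?d1 t - ?d2 t - b t) has_integral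
      1/2 * integral {0..1} ?d1 - integral {0..1} ?d2) {0..1}" by simp
  then have "(?I has_integral 1/2 * integral {0..1} ?d1 - integral {0..1} ?d2) {0..1}"
    by (rule has_integral_eq[rotated]) (simp only: b(2) add_diff_cancel_right')
  then have "integral {0..1} ?I = 1/2 * integral {0..1} ?d1 - integral {0..1} ?d2"
    by (rule integral_unique)
  then show ?thesis using deriv by (simp only:)
qed

end
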